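(* The automorphism group $\mathrm{Aut}(\mathbb{L}_<)$, with the compact-open topology, is extremely amenable.
   Context: Fans: a fan is a finite acyclic undirected connected simple graph with a distinguished root such that all non-root vertices have degree at most 2; $\preceq$ is the tree order ($s\preceq t$ iff $s$ is on the path from $t$ to the root); branches are maximal $\preceq$-chains, of height = number of vertices minus one. $\mathcal{F}_<$ is the class of finite structures $(A,R^A,S^A)$ (discrete topology) where $A$ is a fan with all branches of equal height, $R^A(s,t)$ iff $s=t$ or $t$ is an immediate successor of $s$, and for some enumeration $a_1<\cdots<a_n$ of the branches, $S^A(x,y)$ iff $x\in a_i,y\in a_j$ for some $i\le j$. For topological structures in the language $\{R,S\}$ (compact zero-dimensional second-countable spaces with closed binary relations $R,S$), an epimorphism $\phi:B\to A$ is a continuous surjection such that for $Q\in\{R,S\}$: $Q^A(x,y)$ iff $Q^B(x',y')$ for some $x',y'$ with $\phi(x')=x,\phi(y')=y$; an isomorphism is a bijective epimorphism. $\mathcal{F}_<$ is a projective Fraïssé family, and $\mathbb{L}_<$ denotes its projective Fraïssé limit: the (unique up to isomorphism) topological $\{R,S\}$-structure such that (L1) every $A\in\mathcal{F}_<$ is an epimorphic image of $\mathbb{L}_<$; (L2) every continuous map from $\mathbb{L}_<$ to a finite discrete space factors as $f_0\circ\phi$ with $\phi:\mathbb{L}_<\to A$ an epimorphism onto some $A\in\mathcal{F}_<$; (L3) for any epimorphisms $\phi_1,\phi_2:\mathbb{L}_<\to A$, $A\in\mathcal{F}_<$, there is an automorphism $\psi$ of $\mathbb{L}_<$ with $\phi_2=\phi_1\circ\psi$.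 A topological group is extremely amenable if every continuous action of it on a compact Hausdorff space has a fixed point. *)

theory Defs
  imports "HOL-Analysis.Analysis" "HOL-Algebra.Group_Action"
begin

section \<open>Fans\<close>

text \<open>
  A simple graph on the vertex set \<open>V\<close> is given by its symmetric irreflexive adjacency
  relation \<open>E\<close>.
\<close>

definition simple_graph :: "'a set \<Rightarrow> ('a \<times> 'a) set \<Rightarrow> bool" where
  "simple_graph V E \<longleftrightarrow> E \<subseteq> V \<times> V \<and> sym E \<and> irrefl E"

definition graph_path :: "'a set \<Rightarrow> ('a \<times> 'a) set \<Rightarrow> 'a \<Rightarrow> 'a \<Rightarrow> 'a list \<Rightarrow> bool" where
  "graph_path V E x y p \<longleftrightarrow>
     p \<noteq> [] \<and> hd p = x \<and> last p = y \<and> set p \<subseteq> V \<and> distinct p \<and>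
     successively (\<lambda>u v. (u, v) \<in> E) p"

definition graph_cycle :: "('a \<times> 'a) set \<Rightarrow> 'a list \<Rightarrow> bool" where
  "graph_cycle E c \<longleftrightarrow>
     length c \<ge> 3 \<and> distinct c \<and> successively (\<lambda>u v. (u, v) \<in> E) c \<and> (last c, hd c) \<in> E"

definition degree_in :: "('a \<times> 'a) set \<Rightarrow> 'a \<Rightarrow> nat" where
  "degree_in E v = card {w. (v, w) \<in> E}"

definition fan :: "'a set \<Rightarrow> ('a \<times> 'a) set \<Rightarrow> 'a \<Rightarrow> bool" where
  "fan V E r \<longleftrightarrow>
     finite V \<and> r \<in> V \<and> simple_graph V E \<and>
     (\<forall>x\<in>V. \<forall>y\<in>V. \<exists>p. graph_path V E x y p) \<and>
     (\<nexists>c. graph_cycle E c) \<and>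
     (\<forall>v\<in>V - {r}. degree_in E v \<le> 2)"

text \<open>In a connected acyclic graph the path \<open>p\<close> below is unique.\<close>

definition tree_le :: "'a set \<Rightarrow> ('a \<times> 'a) set \<Rightarrow> 'a \<Rightarrow> 'a \<Rightarrow> 'a \<Rightarrow> bool" where
  "tree_le V E r s t \<longleftrightarrow> (\<exists>p. graph_path V E t r p \<and> s \<in> set p)"

definition tree_less :: "'a set \<Rightarrow> ('a \<times> 'a) set \<Rightarrow> 'a \<Rightarrow> 'a \<Rightarrow> 'a \<Rightarrow> bool" where
  "tree_less V E r s t \<longleftrightarrow> tree_le V E r s t \<and> s \<noteq> t"

definition immediate_successor :: "'a set \<Rightarrow> ('a \<times> 'a) set \<Rightarrow> 'a \<Rightarrow> 'a \<Rightarrow> 'a \<Rightarrow> bool" where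
  "immediate_successor V E r s t \<longleftrightarrow>
     tree_less V E r s t \<and> (\<nexists>u. tree_less V E r s u \<and> tree_less V E r u t)"

definition branches :: "'a set \<Rightarrow> ('a \<times> 'a) set \<Rightarrow> 'a \<Rightarrow> 'a set set" where
  "branches V E r = {b. pred_on.maxchain V (tree_le V E r) b}"

definition height :: "'a set \<Rightarrow> nat" where
  "height b = card b - 1"


section \<open>Topological structures and epimorphisms\<close>

record 'a RS_structure =
  Space :: "'a topology"
  RelR :: "('a \<times> 'a) set"
  RelS :: "('a \<times> 'a) set"

definition zero_dimensional_space :: "'a topology \<Rightarrow> bool" where
  "zero_dimensional_space X \<longleftrightarrow>
     openin X = arbitrary union_of (\<lambda>U. openin X U \<and> closedin X U)"

definition topological_structure :: "'a RS_structure \<Rightarrow> bool" where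
  "topological_structure A \<longleftrightarrow>
     compact_space (Space A) \<and> Hausdorff_space (Space A) \<and>
     zero_dimensional_space (Space A) \<and> second_countable (Space A) \<and>
     closedin (prod_topology (Space A) (Space A)) (RelR A) \<and>
     closedin (prod_topology (Space A) (Space A)) (RelS A)"

definition epimorphism :: "'b RS_structure \<Rightarrow> 'a RS_structure \<Rightarrow> ('b \<Rightarrow> 'a) \<Rightarrow> bool" where
  "epimorphism B A f \<longleftrightarrow>
     continuous_map (Space B) (Space A) f \<and>
     f ` topspace (Space B) = topspace (Space A) \<and>
     (\<forall>x\<in>topspace (Space A). \<forall>y\<in>topspace (Space A).
        ((x, y) \<in> RelR A \<longleftrightarrow>
           (\<exists>x'\<in>topspace (Space B). \<exists>y'\<in>topspace (Space B).
              (x', y') \<in> RelR B \<and> f x' = x \<and> f y' = y)) \<and>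
        ((x, y) \<in> RelS A \<longleftrightarrow>
           (\<exists>x'\<in>topspace (Space B). \<exists>y'\<in>topspace (Space B).
              (x', y') \<in> RelS B \<and> f x' = x \<and> f y' = y)))"

definition isomorphism :: "'b RS_structure \<Rightarrow> 'a RS_structure \<Rightarrow> ('b \<Rightarrow> 'a) \<Rightarrow> bool" where
  "isomorphism B A f \<longleftrightarrow>
     epimorphism B A f \<and> bij_betw f (topspace (Space B)) (topspace (Space A))"

abbreviation automorphism :: "'a RS_structure \<Rightarrow> ('a \<Rightarrow> 'a) \<Rightarrow> bool" where
  "automorphism A \<equiv> isomorphism A A"


section \<open>The class of ordered fans and its projective Fraisse limit\<close>

text \<open>
  The list \<open>bs\<close> enumerates the branches, each exactly once, in increasing order.
\<close>

definition ordered_fan :: "'a RS_structure \<Rightarrow> bool" where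
  "ordered_fan A \<longleftrightarrow>
     (\<exists>V E r bs.
        fan V E r \<and>
        (\<forall>b\<in>branches V E r. \<forall>b'\<in>branches V E r. height b = height b') \<and>
        distinct bs \<and> set bs = branches V E r \<and>
        Space A = discrete_topology V \<and>
        RelR A = {(s, t). s \<in> V \<and> t \<in> V \<and> (s = t \<or> immediate_successor V E r s t)} \<and>
        RelS A = {(x, y). \<exists>i j. i \<le> j \<and> j < length bs \<and> x \<in> bs ! i \<and> y \<in> bs ! j})"

text \<open>
  The members of the class, and the finite discrete spaces, are taken with points in
  \<^typ>\<open>nat\<close>. They are finite, so up to isomorphism nothing is lost.
\<close>

definition projective_Fraisse_limit :: "'a RS_structure \<Rightarrow> bool" where
  "projective_Fraisse_limit L \<longleftrightarrow>
     topological_structure L \<and>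
     (\<forall>A :: nat RS_structure. ordered_fan A \<longrightarrow> (\<exists>\<phi>. epimorphism L A \<phi>)) \<and>
     (\<forall>(Y :: nat set) f. finite Y \<and> continuous_map (Space L) (discrete_topology Y) f \<longrightarrow>
        (\<exists>(A :: nat RS_structure) \<phi> f\<^sub>0. ordered_fan A \<and> epimorphism L A \<phi> \<and>
           (\<forall>x\<in>topspace (Space L). f x = f\<^sub>0 (\<phi> x)))) \<and>
     (\<forall>(A :: nat RS_structure) \<phi>\<^sub>1 \<phi>\<^sub>2.
        ordered_fan A \<and> epimorphism L A \<phi>\<^sub>1 \<and> epimorphism L A \<phi>\<^sub>2 \<longrightarrow>
        (\<exists>\<psi>. automorphism L \<psi> \<and>
           (\<forall>x\<in>topspace (Space L). \<phi>\<^sub>2 x = \<phi>\<^sub>1 (\<psi> x))))"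


section \<open>Automorphism groups and extreme amenability\<close>

text \<open>
  As in \<^const>\<open>BijGroup\<close>, maps defined on the points of a space are represented by
  functions that are \<^const>\<open>extensional\<close> there.
\<close>

definition aut_group :: "'a RS_structure \<Rightarrow> ('a \<Rightarrow> 'a) monoid" where
  "aut_group A = BijGroup (topspace (Space A))
     \<lparr>carrier := {f \<in> extensional (topspace (Space A)). automorphism A f}\<rparr>"

definition compact_open_topology :: "'a topology \<Rightarrow> 'b topology \<Rightarrow> ('a \<Rightarrow> 'b) topology" where
  "compact_open_topology X Y = topology_generated_by
     {{f \<in> extensional (topspace X). continuous_map X Y f \<and> f ` K \<subseteq> U} | K U.
        compactin X K \<and> openin Y U}"

definition aut_topology :: "'a RS_structure \<Rightarrow> ('a \<Rightarrow> 'a) topology" where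
  "aut_topology A =
     subtopology (compact_open_topology (Space A) (Space A)) (carrier (aut_group A))"

definition topological_group :: "('g, 'm) monoid_scheme \<Rightarrow> 'g topology \<Rightarrow> bool" where
  "topological_group G T \<longleftrightarrow>
     group G \<and> topspace T = carrier G \<and>
     continuous_map (prod_topology T T) T (\<lambda>(g, h). g \<otimes>\<^bsub>G\<^esub> h) \<and>
     continuous_map T T (\<lambda>g. inv\<^bsub>G\<^esub> g)"

definition continuous_action ::
    "('g, 'm) monoid_scheme \<Rightarrow> 'g topology \<Rightarrow> 'x topology \<Rightarrow> ('g \<Rightarrow> 'x \<Rightarrow> 'x) \<Rightarrow> bool" where
  "continuous_action G T X \<alpha> \<longleftrightarrow>
     group_action G (topspace X) \<alpha> \<and>
     continuous_map (prod_topology T X) X (\<lambda>(g, x). \<alpha> g x)"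

text \<open>
  Compact spaces are nonempty here. The type argument carries the points of the spaces
  acted upon; a theorem about \<open>extremely_amenable TYPE('x)\<close> with \<open>'x\<close> a type variable
  covers all compact Hausdorff spaces.
\<close>

definition extremely_amenable ::
    "'x itself \<Rightarrow> ('g, 'm) monoid_scheme \<Rightarrow> 'g topology \<Rightarrow> bool" where
  "extremely_amenable (_ :: 'x itself) G T \<longleftrightarrow>
     topological_group G T \<and>
     (\<forall>(X :: 'x topology) \<alpha>.
        compact_space X \<and> Hausdorff_space X \<and> topspace X \<noteq> {} \<and> continuous_action G T X \<alpha> \<longrightarrow>
        (\<exists>x\<in>topspace X. \<forall>g\<in>carrier G. \<alpha> g x = x))"

end

theory Submission
  imports Defs "HOL-Library.Ramsey"
begin

text \<open>
  An epimorphism of ordered fans moves branches monotonically and acts on levels by a slow map,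
  one that starts at \<open>0\<close> and increases by at most one at each step. Let colourings of the epimorphisms
  onto a fan \<open>A\<close> be given. Ramsey's theorem, applied to sets of levels, makes the colour depend only
  on the images of the endpoints of the branches, which form a word over the vertices of \<open>A\<close>. For words
  one uses ultrafilters as in Gowers' theorem: there are ultrafilters \<open>U\<^sub>0, \<dots>, U\<^sub>M\<close> on words over
  \<open>{0..M}\<close> with \<open>U\<^sub>i U\<^sub>j = U\<^bsub>max i j\<^esub>\<close> such that every slow map \<open>s\<close> sends \<open>U\<^sub>k\<close> to \<open>U\<^bsub>s k\<^esub>\<close>. Concatenating
  copies of \<open>U\<^sub>M\<close> over the branches of \<open>B\<close> yields an ultrafilter whose image under every
  epimorphism from \<open>B\<close> to \<open>A\<close> is the same. This is the Ramsey property of ordered fans, and extreme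
  amenability follows as in the Kechris-Pestov-Todorcevic correspondence: the stabilizers of
  epimorphisms onto finite fans form a neighbourhood basis of the identity, so a flow without
  fixed points would give a finite colouring violating the Ramsey property.
\<close>

section \<open>Idempotents and ultrafilters\<close>

text \<open>Different epimorphisms from \<open>B\<close> to \<open>A\<close> treat the branches of
  \<open>B\<close> differently: some branches end below the top of their target, some collapse to
  the root, several may share one target. None of this may leave a trace in the image ultrafilter,
  and the law with \<open>max\<close> is made for that: the factor of a short branch is swallowed by
  the factor of a branch that reaches the top. Short factors occur before and after the full one, so
  absorption is needed on both sides. Gowers' method gives only the one-sided law
  \<open>u j \<odot> u i = u j\<close> for \<open>i \<le> j\<close>, and the products of
  \<open>u 0\<close>, ..., \<open>u k\<close> turn it into the two-sided one.

  Besides its endpoints, an epimorphism has the levels at which each branch climbs, and the number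
  of these steps varies with the epimorphism. In the large fan, the branches are therefore made to
  climb one after another, in consecutive blocks of one set of levels. Homogeneity for subsets of a
  single set, of all sizes at once, then controls every composite that occurs.\<close>

lemma Hausdorff_space_fun:
  assumes "Hausdorff_space (euclidean :: 'z::topological_space topology)"
  shows "Hausdorff_space (euclidean :: ('k \<Rightarrow> 'z) topology)"
proof -
  have "Hausdorff_space (product_topology (\<lambda>i::'k. euclidean :: 'z topology) UNIV)"
    using assms by (simp add: Hausdorff_space_product_topology)
  then show ?thesis by (simp only: euclidean_product_topology)
qed

lemma Hausdorff_space_bool: "Hausdorff_space (euclidean :: bool topology)"
  by (metis (mono_tags) Hausdorff_space_def disjnt_def hausdorff open_openin)

lemma compact_fun:
  assumes "compact (UNIV :: 'z::topological_space set)"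
  shows "compact (UNIV :: ('k \<Rightarrow> 'z) set)"
proof -
  have "compact_space (euclidean :: 'z topology)"
    using assms by (simp add: compact_space_def)
  then have "compact_space (product_topology (\<lambda>i::'k. euclidean :: 'z topology) UNIV)"
    by (simp add: compact_space_product_topology)
  then have "compact_space (euclidean :: ('k \<Rightarrow> 'z) topology)"
    by (simp only: euclidean_product_topology)
  then show ?thesis by (simp add: compact_space_def)
qed

lemma compact_bool: "compact (UNIV :: bool set)"
  by (simp add: finite_imp_compact)

text \<open>This is the Ellis-Numakura lemma. In a minimal closed subsemigroup \<open>S\<close> the
  set \<open>S a\<close> is again a closed subsemigroup, hence all of \<open>S\<close>, so some
  \<open>x\<close> in \<open>S\<close> satisfies \<open>m x a = a\<close>. The set of all such
  \<open>x\<close> is again a closed subsemigroup, hence equals \<open>S\<close> and contains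
  \<open>a\<close>.\<close>

lemma idempotent_in_compact_semigroup:
  fixes m :: "'a::topological_space \<Rightarrow> 'a \<Rightarrow> 'a"
  assumes T2: "Hausdorff_space (euclidean :: 'a topology)"
    and K: "compact K" "K \<noteq> {}"
    and clos: "\<And>x y. x \<in> K \<Longrightarrow> y \<in> K \<Longrightarrow> m x y \<in> K"
    and assoc: "\<And>x y z. m (m x y) z = m x (m y z)"
    and cont: "\<And>a. continuous_on UNIV (\<lambda>x. m x a)"
  shows "\<exists>e\<in>K. m e e = e"
proof -
  have cc: "closed S" if "compact S" for S :: "'a set"
    using compactin_imp_closedin[OF T2, of S] that by simp
  define C where "C = {S. S \<subseteq> K \<and> S \<noteq> {} \<and> closed S \<and> (\<forall>x\<in>S. \<forall>y\<in>S. m x y \<in> S)}"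
  \<comment> \<open>Zorn's lemma is applied to the complements, because a maximal complement is a
    minimal subsemigroup.\<close>
  have "\<exists>M\<in>uminus ` C. \<forall>X\<in>uminus ` C. M \<subseteq> X \<longrightarrow> X = M"
  proof (rule subset_Zorn_nonempty)
    show "uminus ` C \<noteq> {}"
      using K clos cc[OF K(1)] by (auto simp: C_def)
    fix D assume D: "D \<noteq> {}" "subset.chain (uminus ` C) D"
    define F where "F = uminus ` D"
    have F: "F \<noteq> {}" "F \<subseteq> C" 
      using D by (auto simp: F_def subset_chain_def)
    have lin: "A \<subseteq> B \<or> B \<subseteq> A" if "A \<in> F" "B \<in> F" for A B
      using that D by (auto simp: F_def subset_chain_def)
    have "K \<inter> \<Inter>F \<noteq> {}"
    proof (rule compact_imp_fip[OF K(1)])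
      show "closed T" if "T \<in> F" for T using that F by (auto simp: C_def)
      fix F' assume F': "finite F'" "F' \<subseteq> F"
      show "K \<inter> \<Inter>F' \<noteq> {}"
      proof (cases "F' = {}")
        case False
        have "\<exists>A\<in>F'. A \<subseteq> \<Inter>F'" using F'(1) False F'(2)
        proof (induction F' rule: finite_ne_induct)
          case (insert x G)
          then obtain A where A: "A \<in> G" "A \<subseteq> \<Inter>G" by auto
          then have "A \<subseteq> x \<or> x \<subseteq> A" using lin[of A x] insert by auto
          then show ?case
          proof
            assume "A \<subseteq> x"
            then show ?thesis using A by (intro bexI[of _ A]) auto
          next
            assume "x \<subseteq> A"
            then show ?thesis using A by (intro bexI[of _ x]) auto
          qed
        qed auto
        then obtain A where A: "A \<in> F'" "A \<subseteq> \<Inter>F'" by blast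
        then have "A \<in> C" using F' F by auto
        then have "A \<noteq> {}" "A \<subseteq> K" by (auto simp: C_def)
        then have "A \<subseteq> K \<inter> \<Inter>F'" using A(2) by (rule_tac Int_greatest)
        then show ?thesis using \<open>A \<noteq> {}\<close> by blast
      qed (use K in auto)
    qed
    moreover have "closed (\<Inter>F)" using F by (auto simp: C_def)
    moreover have "\<Inter>F \<subseteq> K" using F unfolding C_def by blast
    moreover have "\<forall>x\<in>\<Inter>F. \<forall>y\<in>\<Inter>F. m x y \<in> \<Inter>F"
    proof (intro ballI InterI)
      fix x y S assume "x \<in> \<Inter>F" "y \<in> \<Inter>F" "S \<in> F"
      then show "m x y \<in> S" using F(2) unfolding C_def by auto
    qed
    ultimately have "\<Inter>F \<in> C" unfolding C_def by auto
    moreover have "\<Union>D = - \<Inter>F" by (auto simp: F_def)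
    ultimately show "\<Union>D \<in> uminus ` C" by blast
  qed
  then obtain S where S: "S \<in> C" and "\<forall>X\<in>uminus ` C. - S \<subseteq> X \<longrightarrow> X = - S"
    by blast
  then have min: "T = S" if "T \<in> C" "T \<subseteq> S" for T
    using that by (metis (no_types, lifting) Compl_subset_Compl_iff compl_eq_compl_iff imageI)
  from S obtain a where a: "a \<in> S" by (auto simp: C_def)
  have cS: "compact S" using S K by (metis (no_types, lifting) C_def compact_Int_closed inf.absorb_iff2 mem_Collect_eq)
  have "(\<lambda>x. m x a) ` S = S"
  proof (rule min)
    have "compact ((\<lambda>x. m x a) ` S)"
      by (rule compact_continuous_image[OF continuous_on_subset[OF cont] cS]) simp
    then have "closed ((\<lambda>x. m x a) ` S)" by (rule cc)
    moreover have sub: "(\<lambda>x. m x a) ` S \<subseteq> S" using S a by (auto simp: C_def)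
    moreover have "m x y \<in> (\<lambda>x. m x a) ` S"
      if xy: "x \<in> (\<lambda>x. m x a) ` S" "y \<in> (\<lambda>x. m x a) ` S" for x y
    proof -
      obtain y' where "y' \<in> S" "y = m y' a" using xy by blast
      moreover have "m x y' \<in> S"
        using xy(1) sub S \<open>y' \<in> S\<close> unfolding C_def by blast
      ultimately show ?thesis using assoc by (metis imageI)
    qed
    ultimately show "(\<lambda>x. m x a) ` S \<in> C" using S a unfolding C_def by blast
    show "(\<lambda>x. m x a) ` S \<subseteq> S" by fact
  qed
  then obtain x where x: "x \<in> S" "m x a = a" using a by (metis imageE)
  have "{x \<in> S. m x a = a} = S"
  proof (rule min)
    have "closed {x. m x a = a}"
      using closed_vimage[OF cc cont, of "{a}"] by (simp add: vimage_def)
    moreover have "closed S" using S by (auto simp: C_def)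
    ultimately have "closed (S \<inter> {x. m x a = a})" by (intro closed_Int)
    moreover have "{x \<in> S. m x a = a} = S \<inter> {x. m x a = a}" by auto
    ultimately have "closed {x \<in> S. m x a = a}" by simp
    moreover have "m y z \<in> S" if "y \<in> S" "z \<in> S" for y z
      using that S by (auto simp: C_def)
    moreover have "S \<subseteq> K" using S by (auto simp: C_def)
    ultimately show "{x \<in> S. m x a = a} \<in> C" using x assoc by (auto simp: C_def)
  qed auto
  then show ?thesis using a S by (auto simp: C_def)
qed

section \<open>The compact semigroup of ultrafilters on words\<close>

definition ultrafilters :: "('w set \<Rightarrow> bool) set" where
  "ultrafilters = {p. \<forall>A B. (p (A \<inter> B) \<longleftrightarrow> p A \<and> p B) \<and> (p (- A) \<longleftrightarrow> \<not> p A)}"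

lemma ultrafilter_Int: "p \<in> ultrafilters \<Longrightarrow> p (A \<inter> B) \<longleftrightarrow> p A \<and> p B"
  by (simp add: ultrafilters_def)

lemma ultrafilter_Compl: "p \<in> ultrafilters \<Longrightarrow> p (- A) \<longleftrightarrow> \<not> p A"
  by (simp add: ultrafilters_def)

lemma ultrafilter_mono: "p \<in> ultrafilters \<Longrightarrow> p A \<Longrightarrow> A \<subseteq> B \<Longrightarrow> p B"
  by (metis inf.absorb_iff1 ultrafilter_Int)

lemma ultrafilter_UNIV: "p \<in> ultrafilters \<Longrightarrow> p UNIV"
  by (metis Compl_UNIV_eq subset_UNIV ultrafilter_Compl ultrafilter_mono)

lemma ultrafilter_not_empty: "p \<in> ultrafilters \<Longrightarrow> \<not> p {}"
  by (metis Compl_UNIV_eq ultrafilter_Compl ultrafilter_UNIV)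

lemma ultrafilter_finite_INT:
  assumes "p \<in> ultrafilters" "finite I" "\<And>i. i \<in> I \<Longrightarrow> p (A i)"
  shows "p (\<Inter>i\<in>I. A i)"
  using assms(2,3) by (induction I rule: finite_induct)
    (auto simp: assms(1) ultrafilter_UNIV ultrafilter_Int)

lemma ultrafilter_finite_UN:
  assumes "p \<in> ultrafilters" "finite I" "p (\<Union>i\<in>I. A i)"
  shows "\<exists>i\<in>I. p (A i)"
  using assms(2,3)
proof (induction I rule: finite_induct)
  case empty
  then show ?case using ultrafilter_not_empty[OF assms(1)] by simp
next
  case (insert i I)
  have "p (A i) \<or> p (\<Union>i\<in>I. A i)"
  proof (rule ccontr)
    assume "\<not> ?thesis"
    then have "p (- A i)" "p (- (\<Union>i\<in>I. A i))"
      by (simp_all only: ultrafilter_Compl[OF assms(1)] de_Morgan_disj simp_thms)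
    then have "p (- A i \<inter> - (\<Union>i\<in>I. A i))"
      by (simp only: ultrafilter_Int[OF assms(1)] simp_thms)
    then have "p (- (\<Union>i\<in>insert i I. A i))" by (simp only: Compl_Un UN_insert)
    then show False using insert.prems ultrafilter_Compl[OF assms(1)] by blast
  qed
  then show ?case using insert.IH by auto
qed

text \<open>The extension of concatenation to the Stone-Cech compactification of the set of words.
  With \<open>q\<close> evaluated inside, the value at each \<open>A\<close> is a single value of
  \<open>p\<close>, so the product is continuous in its left factor.\<close>

definition conv :: "('w list set \<Rightarrow> bool) \<Rightarrow> ('w list set \<Rightarrow> bool) \<Rightarrow> 'w list set \<Rightarrow> bool"
    (infixl \<open>\<odot>\<close> 70) where
  "p \<odot> q = (\<lambda>A. p {x. q {y. x @ y \<in> A}})"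

definition push :: "('v \<Rightarrow> 'w) \<Rightarrow> ('v set \<Rightarrow> bool) \<Rightarrow> 'w set \<Rightarrow> bool" where
  "push f p = (\<lambda>A. p (f -` A))"

definition principal :: "'w \<Rightarrow> 'w set \<Rightarrow> bool" where
  "principal x = (\<lambda>A. x \<in> A)"

lemma principal_ultrafilter: "principal x \<in> ultrafilters"
  by (auto simp: principal_def ultrafilters_def)

lemma conv_ultrafilter:
  "(p :: 'a list set \<Rightarrow> bool) \<in> ultrafilters \<Longrightarrow> q \<in> ultrafilters \<Longrightarrow> p \<odot> q \<in> ultrafilters"
  unfolding ultrafilters_def conv_def
proof (intro CollectI allI conjI)
  fix A B :: "'a list set"
  assume "p \<in> {p. \<forall>A B. p (A \<inter> B) = (p A \<and> p B) \<and> p (- A) = (\<not> p A)}"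
    and "q \<in> {p. \<forall>A B. p (A \<inter> B) = (p A \<and> p B) \<and> p (- A) = (\<not> p A)}"
  then have pI: "p (X \<inter> Y) = (p X \<and> p Y)" and pC: "p (- X) = (\<not> p X)"
    and qI: "q (X \<inter> Y) = (q X \<and> q Y)" and qC: "q (- X) = (\<not> q X)" for X Y :: "'a list set"
    by auto
  have "{y. x @ y \<in> A \<inter> B} = {y. x @ y \<in> A} \<inter> {y. x @ y \<in> B}"
    "{y. x @ y \<in> - A} = - {y. x @ y \<in> A}" for x
    by auto
  then show "p {x. q {y. x @ y \<in> A \<inter> B}} = (p {x. q {y. x @ y \<in> A}} \<and> p {x. q {y. x @ y \<in> B}})"
    "p {x. q {y. x @ y \<in> - A}} = (\<not> p {x. q {y. x @ y \<in> A}})"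
    by (simp_all add: qI qC Collect_conj_eq pI Collect_neg_eq pC)
qed

lemma push_ultrafilter: "p \<in> ultrafilters \<Longrightarrow> push f p \<in> ultrafilters"
  by (auto simp: ultrafilters_def push_def vimage_Compl)

lemma conv_assoc: "(p \<odot> q) \<odot> r = p \<odot> (q \<odot> r)"
  by (simp add: conv_def)

lemma conv_Nil [simp]: "principal [] \<odot> p = p" "p \<odot> principal [] = p"
  by (auto simp: conv_def principal_def)

lemma push_principal: "push f (principal x) = principal (f x)"
  by (auto simp: push_def principal_def)

lemma push_conv:
  "push (map f) (p \<odot> q) = push (map f) p \<odot> push (map f) q"
  by (auto simp: push_def conv_def vimage_def)

lemma push_push: "push f (push g p) = push (f \<circ> g) p"
  by (auto simp: push_def vimage_def)

text \<open>Used to replace maps on letters by others that agree only on the letters of a large set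
  of words.\<close>

lemma push_cong:
  assumes "p \<in> ultrafilters" "p G" "\<And>x. x \<in> G \<Longrightarrow> f x = g x"
  shows "push f p = push g p"
proof
  fix A
  have "f -` A \<inter> G = g -` A \<inter> G" using assms(3) by auto
  then show "push f p A = push g p A"
    using assms(1,2) by (metis push_def ultrafilter_Int)
qed

lemma conv_mem:
  assumes "p \<in> ultrafilters" "q \<in> ultrafilters" "p A" "q B"
    and "\<And>x y. x \<in> A \<Longrightarrow> y \<in> B \<Longrightarrow> x @ y \<in> C"
  shows "(p \<odot> q) C"
proof -
  have "B \<subseteq> {y. x @ y \<in> C}" if "x \<in> A" for x
    using that assms by auto
  then have "A \<subseteq> {x. q {y. x @ y \<in> C}}"
    using assms(2,4) ultrafilter_mono by (metis (mono_tags, lifting) mem_Collect_eq subsetI)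
  then show ?thesis
    unfolding conv_def using assms(1,3) ultrafilter_mono by metis
qed

lemma closed_eval: "closed {p :: 'i \<Rightarrow> bool. p A}" "closed {p :: 'i \<Rightarrow> bool. \<not> p A}"
proof -
  have "closed ((\<lambda>p :: 'i \<Rightarrow> bool. p A) -` S)" for S
    by (rule closed_vimage[OF _ continuous_on_product_coordinates])
      (metis closed_def open_discrete)
  from this[of "{True}"] this[of "{False}"]
  show "closed {p :: 'i \<Rightarrow> bool. p A}" "closed {p :: 'i \<Rightarrow> bool. \<not> p A}"
    by (auto simp: vimage_def)
qed

text \<open>Each defining condition involves only finitely many values of \<open>p\<close>, and
  every value is a clopen condition. As a closed subset of a power of \<open>bool\<close>, the
  ultrafilters form a compact Hausdorff space.\<close>

lemma closed_ultrafilters: "closed (ultrafilters :: ('w set \<Rightarrow> bool) set)"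
proof -
  have "ultrafilters = {p :: 'w set \<Rightarrow> bool. \<forall>A B.
      (p (A \<inter> B) \<and> p A \<and> p B \<or> \<not> p (A \<inter> B) \<and> (\<not> p A \<or> \<not> p B)) \<and>
      (p (- A) \<and> \<not> p A \<or> \<not> p (- A) \<and> p A)}"
    unfolding ultrafilters_def by (intro Collect_cong iff_allI) auto
  also have "closed \<dots>"
    by (intro closed_Collect_all closed_Collect_conj closed_Collect_disj closed_eval)
  finally show ?thesis .
qed

lemma continuous_conv: "continuous_on UNIV (\<lambda>p. p \<odot> q)"
  unfolding conv_def
  by (rule continuous_on_coordinatewise_then_product) (rule continuous_on_product_coordinates)

section \<open>Coherent families of ultrafilters\<close>

text \<open>The tetris operation \<open>h - 1\<close> of Gowers' theorem is one of these maps;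
  truncations and counting functions of sets of positive numbers are others.\<close>

definition slow :: "(nat \<Rightarrow> nat) \<Rightarrow> bool" where
  "slow s \<longleftrightarrow> s 0 = 0 \<and> (\<forall>h. s (Suc h) = s h \<or> s (Suc h) = Suc (s h))"

lemma slow_0: "slow s \<Longrightarrow> s 0 = 0"
  by (simp add: slow_def)

lemma slow_Suc: "slow s \<Longrightarrow> s h \<le> s (Suc h) \<and> s (Suc h) \<le> Suc (s h)"
  unfolding slow_def by (metis le_SucI order_refl)

lemma slow_mono:
  assumes "slow s" "h \<le> k"
  shows "s h \<le> s k"
  using assms(2) by (rule lift_Suc_mono_le[rotated]) (simp add: slow_Suc assms(1))

lemma slow_le: "slow s \<Longrightarrow> s h \<le> h"
proof (induction h)
  case (Suc h)
  then show ?case using slow_Suc[of s h] by simp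
qed (simp add: slow_0)

text \<open>The bound on the letters makes a map on letters matter only up to \<open>k\<close>. The
  occurrence of \<open>k\<close> ensures later that each branch of \<open>B\<close> is covered up to
  its tip, which gives surjectivity.\<close>

definition top_words :: "nat \<Rightarrow> nat list set" where
  "top_words k = {w. set w \<subseteq> {..k} \<and> k \<in> set w}"

definition coherent :: "(nat \<Rightarrow> nat list set \<Rightarrow> bool) set" where
  "coherent = {x. (\<forall>k. x k \<in> ultrafilters \<and> x k (top_words k)) \<and>
     (\<forall>s k. slow s \<longrightarrow> push (map s) (x k) = x (s k))}"

lemma coherentD:
  assumes "x \<in> coherent"
  shows "x k \<in> ultrafilters" "x k (top_words k)" "slow s \<Longrightarrow> push (map s) (x k) = x (s k)"
  using assms by (auto simp: coherent_def)

lemma closed_Collect_ball: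
  "(\<And>i. i \<in> I \<Longrightarrow> closed {x. P i x}) \<Longrightarrow> closed {x. \<forall>i\<in>I. P i x}"
  using closed_INT[of I "\<lambda>i. {x. P i x}"] by (simp add: Collect_ball_eq)

lemma closed_coordinate: "closed S \<Longrightarrow> closed {x :: 'j \<Rightarrow> 'b::topological_space. x k \<in> S}"
  using closed_vimage[OF _ continuous_on_product_coordinates, of S k] by (simp add: vimage_def)

lemma closed_coherent: "closed coherent"
proof -
  have c: "closed {x :: nat \<Rightarrow> nat list set \<Rightarrow> bool. x k A}" 
    "closed {x :: nat \<Rightarrow> nat list set \<Rightarrow> bool. \<not> x k A}" for k A
    using closed_coordinate[OF closed_eval(1)] closed_coordinate[OF closed_eval(2)] by auto
  have "coherent = {x. (\<forall>k. x k \<in> ultrafilters \<and> x k (top_words k)) \<and>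
     (\<forall>s\<in>Collect slow. \<forall>k A. x k (map s -` A) \<and> x (s k) A \<or> \<not> x k (map s -` A) \<and> \<not> x (s k) A)}"
    unfolding coherent_def push_def fun_eq_iff by (intro Collect_cong) auto
  also have "closed \<dots>"
    by (intro closed_Collect_conj closed_Collect_all closed_Collect_disj closed_Collect_ball c
        closed_coordinate closed_ultrafilters)
  finally show ?thesis .
qed

lemma top_words_append: "x \<in> top_words j \<Longrightarrow> y \<in> top_words k \<Longrightarrow> x @ y \<in> top_words (max j k)"
  by (auto simp: top_words_def max_def)

lemma conv_top_words:
  assumes "p \<in> ultrafilters" "q \<in> ultrafilters" "p (top_words j)" "q (top_words k)"
  shows "(p \<odot> q) (top_words (max j k))"
  by (rule conv_mem[OF assms top_words_append])

lemma coherent_conv: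
  assumes "x \<in> coherent" "y \<in> coherent"
  shows "(\<lambda>k. x k \<odot> y k) \<in> coherent"
  unfolding coherent_def
  using assms conv_top_words[of "x k" "y k" k k for k]
  by (auto simp: push_conv coherentD conv_ultrafilter)

text \<open>The Ellis-Numakura lemma for the pointwise product of families: all coordinates become
  idempotent simultaneously, while closed multiplicative conditions that link the coordinates, such
  as coherence, survive.\<close>

lemma idempotent_family:
  fixes Z :: "(nat \<Rightarrow> 'w list set \<Rightarrow> bool) set"
  assumes "closed Z" "Z \<noteq> {}" "\<And>x y. x \<in> Z \<Longrightarrow> y \<in> Z \<Longrightarrow> (\<lambda>k. x k \<odot> y k) \<in> Z"
  shows "\<exists>e\<in>Z. \<forall>k. e k \<odot> e k = e k"
proof -
  have "\<exists>e\<in>Z. (\<lambda>k. e k \<odot> e k) = e"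
  proof (rule idempotent_in_compact_semigroup[where m = "\<lambda>x y k. x k \<odot> y k"])
    show "Hausdorff_space (euclidean :: (nat \<Rightarrow> 'w list set \<Rightarrow> bool) topology)"
      by (intro Hausdorff_space_fun Hausdorff_space_bool)
    have "compact (UNIV :: (nat \<Rightarrow> 'w list set \<Rightarrow> bool) set)"
      by (intro compact_fun compact_bool)
    then show "compact Z"
      using assms(1) compact_Int_closed by fastforce
    show "continuous_on UNIV (\<lambda>x k. x k \<odot> a k)" for a :: "nat \<Rightarrow> 'w list set \<Rightarrow> bool"
    proof (rule continuous_on_coordinatewise_then_product)
      fix k
      show "continuous_on UNIV (\<lambda>x. x k \<odot> a k)"
        by (rule continuous_on_compose2[OF continuous_conv continuous_on_product_coordinates]) simp
    qed
  qed (use assms in \<open>auto simp: conv_assoc\<close>)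
  then show ?thesis by (metis (no_types, lifting))
qed

text \<open>An idempotent ultrafilter on nonempty words of zeros, relabelled by the letter
  \<open>k\<close>, gives idempotents \<open>c k\<close> that any map \<open>s\<close> permutes as
  it does the letters. The product of \<open>c 0\<close>, ..., \<open>c k\<close> sees each letter
  in increasing order, and a slow map only repeats neighbouring factors.\<close>

lemma coherent_nonempty: "coherent \<noteq> {}"
proof -
  \<comment> \<open>All coordinates carry the same condition and only one of them is used; the
    family form serves to apply \<open>idempotent_family\<close>.\<close>
  define Z :: "(nat \<Rightarrow> nat list set \<Rightarrow> bool) set"
    where "Z = {x. \<forall>k. x k \<in> ultrafilters \<and> x k (top_words 0)}"
  have "closed Z"
    unfolding Z_def using closed_coordinate[OF closed_eval(1)]
    by (intro closed_Collect_all closed_Collect_conj closed_coordinate closed_ultrafilters) simp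
  moreover have "(\<lambda>k. principal [0]) \<in> Z"
    unfolding Z_def by (simp add: principal_ultrafilter) (simp add: principal_def top_words_def)
  then have "Z \<noteq> {}" by auto
  moreover have "(\<lambda>k. x k \<odot> y k) \<in> Z" if xy: "x \<in> Z" "y \<in> Z" for x y
  proof -
    have "x k \<odot> y k \<in> ultrafilters \<and> (x k \<odot> y k) (top_words 0)" for k
      using xy conv_top_words[of "x k" "y k" 0 0] by (simp add: Z_def conv_ultrafilter)
    then show ?thesis by (simp add: Z_def)
  qed
  ultimately have "\<exists>e\<in>Z. \<forall>k. e k \<odot> e k = e k"
    by (rule idempotent_family)
  then obtain e where e: "e \<in> Z" "\<And>k. e k \<odot> e k = e k" by blast
  define v where "v = e 0"
  have v: "v \<in> ultrafilters" "v (top_words 0)" "v \<odot> v = v"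
    using e by (auto simp: v_def Z_def)
  define c where "c k = push (map (\<lambda>_ :: nat. k :: nat)) v" for k
  have c_idem: "c k \<odot> c k = c k" for k
    using v by (metis c_def push_conv)
  have c_uf: "c k \<in> ultrafilters" for k
    using v by (simp add: c_def push_ultrafilter)
  have c_push: "push (map s) (c k) = c (s k)" for s k
    by (simp add: c_def push_push comp_def)
  have c_top: "c k (top_words k)" for k
  proof -
    have "top_words 0 \<subseteq> map (\<lambda>_. k) -` top_words k"
      by (auto simp: top_words_def)
    then show ?thesis using v ultrafilter_mono unfolding c_def push_def by blast
  qed
  define x where "x = rec_nat (c 0) (\<lambda>k p. p \<odot> c (Suc k))"
  have x_simps: "x 0 = c 0" "\<And>k. x (Suc k) = x k \<odot> c (Suc k)" by (simp_all add: x_def)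
  have "x k \<in> ultrafilters \<and> x k (top_words k)" for k
  proof (induction k)
    case (Suc k)
    then show ?case
      using c_uf c_top conv_top_words[of "x k" "c (Suc k)" k "Suc k"]
      by (auto simp: x_simps conv_ultrafilter)
  qed (auto simp: x_simps c_uf c_top)
  moreover have "push (map s) (x k) = x (s k)" if "slow s" for s k
  proof (induction k)
    case 0
    then show ?case using that by (simp add: x_simps c_push slow_0)
  next
    case (Suc k)
    have abs: "x j \<odot> c j = x j" for j
      by (cases j) (auto simp: x_simps c_idem conv_assoc)
    have "push (map s) (x (Suc k)) = x (s k) \<odot> c (s (Suc k))"
      by (simp add: x_simps push_conv Suc c_push)
    then show ?case
      using that abs by (auto simp: slow_def x_simps dest: spec[of _ k])
  qed
  ultimately have "x \<in> coherent" by (simp add: coherent_def)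
  then show ?thesis by blast
qed

text \<open>
  Induction on \<open>M\<close>: from an idempotent family \<open>e\<close> that agrees with \<open>u\<close> up to level \<open>k\<close>, pass to the
  products \<open>e j \<odot> \<dots> \<odot> e (k + 1) \<odot> u k\<close>. A slow map only repeats factors of such a product, so
  idempotence keeps the new family coherent.
\<close>

lemma coherent_absorbing:
  "\<exists>u\<in>coherent. \<forall>i j. i \<le> j \<longrightarrow> j \<le> M \<longrightarrow> u j \<odot> u i = u j"
proof (induction M)
  case 0
  have "\<exists>e\<in>coherent. \<forall>k. e k \<odot> e k = e k"
    by (intro idempotent_family closed_coherent coherent_nonempty coherent_conv)
  then show ?case by auto
next
  case (Suc k)
  then obtain u where u: "u \<in> coherent" "\<And>i j. i \<le> j \<Longrightarrow> j \<le> k \<Longrightarrow> u j \<odot> u i = u j"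
    by blast
  have sing: "closed {p :: nat list set \<Rightarrow> bool}" for p
  proof -
    have "{p} = {q. \<forall>A\<in>Collect p. q A} \<inter> {q. \<forall>A\<in>- Collect p. \<not> q A}" by auto
    moreover have "closed \<dots>" by (intro closed_Int closed_Collect_ball closed_eval)
    ultimately show ?thesis by simp
  qed
  \<comment> \<open>Freezing the coordinates up to \<open>k\<close> preserves the absorption already
    obtained. \<open>Z\<close> is closed under products because \<open>u i\<close> is idempotent,
    the case \<open>i = j\<close> of the induction hypothesis.\<close>
  define Z where "Z = coherent \<inter> {x. \<forall>i\<in>{..k}. x i = u i}"
  have Zc: "closed Z"
    unfolding Z_def using closed_coordinate[OF sing]
    by (intro closed_Int closed_coherent closed_Collect_ball) simp
  have Zm: "(\<lambda>k. x k \<odot> y k) \<in> Z" if "x \<in> Z" "y \<in> Z" for x y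
    using that u by (auto simp: Z_def coherent_conv)
  have uZ: "u \<in> Z" using u(1) by (simp add: Z_def)
  obtain e where e: "e \<in> Z" "\<And>k. e k \<odot> e k = e k"
    using idempotent_family[OF Zc _ Zm] uZ by blast
  have ek: "e i = u i" if "i \<le> k" for i
    using that e by (auto simp: Z_def)
  have ec: "e \<in> coherent" using e by (auto simp: Z_def)
  define y where "y = rec_nat (u 0) (\<lambda>j p. if Suc j \<le> k then u (Suc j) else e (Suc j) \<odot> p)"
  have y_le: "y j = u j" if "j \<le> k" for j
    using that by (cases j) (auto simp: y_def)
  have y_gt: "y (Suc j) = e (Suc j) \<odot> y j" if "k \<le> j" for j
    using that by (auto simp: y_def)
  have y_uf: "y j \<in> ultrafilters \<and> y j (top_words j)" for j
  proof (induction j)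
    case 0
    then show ?case using coherentD[OF u(1)] y_le[of 0] by simp
  next
    case (Suc j)
    show ?case
    proof (cases "Suc j \<le> k")
      case True
      then show ?thesis using coherentD[OF u(1)] y_le by simp
    next
      case False
      then show ?thesis
        using Suc coherentD[OF ec] conv_top_words[of "e (Suc j)" "y j" "Suc j" j]
        by (simp add: y_gt conv_ultrafilter)
    qed
  qed
  have ey: "e m \<odot> y m = y m" for m
  proof (cases "m \<le> k")
    case True
    then show ?thesis using u(2)[of m m] by (simp add: ek y_le)
  next
    case False
    then obtain j where "m = Suc j" "k \<le> j" by (metis not_less_eq_eq not0_implies_Suc le0)
    then show ?thesis by (simp add: y_gt conv_assoc[symmetric] e)
  qed
  have ey': "e (Suc m) \<odot> y m = y (Suc m)" for m
  proof (cases "Suc m \<le> k")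
    case True
    then show ?thesis using u(2)[of m "Suc m"] by (simp add: ek y_le)
  qed (simp add: y_gt)
  have "push (map s) (y j) = y (s j)" if s: "slow s" for s j
  proof (induction j)
    case 0
    then show ?case using coherentD(3)[OF u(1) s] y_le[of 0] slow_0[OF s] by simp
  next
    case (Suc j)
    show ?case
    proof (cases "Suc j \<le> k")
      case True
      moreover have "s (Suc j) \<le> k" using slow_le[OF s, of "Suc j"] True by simp
      ultimately show ?thesis using coherentD(3)[OF u(1) s] by (simp add: y_le)
    next
      case False
      then have "push (map s) (y (Suc j)) = e (s (Suc j)) \<odot> y (s j)"
        using coherentD(3)[OF ec s] Suc by (simp add: y_gt push_conv)
      then show ?thesis using s ey ey' by (metis slow_def)
    qed
  qed
  then have yc: "y \<in> coherent" using y_uf by (simp add: coherent_def)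
  \<comment> \<open>The new relation at level \<open>k + 1\<close> is inherited by products from
    their right factor, and \<open>y\<close> satisfies it because its coordinate
    \<open>k + 1\<close> ends in \<open>u k\<close>. An idempotent of \<open>Y\<close> then absorbs
    every \<open>u i\<close> with \<open>i \<le> k\<close>, since \<open>u k\<close> does.\<close>
  define Y where "Y = Z \<inter> {x. x (Suc k) \<odot> u k \<in> {x (Suc k)}}"
  have Y_eq: "Y = Z \<inter> {x. x (Suc k) \<odot> u k = x (Suc k)}" by (auto simp: Y_def)
  have "closed {p. p \<odot> u k = p}"
  proof -
    have "{p. p \<odot> u k = p} = {p. \<forall>A. p {x. u k {y. x @ y \<in> A}} \<and> p A \<or> 
        \<not> p {x. u k {y. x @ y \<in> A}} \<and> \<not> p A}"
      unfolding fun_eq_iff conv_def by auto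
    also have "closed \<dots>"
      by (intro closed_Collect_all closed_Collect_disj closed_Collect_conj closed_eval)
    finally show ?thesis .
  qed
  from closed_coordinate[OF this] have Yc: "closed Y" unfolding Y_eq by (intro closed_Int Zc) simp
  have "y \<in> Y"
    using yc y_le u(2)[of k k] by (simp add: Y_eq Z_def y_gt conv_assoc)
  moreover have "(\<lambda>k. p k \<odot> q k) \<in> Y" if "p \<in> Y" "q \<in> Y" for p q
    using that Zm by (auto simp: Y_eq conv_assoc)
  ultimately obtain f where f: "f \<in> Y" "\<And>k. f k \<odot> f k = f k"
    using idempotent_family[OF Yc] by blast
  then have fu: "f i = u i" if "i \<le> k" for i using that by (auto simp: Y_eq Z_def)
  have "f j \<odot> f i = f j" if "i \<le> j" "j \<le> Suc k" for i j
  proof (cases "j \<le> k")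
    case True
    then show ?thesis using u(2) that fu by simp
  next
    case False
    then have j: "j = Suc k" using that by simp
    show ?thesis
    proof (cases "i = j")
      case False
      then have "i \<le> k" using j that by simp
      moreover have "f j \<odot> u k = f j" using f j by (auto simp: Y_eq)
      ultimately show ?thesis using u(2)[of i k] by (metis conv_assoc fu order_refl)
    qed (simp add: f)
  qed
  moreover have "f \<in> coherent" using f by (simp add: Y_eq Z_def)
  ultimately show ?case by blast
qed

text \<open>\<open>U k\<close> is the product of \<open>u 0\<close>, ..., \<open>u k\<close> for an
  absorbing coherent \<open>u\<close>. Its last factor makes it absorb every \<open>u i\<close> with
  \<open>i \<le> k\<close> on the right, hence also \<open>U i\<close>. For
  \<open>j \<le> k\<close>, the product \<open>U j \<odot> U k\<close> begins with
  \<open>U j \<odot> U j = U j\<close>, and the remaining factors of \<open>U k\<close> complete it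
  to \<open>U k\<close>. A slow map repeats or advances factors, and repetitions are
  absorbed.\<close>

lemma ultrafilter_chain:
  "\<exists>U :: nat \<Rightarrow> nat list set \<Rightarrow> bool. \<forall>k\<le>M.
     U k \<in> ultrafilters \<and> U k (top_words k) \<and>
     (\<forall>s. slow s \<longrightarrow> push (map s) (U k) = U (s k)) \<and>
     (\<forall>j\<le>M. U j \<odot> U k = U (max j k))"
proof -
  obtain u where u: "u \<in> coherent" "\<And>i j. i \<le> j \<Longrightarrow> j \<le> M \<Longrightarrow> u j \<odot> u i = u j"
    using coherent_absorbing by blast
  define U where "U = rec_nat (u 0) (\<lambda>k p. p \<odot> u (Suc k))"
  have U: "U 0 = u 0" "\<And>k. U (Suc k) = U k \<odot> u (Suc k)" by (simp_all add: U_def)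
  have uf: "U k \<in> ultrafilters \<and> U k (top_words k)" for k
  proof (induction k)
    case (Suc k)
    then show ?case
      using coherentD[OF u(1)] conv_top_words[of "U k" "u (Suc k)" k "Suc k"]
      by (auto simp: U conv_ultrafilter)
  qed (use coherentD[OF u(1)] in \<open>auto simp: U\<close>)
  have Uu: "U j \<odot> u i = U j" if "i \<le> j" "j \<le> M" for i j
  proof (cases j)
    case (Suc j')
    then show ?thesis using that u(2)[of i j] by (simp add: U conv_assoc)
  qed (use that u(2)[of i j] in \<open>simp add: U\<close>)
  have push: "push (map s) (U k) = U (s k)" if "k \<le> M" "slow s" for s k
    using that(1)
  proof (induction k)
    case 0
    then show ?case using coherentD(3)[OF u(1) that(2)] that(2) by (simp add: U slow_0)
  next
    case (Suc k)
    have "push (map s) (U (Suc k)) = U (s k) \<odot> u (s (Suc k))"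
      using Suc coherentD(3)[OF u(1) that(2)] by (simp add: U push_conv)
    moreover have "s k \<le> M" using slow_le[OF that(2), of k] Suc.prems by simp
    ultimately show ?case using that(2) Uu[of "s k" "s k"] U(2) by (metis order_refl slow_def)
  qed
  have down: "U j \<odot> U k = U j" if "k \<le> j" "j \<le> M" for j k
    using that(1)
  proof (induction k)
    case (Suc k)
    then show ?case using Uu[of "Suc k" j] that by (simp add: U conv_assoc[symmetric])
  qed (use Uu[of 0 j] that in \<open>simp add: U\<close>)
  have up: "U j \<odot> U k = U k" if "j \<le> k" "k \<le> M" for j k
    using that
  proof (induction k)
    case (Suc k)
    show ?case
    proof (cases "j \<le> k")
      case True
      then show ?thesis using Suc by (simp add: U conv_assoc[symmetric])
    next
      case False
      then have "j = Suc k" using Suc by simp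
      then show ?thesis using down Suc by simp
    qed
  qed (use down in simp)
  have "U j \<odot> U k = U (max j k)" if "j \<le> M" "k \<le> M" for j k
    using that up[of j k] down[of k j] by (cases "j \<le> k") (auto simp: max_def)
  then show ?thesis using uf push by blast
qed

section \<open>A Ramsey theorem for words over a fan\<close>

primrec conv_prod :: "(nat \<Rightarrow> 'w list set \<Rightarrow> bool) \<Rightarrow> nat \<Rightarrow> 'w list set \<Rightarrow> bool" where
  "conv_prod p 0 = principal []"
| "conv_prod p (Suc n) = conv_prod p n \<odot> p n"

lemma conv_prod_cong:
  "(\<And>i. i < n \<Longrightarrow> p i = q i) \<Longrightarrow> conv_prod p n = conv_prod q n"
  by (induction n) auto

lemma push_conv_prod: "push (map g) (conv_prod p n) = conv_prod (\<lambda>i. push (map g) (p i)) n"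
  by (induction n) (auto simp: push_principal push_conv)

lemma conv_prod_ultrafilter:
  "(\<And>i. i < n \<Longrightarrow> p i \<in> ultrafilters) \<Longrightarrow> conv_prod p n \<in> ultrafilters"
  by (induction n) (auto simp: principal_ultrafilter conv_ultrafilter)

text \<open>
  How an epimorphism from a fan with \<open>b\<close> branches of height \<open>M\<close> onto one with \<open>n\<close> branches of
  height \<open>N\<close> acts: branch \<open>a\<close> goes into branch \<open>l a\<close>, and the vertex at level \<open>h\<close> goes to
  level \<open>s a h\<close>.
\<close>

definition fan_data :: "nat \<Rightarrow> nat \<Rightarrow> nat \<Rightarrow> nat \<Rightarrow> (nat \<Rightarrow> nat) \<Rightarrow> (nat \<Rightarrow> nat \<Rightarrow> nat) \<Rightarrow> bool" where
  "fan_data b M n N l s \<longleftrightarrow>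
     (\<forall>a<b. l a < n \<and> slow (s a) \<and> s a M \<le> N) \<and>
     (\<forall>a a'. a \<le> a' \<longrightarrow> a' < b \<longrightarrow> 0 < s a M \<longrightarrow> 0 < s a' M \<longrightarrow> l a \<le> l a') \<and>
     (\<forall>i<n. \<exists>a<b. l a = i \<and> s a M = N)"

text \<open>The factors after position \<open>j\<close> sit at level 0, which is neutral on both
  sides for all \<open>P j k\<close> because the root belongs to every branch. So the new factor
  moves left past them and merges with the one at \<open>j\<close>.\<close>

lemma conv_prod_absorb:
  fixes P :: "nat \<Rightarrow> nat \<Rightarrow> 'w list set \<Rightarrow> bool"
  assumes P: "\<And>i j k. j \<le> N \<Longrightarrow> k \<le> N \<Longrightarrow> P i j \<odot> P i k = P i (max j k)"
    and P0: "\<And>i. P i 0 = P 0 0"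
    and K: "\<And>i. K i \<le> N" and k: "k \<le> N"
  shows "j < n \<Longrightarrow> (\<And>i. j < i \<Longrightarrow> i < n \<Longrightarrow> K i = 0) \<Longrightarrow>
    conv_prod (\<lambda>i. P i (K i)) n \<odot> P j k = conv_prod (\<lambda>i. P i ((K(j := max (K j) k)) i)) n"
proof (induction n)
  case (Suc n)
  show ?case
  proof (cases "j = n")
    case True
    have "conv_prod (\<lambda>i. P i (K i)) n = conv_prod (\<lambda>i. P i ((K(j := max (K j) k)) i)) n"
      using True by (intro conv_prod_cong) auto
    then show ?thesis using True P[OF K k] by (simp add: conv_assoc)
  next
    case False
    then have jn: "j < n" and Kn: "K n = 0" using Suc.prems by auto
    have z: "P n 0 \<odot> P j k = P j k" "P j k \<odot> P n 0 = P j k"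
      using P[of 0 k j] P[of k 0 j] k P0[of n] P0[of j] by simp_all
    let ?Q = "conv_prod (\<lambda>i. P i (K i)) n"
    have "conv_prod (\<lambda>i. P i (K i)) (Suc n) \<odot> P j k = ?Q \<odot> (P n 0 \<odot> P j k)"
      by (simp add: Kn conv_assoc)
    also have "\<dots> = (?Q \<odot> P j k) \<odot> P n 0"
      by (simp add: z conv_assoc)
    also have "?Q \<odot> P j k = conv_prod (\<lambda>i. P i ((K(j := max (K j) k)) i)) n"
      using Suc jn by simp
    finally show ?thesis using jn Kn by simp
  qed
qed simp

text \<open>The branches of the source are multiplied in one at a time. Monotonicity of the labels
  guarantees that no factor beyond \<open>l c\<close> has left level 0 when branch \<open>c\<close>
  arrives, and \<open>full\<close> guarantees that every factor ends at level
  \<open>N\<close>.\<close>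

lemma conv_prod_branches:
  fixes P :: "nat \<Rightarrow> nat \<Rightarrow> 'w list set \<Rightarrow> bool" and l k :: "nat \<Rightarrow> nat"
  assumes P: "\<And>i j k. j \<le> N \<Longrightarrow> k \<le> N \<Longrightarrow> P i j \<odot> P i k = P i (max j k)"
    and P0: "\<And>i. P i 0 = P 0 0"
    and l: "\<And>a. a < b \<Longrightarrow> l a < n \<and> k a \<le> N"
    and mono: "\<And>a a'. a \<le> a' \<Longrightarrow> a' < b \<Longrightarrow> 0 < k a \<Longrightarrow> 0 < k a' \<Longrightarrow> l a \<le> l a'"
    and full: "\<And>i. i < n \<Longrightarrow> \<exists>a<b. l a = i \<and> k a = N"
    and n: "0 < n"
  shows "conv_prod (\<lambda>a. P (l a) (k a)) b = conv_prod (\<lambda>i. P i N) n"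
proof -
  \<comment> \<open>\<open>K c i\<close> is the largest level reached in target branch
    \<open>i\<close> by the source branches before \<open>c\<close>.\<close>
  define K where "K = rec_nat (\<lambda>i. 0 :: nat) (\<lambda>a K. K(l a := max (K (l a)) (k a)))"
  have K: "K 0 = (\<lambda>i. 0)" "\<And>a. K (Suc a) = (K a)(l a := max (K a (l a)) (k a))"
    by (simp_all add: K_def)
  have le: "K c i \<le> N" if "c \<le> b" for c i
    using that by (induction c) (auto simp: K l Suc_le_eq)
  have wit: "\<exists>a<c. l a = i \<and> k a = K c i" if "0 < K c i" for c i
    using that
  proof (induction c)
    case (Suc c)
    show ?case
    proof (cases "i = l c \<and> K c i \<le> k c")
      case True
      then show ?thesis by (intro exI[of _ c]) (auto simp: K max_def)
    next
      case False
      then have "K (Suc c) i = K c i" by (auto simp: K)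
      then show ?thesis using Suc by (metis less_SucI)
    qed
  qed (simp add: K)
  have ge: "k a \<le> K c (l a)" if "a < c" for a c
    using that
  proof (induction c)
    case (Suc c)
    then show ?case by (cases "a = c") (auto simp: K le_max_iff_disj)
  qed simp
  have z: "P i 0 \<odot> P i' 0 = P 0 0" for i i'
    using P[of 0 0 0] P0 by (metis le0 max.idem)
  \<comment> \<open>The factor \<open>P 0 0\<close> in front starts the induction: the empty product
    is the principal ultrafilter at the empty word, whereas \<open>n\<close> factors at level 0
    multiply to \<open>P 0 0\<close>.\<close>
  have "c \<le> b \<Longrightarrow> P 0 0 \<odot> conv_prod (\<lambda>a. P (l a) (k a)) c = conv_prod (\<lambda>i. P i (K c i)) n" for c
  proof (induction c)
    case 0
    have "conv_prod (\<lambda>i. P i 0) (Suc m) = P 0 0" for m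
      by (induction m) (use z P0 in auto)
    then show ?case using n by (cases n) (auto simp: K)
  next
    case (Suc c)
    have Kc: "K c i \<le> N" for i using le Suc.prems by simp
    have kc: "k c \<le> N" "l c < n" using l Suc.prems by auto
    have "P 0 0 \<odot> conv_prod (\<lambda>a. P (l a) (k a)) (Suc c) = conv_prod (\<lambda>i. P i (K c i)) n \<odot> P (l c) (k c)"
      using Suc by (simp add: conv_assoc[symmetric])
    also have "\<dots> = conv_prod (\<lambda>i. P i (K (Suc c) i)) n"
    proof (cases "k c = 0")
      case True
      \<comment> \<open>The label of a collapsed branch carries no information, so its factor is
        merged at the last position, where nothing stands behind it.\<close>
      define j where "j = n - 1"
      have "conv_prod (\<lambda>i. P i (K c i)) n \<odot> P j 0 = conv_prod (\<lambda>i. P i (((K c)(j := max (K c j) 0)) i)) n"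
        by (rule conv_prod_absorb[where P = P and K = "K c" and N = N, OF P P0 Kc]) (use n in \<open>auto simp: j_def\<close>)
      moreover have "K (Suc c) = K c" "(K c)(j := max (K c j) 0) = K c" using True by (auto simp: K)
      ultimately show ?thesis using True P0 by metis
    next
      case False
      have "K c i = 0" if "l c < i" for i
      proof (rule ccontr)
        assume "K c i \<noteq> 0"
        then obtain a where "a < c" "l a = i" "k a = K c i" using wit by blast
        then show False
          using mono[of a c] Suc.prems False that \<open>K c i \<noteq> 0\<close> by simp
      qed
      then show ?thesis
        unfolding K by (intro conv_prod_absorb[where P = P and K = "K c" and N = N, OF P P0 Kc kc]) auto
    qed
    finally show ?case .
  qed
  from this[of b] have "P 0 0 \<odot> conv_prod (\<lambda>a. P (l a) (k a)) b = conv_prod (\<lambda>i. P i (K b i)) n"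
    by simp
  moreover have "K b i = N" if "i < n" for i
    using full[OF that] ge le[of b i] by (metis le_antisym order_refl)
  then have "conv_prod (\<lambda>i. P i (K b i)) n = conv_prod (\<lambda>i. P i N) n"
    by (intro conv_prod_cong) simp
  \<comment> \<open>The auxiliary factor disappears again, since the leading factor of a nonempty
    product absorbs it.\<close>
  moreover have "P 0 0 \<odot> conv_prod (\<lambda>a. P (l a) (k a)) (Suc c) = conv_prod (\<lambda>a. P (l a) (k a)) (Suc c)"
    if "Suc c \<le> b" for c
    using that
  proof (induction c)
    case 0
    then show ?case using P[of 0 "k 0" "l 0"] P0[of "l 0"] l[of 0] by simp
  next
    case (Suc c)
    then have "P 0 0 \<odot> conv_prod (\<lambda>a. P (l a) (k a)) (Suc c) = conv_prod (\<lambda>a. P (l a) (k a)) (Suc c)"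
      by simp
    then show ?case by (metis conv_assoc conv_prod.simps(2))
  qed
  moreover have "0 < b" using full[OF n] by auto
  then obtain c where "b = Suc c" using gr0_implies_Suc by blast
  ultimately show ?thesis by simp
qed

text \<open>A letter \<open>(a, h)\<close> is the endpoint of a future branch over \<open>B\<close>,
  at level \<open>h\<close> of branch \<open>a\<close>. The conditions on order, range and tips are
  what makes the word the endpoint list of an epimorphism onto the fan with coordinates
  \<open>w\<close>; the last one says that all \<open>f\<close> in \<open>F\<close> give image words
  of one colour.\<close>

definition homogeneous_word ::
    "('b \<Rightarrow> 'a) set \<Rightarrow> (nat \<Rightarrow> nat \<Rightarrow> 'b) \<Rightarrow> nat \<Rightarrow> nat \<Rightarrow> ('a list \<Rightarrow> 'c) \<Rightarrow> (nat \<times> nat) list \<Rightarrow> bool" where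
  "homogeneous_word F w b M e x \<longleftrightarrow>
     sorted (map fst x) \<and> (\<forall>p\<in>set x. fst p < b \<and> snd p \<le> M) \<and> (\<forall>a<b. (a, M) \<in> set x) \<and>
     (\<exists>c. \<forall>f\<in>F. e (map (\<lambda>p. f (w (fst p) (snd p))) x) = c)"

lemma homogeneous_wordD:
  assumes "homogeneous_word F w b M e x"
  shows "sorted (map fst x)" "p \<in> set x \<Longrightarrow> fst p < b \<and> snd p \<le> M" "a < b \<Longrightarrow> (a, M) \<in> set x"
    "\<exists>c. \<forall>f\<in>F. e (map (\<lambda>p. f (w (fst p) (snd p))) x) = c"
proof -
  note x = assms[unfolded homogeneous_word_def]
  show "sorted (map fst x)" by (rule x[THEN conjunct1])
  show "p \<in> set x \<Longrightarrow> fst p < b \<and> snd p \<le> M"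
    by (rule x[THEN conjunct2, THEN conjunct1, THEN bspec])
  show "a < b \<Longrightarrow> (a, M) \<in> set x"
    by (rule x[THEN conjunct2, THEN conjunct2, THEN conjunct1, rule_format])
  show "\<exists>c. \<forall>f\<in>F. e (map (\<lambda>p. f (w (fst p) (snd p))) x) = c"
    by (rule x[THEN conjunct2, THEN conjunct2, THEN conjunct2])
qed

text \<open>\<open>\<Omega>\<close> has the same image \<open>W\<close> under every \<open>f\<close>
  in \<open>F\<close>: slow maps and coherence turn its factors into \<open>P (l a) (s a M)\<close>,
  and \<open>conv_prod_branches\<close> removes the dependence on \<open>l\<close> and
  \<open>s\<close>. A colour class that is large for \<open>W\<close> therefore has
  \<open>\<Omega>\<close>-large preimages under all \<open>f\<close>, and finitely many of them
  meet.\<close>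

lemma word_ramsey_aux:
  fixes w :: "nat \<Rightarrow> nat \<Rightarrow> 'b" and v :: "nat \<Rightarrow> nat \<Rightarrow> 'a" and e :: "'a list \<Rightarrow> nat"
  assumes F: "finite F" and e: "\<And>z. e z < r" and v0: "\<And>i. v i 0 = v 0 0" and n: "0 < n"
    and data: "\<And>f. f \<in> F \<Longrightarrow> \<exists>l s. fan_data b M n N l s \<and> (\<forall>a<b. \<forall>h\<le>M. f (w a h) = v (l a) (s a h))"
  shows "\<exists>x. homogeneous_word F w b M e x"
proof -
  obtain U :: "nat \<Rightarrow> nat list set \<Rightarrow> bool" where U: "\<forall>k\<le>max M N.
     U k \<in> ultrafilters \<and> U k (top_words k) \<and> (\<forall>s. slow s \<longrightarrow> push (map s) (U k) = U (s k)) \<and>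
     (\<forall>j\<le>max M N. U j \<odot> U k = U (max j k))"
    using ultrafilter_chain by blast
  define P where "P i k = push (map (v i)) (U k)" for i k
  have P: "P i j \<odot> P i k = P i (max j k)" if "j \<le> N" "k \<le> N" for i j k
    using that U unfolding P_def push_conv[symmetric] by (simp add: le_max_iff_disj)
  have P0: "P i 0 = P 0 0" for i
    unfolding P_def
  proof (rule push_cong[of _ "top_words 0"])
    show "map (v i) x = map (v 0) x" if "x \<in> top_words 0" for x
      using that v0 by (force simp: top_words_def)
  qed (use U in auto)
  \<comment> \<open>One copy of \<open>U M\<close> for each branch of the source, with letters
    marked by the branch.\<close>
  define \<Omega> where "\<Omega> = conv_prod (\<lambda>a. push (map (Pair a)) (U M)) b"
  have \<Omega>_uf: "\<Omega> \<in> ultrafilters"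
    unfolding \<Omega>_def using U by (intro conv_prod_ultrafilter push_ultrafilter) auto
  define A where "A c = {x :: (nat \<times> nat) list. sorted (map fst x) \<and>
      (\<forall>p\<in>set x. fst p < c \<and> snd p \<le> M) \<and> (\<forall>a<c. (a, M) \<in> set x)}" for c
  have A: "conv_prod (\<lambda>a. push (map (Pair a)) (U M)) c (A c)" for c
  proof (induction c)
    case (Suc c)
    show ?case unfolding conv_prod.simps
    proof (rule conv_mem)
      show "conv_prod (\<lambda>a. push (map (Pair a)) (U M)) c (A c)" by fact
      have "top_words M \<subseteq> map (Pair c) -` (map (Pair c) ` top_words M)" by auto
      then show "push (map (Pair c)) (U M) (map (Pair c) ` top_words M)"
        using U ultrafilter_mono unfolding push_def by (meson max.cobounded1)
      show "conv_prod (\<lambda>a. push (map (Pair a)) (U M)) c \<in> ultrafilters"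
        "push (map (Pair c)) (U M) \<in> ultrafilters"
        using U by (simp_all add: conv_prod_ultrafilter push_ultrafilter)
      fix x y assume x: "x \<in> A c" and "y \<in> map (Pair c) ` top_words M"
      then obtain q where q: "y = map (Pair c) q" "set q \<subseteq> {..M}" "M \<in> set q"
        by (auto simp: top_words_def)
      have "sorted (map fst y)" unfolding q by (induction q) auto
      then show "x @ y \<in> A (Suc c)"
        using x q by (fastforce simp: A_def sorted_append less_Suc_eq)
    qed
  qed (simp add: principal_def A_def)
  define ev where "ev f = map (\<lambda>p. f (w (fst p) (snd p)))" for f :: "'b \<Rightarrow> 'a"
  define W where "W = conv_prod (\<lambda>i. P i N) n"
  have W: "push (ev f) \<Omega> = W" if fF: "f \<in> F" for f
  proof -
    obtain l s where d: "fan_data b M n N l s" and f: "\<And>a h. a < b \<Longrightarrow> h \<le> M \<Longrightarrow> f (w a h) = v (l a) (s a h)"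
      using data[OF fF] by blast
    have "push (ev f) \<Omega> = conv_prod (\<lambda>a. P (l a) (s a M)) b"
      unfolding \<Omega>_def ev_def push_conv_prod
    proof (rule conv_prod_cong)
      fix a assume a: "a < b"
      have "push (map (\<lambda>p. f (w (fst p) (snd p)))) (push (map (Pair a)) (U M)) = push (map (\<lambda>q. f (w a q))) (U M)"
        by (simp add: push_push comp_def)
      also have "\<dots> = push (map (v (l a)) \<circ> map (s a)) (U M)"
      proof (rule push_cong[of _ "top_words M"])
        show "map (\<lambda>q. f (w a q)) x = (map (v (l a)) \<circ> map (s a)) x" if "x \<in> top_words M" for x
          using that f[OF a] by (auto simp: top_words_def)
      qed (use U in auto)
      also have "\<dots> = push (map (v (l a))) (push (map (s a)) (U M))"
        by (simp only: push_push)
      also have "push (map (s a)) (U M) = U (s a M)"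
        using U d a by (simp add: fan_data_def)
      also have "push (map (v (l a))) (U (s a M)) = P (l a) (s a M)"
        by (simp add: P_def)
      finally show "push (map (\<lambda>p. f (w (fst p) (snd p)))) (push (map (Pair a)) (U M)) = P (l a) (s a M)" .
    qed
    also have "\<dots> = W"
      unfolding W_def using d n
      by (intro conv_prod_branches P P0) (auto simp: fan_data_def)
    finally show ?thesis .
  qed
  have W_uf: "W \<in> ultrafilters"
    unfolding W_def P_def using U by (intro conv_prod_ultrafilter push_ultrafilter) auto
  have "(\<Union>c\<in>{..<r}. {z. e z = c}) = UNIV" using e by auto
  then have "W (\<Union>c\<in>{..<r}. {z. e z = c})" using ultrafilter_UNIV[OF W_uf] by simp
  then obtain c where c: "W {z. e z = c}"
    using ultrafilter_finite_UN[OF W_uf] by blast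
  have "\<Omega> (ev f -` {z. e z = c})" if "f \<in> F" for f
  proof -
    have "push (ev f) \<Omega> {z. e z = c}" using c by (simp only: W[OF that])
    then show ?thesis by (simp only: push_def)
  qed
  then have "\<Omega> (\<Inter>f\<in>F. ev f -` {z. e z = c})"
    by (rule ultrafilter_finite_INT[OF \<Omega>_uf F])
  moreover have "\<Omega> (A b)" using A[of b] by (simp only: \<Omega>_def)
  ultimately have "\<Omega> (A b \<inter> (\<Inter>f\<in>F. ev f -` {z. e z = c}))"
    using ultrafilter_Int[OF \<Omega>_uf] by blast
  then have "A b \<inter> (\<Inter>f\<in>F. ev f -` {z. e z = c}) \<noteq> {}"
    using ultrafilter_not_empty[OF \<Omega>_uf] by metis
  then obtain x where x: "x \<in> A b \<inter> (\<Inter>f\<in>F. ev f -` {z. e z = c})"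
    unfolding ex_in_conv[symmetric] by (elim exE)
  have "e (map (\<lambda>p. f (w (fst p) (snd p))) x) = c" if "f \<in> F" for f
  proof -
    have "x \<in> ev f -` {z. e z = c}" using IntD2[OF x] that by (rule INT_D)
    then show ?thesis by (simp only: vimage_def mem_Collect_eq ev_def)
  qed
  then have col: "\<exists>c. \<forall>f\<in>F. e (map (\<lambda>p. f (w (fst p) (snd p))) x) = c" by (intro exI ballI)
  have xA: "sorted (map fst x) \<and> (\<forall>p\<in>set x. fst p < b \<and> snd p \<le> M) \<and> (\<forall>a<b. (a, M) \<in> set x)"
    using IntD1[OF x] unfolding A_def mem_Collect_eq .
  show ?thesis
    unfolding homogeneous_word_def
    by (rule exI[of _ x], intro conjI) (rule xA[THEN conjunct1] xA[THEN conjunct2, THEN conjunct1]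
      xA[THEN conjunct2, THEN conjunct2] col)+
qed

text \<open>Evaluation preserves the length of a word, so bad colourings chosen separately for every
  length combine into one colouring that contradicts \<open>word_ramsey_aux\<close>. The fixed
  length \<open>m\<close> becomes the number of branches of the large fan.\<close>

lemma word_ramsey:
  fixes w :: "nat \<Rightarrow> nat \<Rightarrow> 'b" and v :: "nat \<Rightarrow> nat \<Rightarrow> 'a"
  assumes F: "finite F" and v0: "\<And>i. v i 0 = v 0 0" and n: "0 < n"
    and data: "\<And>f. f \<in> F \<Longrightarrow> \<exists>l s. fan_data b M n N l s \<and> (\<forall>a<b. \<forall>h\<le>M. f (w a h) = v (l a) (s a h))"
  shows "\<exists>m. \<forall>e :: 'a list \<Rightarrow> nat. (\<forall>z. e z < r) \<longrightarrow> (\<exists>x. length x = m \<and> homogeneous_word F w b M e x)"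
proof (rule ccontr)
  assume "\<not> ?thesis"
  then obtain E :: "nat \<Rightarrow> 'a list \<Rightarrow> nat" where E: "\<And>m z. E m z < r"
    and bad: "\<And>m x. length x = m \<Longrightarrow> \<not> homogeneous_word F w b M (E m) x"
    by metis
  define e where "e z = E (length z) z" for z
  have er: "e z < r" for z using E by (simp add: e_def)
  have "\<exists>x. homogeneous_word F w b M e x"
    by (rule word_ramsey_aux[where e = e and F = F and r = r, OF F er v0 n data])
  then obtain x where "homogeneous_word F w b M e x" by blast
  then have "homogeneous_word F w b M (E (length x)) x"
    unfolding homogeneous_word_def e_def length_map .
  then show False using bad by blast
qed

section \<open>Coordinates on fans\<close>

lemma graph_path_Cons:
  assumes "p \<noteq> []"
  shows "graph_path V E x y (z # p) \<longleftrightarrow>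
    z = x \<and> x \<in> V \<and> x \<notin> set p \<and> (x, hd p) \<in> E \<and> graph_path V E (hd p) y p"
  using assms by (auto simp: graph_path_def successively_Cons)

lemma graph_path_nonempty: "graph_path V E x y p \<Longrightarrow> p \<noteq> [] \<and> hd p = x \<and> last p = y"
  by (simp add: graph_path_def)

text \<open>Let \<open>w\<close> be the first vertex of \<open>p\<close> that lies on
  \<open>q\<close>. Going from \<open>x\<close> along \<open>p\<close> to \<open>w\<close> and back
  along \<open>q\<close> closes a cycle, simple by the choice of \<open>w\<close>; as
  \<open>a\<close> and \<open>b\<close> differ, it has at least three vertices.\<close>

lemma two_graph_paths_cycle:
  assumes sym: "sym E" and p: "graph_path V E a y p" and q: "graph_path V E b y q" and ab: "a \<noteq> b"
    and xa: "(x, a) \<in> E" and xb: "(x, b) \<in> E" and xp: "x \<notin> set p" and xq: "x \<notin> set q"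
  shows "\<exists>c. graph_cycle E c"
proof -
  have "y \<in> set p" "y \<in> set q" using p q graph_path_nonempty last_in_set by metis+
  then obtain p1 w p2 where ps: "p = p1 @ w # p2" "w \<in> set q" "\<forall>u\<in>set p1. u \<notin> set q"
    using split_list_first_prop[of p "\<lambda>u. u \<in> set q"] by metis
  then obtain q1 q2 where qs: "q = q1 @ w # q2" using split_list by metis
  have hp: "hd (p1 @ [w]) = a" "hd (q1 @ [w]) = b"
    using graph_path_nonempty[OF p] graph_path_nonempty[OF q] unfolding ps qs by (cases p1; cases q1; simp)+
  have suc: "successively (\<lambda>u v. (u, v) \<in> E) (p1 @ [w])" "successively (\<lambda>u v. (u, v) \<in> E) (q1 @ [w])"
    using p q unfolding graph_path_def ps qs by (auto simp: successively_append_iff successively_Cons)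
  define c where "c = x # p1 @ w # rev q1"
  have "\<not> (p1 = [] \<and> q1 = [])" using hp ab by auto
  then have "length c \<ge> 3" by (cases p1; cases q1) (auto simp: c_def)
  moreover have "distinct c"
    using p q xp xq ps(3) unfolding graph_path_def ps(1) qs by (auto simp: c_def)
  moreover have "successively (\<lambda>u v. (u, v) \<in> E) c"
  proof -
    have "successively (\<lambda>u v. (u, v) \<in> E) (x # p1 @ [w])"
      using suc(1) hp(1) xa by (simp add: successively_Cons)
    moreover have "successively (\<lambda>u v. (v, u) \<in> E) (rev (q1 @ [w]))"
      using suc(2) by (simp only: successively_rev)
    then have "successively (\<lambda>u v. (u, v) \<in> E) (w # rev q1)"
      using sym by (simp add: sym_def) (metis (mono_tags, lifting) successively_mono)
    ultimately have "successively (\<lambda>u v. (u, v) \<in> E) ((x # p1) @ w # rev q1)"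
      unfolding successively_append_iff[of _ "x # p1"] by (auto simp: successively_append_iff[of _ "x # p1" "[w]", simplified])
    then show ?thesis by (simp add: c_def)
  qed
  moreover have "(last c, hd c) \<in> E"
  proof -
    have "last c = b" using hp(2) by (cases q1) (auto simp: c_def)
    then show ?thesis using xb sym by (simp add: c_def sym_def)
  qed
  ultimately have "graph_cycle E c" by (simp add: graph_cycle_def)
  then show ?thesis by blast
qed

lemma graph_path_loop: "graph_path V E x x p \<Longrightarrow> p = [x]"
proof (cases p)
  case (Cons z q)
  assume p: "graph_path V E x x p"
  have "q = []"
  proof (rule ccontr)
    assume "q \<noteq> []"
    then have "x \<notin> set q" "last q = x"
      using p unfolding Cons graph_path_Cons[OF \<open>q \<noteq> []\<close>] by (auto simp: graph_path_def)
    then show False using last_in_set[OF \<open>q \<noteq> []\<close>] by simp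
  qed
  then show ?thesis using p Cons by (simp add: graph_path_def)
qed (simp add: graph_path_def)

text \<open>If the second vertices of the two paths differed, both tails would lead from neighbours
  of \<open>x\<close> to \<open>y\<close> and close a cycle through \<open>x\<close>.\<close>

lemma unique_graph_path:
  assumes sg: "simple_graph V E" and acyc: "\<nexists>c. graph_cycle E c"
  shows "graph_path V E x y p \<Longrightarrow> graph_path V E x y q \<Longrightarrow> p = q"
proof (induction p arbitrary: x q)
  case Nil
  then show ?case by (simp add: graph_path_def)
next
  case (Cons z p)
  obtain z' q' where q: "q = z' # q'" using graph_path_nonempty[OF Cons.prems(2)] by (cases q) auto
  have z: "z = x" "z' = x"
    using graph_path_nonempty[OF Cons.prems(1)] graph_path_nonempty[OF Cons.prems(2)] q by simp_all
  show ?case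
  proof (cases "x = y")
    case True
    then show ?thesis using Cons.prems graph_path_loop by metis
  next
    case False
    then have ne: "p \<noteq> []" "q' \<noteq> []"
      using graph_path_nonempty[OF Cons.prems(1)] graph_path_nonempty[OF Cons.prems(2)] q z by auto
    note pp = Cons.prems(1)[unfolded graph_path_Cons[OF ne(1)]]
      and qq = Cons.prems(2)[unfolded q graph_path_Cons[OF ne(2)]]
    have "hd p = hd q'"
    proof (rule ccontr)
      assume "hd p \<noteq> hd q'"
      then have "\<exists>c. graph_cycle E c"
        using two_graph_paths_cycle[of E V "hd p" y p "hd q'" q' x] pp qq sg
        by (simp add: simple_graph_def)
      then show False using acyc by blast
    qed
    then have "p = q'" using pp qq Cons.IH by metis
    then show ?thesis using q z by simp
  qed
qed

section \<open>The tree order and the branches of a rooted fan\<close>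

locale rooted_fan =
  fixes V :: "'a set" and E :: "('a \<times> 'a) set" and r :: 'a
  assumes fan: "fan V E r"
begin

lemma finite_V: "finite V" and r_V: "r \<in> V" and sg: "simple_graph V E"
  and acyc: "\<nexists>c. graph_cycle E c" and deg: "v \<in> V \<Longrightarrow> v \<noteq> r \<Longrightarrow> degree_in E v \<le> 2"
  and conn: "x \<in> V \<Longrightarrow> y \<in> V \<Longrightarrow> \<exists>p. graph_path V E x y p"
  using fan by (auto simp: fan_def)

definition path :: "'a \<Rightarrow> 'a list" where
  "path t = (THE p. graph_path V E t r p)"

lemma path_eq: "graph_path V E t r p \<Longrightarrow> path t = p"
  unfolding path_def using unique_graph_path[OF sg acyc] by blast

lemma graph_path_path: "t \<in> V \<Longrightarrow> graph_path V E t r (path t)"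
  using conn[OF _ r_V] path_eq by metis

lemma path_props:
  assumes "t \<in> V"
  shows "path t \<noteq> []" "hd (path t) = t" "last (path t) = r" "set (path t) \<subseteq> V" "distinct (path t)"
    "successively (\<lambda>u v. (u, v) \<in> E) (path t)"
  using graph_path_path[OF assms] by (auto simp: graph_path_def)

lemma path_r: "path r = [r]"
  by (rule path_eq) (simp add: graph_path_def r_V)

lemma self_path: "t \<in> V \<Longrightarrow> t \<in> set (path t)"
  using path_props(1,2) by (metis list.set_sel(1))

lemma tree_le_iff: "t \<in> V \<Longrightarrow> tree_le V E r s t \<longleftrightarrow> s \<in> set (path t)"
  unfolding tree_le_def using graph_path_path path_eq by metis

lemma tree_le_V: "tree_le V E r s t \<Longrightarrow> s \<in> V \<and> t \<in> V"
  unfolding tree_le_def graph_path_def by (metis list.set_sel(1) subsetD)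

lemma path_suffix:
  assumes t: "t \<in> V" and p: "path t = xs @ s # ys"
  shows "path s = s # ys"
proof (rule path_eq)
  show "graph_path V E s r (s # ys)"
    using path_props[OF t] unfolding p
    by (auto simp: graph_path_def successively_append_iff split: if_splits)
qed

lemma path_suffix_ex:
  assumes "t \<in> V" "s \<in> set (path t)"
  shows "\<exists>xs. path t = xs @ path s"
  using assms path_suffix by (metis split_list)

lemma tree_le_refl: "t \<in> V \<Longrightarrow> tree_le V E r t t"
  by (simp add: tree_le_iff self_path)

lemma tree_le_trans:
  assumes "tree_le V E r s t" "tree_le V E r t u"
  shows "tree_le V E r s u"
proof -
  have V: "s \<in> V" "t \<in> V" "u \<in> V" using assms tree_le_V by blast+
  then obtain xs where "path u = xs @ path t" using path_suffix_ex assms(2) tree_le_iff by metis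
  then show ?thesis using assms(1) V by (simp add: tree_le_iff)
qed

lemma tree_le_length:
  assumes "tree_le V E r s t"
  shows "length (path s) \<le> length (path t)" "length (path s) = length (path t) \<Longrightarrow> s = t"
proof -
  have V: "s \<in> V" "t \<in> V" using assms tree_le_V by blast+
  then obtain xs where xs: "path t = xs @ path s" using path_suffix_ex assms(1) tree_le_iff by metis
  then show "length (path s) \<le> length (path t)" by simp
  assume "length (path s) = length (path t)"
  then have "path t = path s" using xs by simp
  then show "s = t" using path_props(2) V by metis
qed

lemma tree_le_antisym: "tree_le V E r s t \<Longrightarrow> tree_le V E r t s \<Longrightarrow> s = t"
  using tree_le_length by (metis le_antisym)

lemma tree_le_below:
  assumes "tree_le V E r s t" "tree_le V E r s' t"
  shows "tree_le V E r s s' \<or> tree_le V E r s' s"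
proof -
  have V: "s \<in> V" "s' \<in> V" "t \<in> V" using assms tree_le_V by blast+
  obtain xs ys where p: "path t = xs @ s # ys" using assms(1) V tree_le_iff by (metis split_list)
  then have ps: "path s = s # ys" using path_suffix V by blast
  have "s' \<in> set (path t)" using assms(2) V tree_le_iff by metis
  then consider "s' \<in> set (path s)" | "s' \<in> set xs" using p ps by auto
  then show ?thesis
  proof cases
    case 1
    then show ?thesis using V tree_le_iff by metis
  next
    case 2
    then obtain as bs where "xs = as @ s' # bs" by (metis split_list)
    then have "path s' = s' # bs @ s # ys" using path_suffix[OF V(3), of as s' "bs @ s # ys"] p by simp
    then show ?thesis using V by (simp add: tree_le_iff)
  qed
qed

text \<open>This is where the degree bound enters: branches separate only at the root. For
  incomparable \<open>s\<close> and \<open>s'\<close> above \<open>t\<close>, let \<open>w\<close>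
  be the vertex where their paths to the root meet. It is not the root, because \<open>t\<close>
  lies on both paths, and it has three neighbours: its predecessors on the two paths and its
  successor towards the root.\<close>

lemma tree_le_above:
  assumes t: "t \<noteq> r" and le: "tree_le V E r t s" "tree_le V E r t s'"
  shows "tree_le V E r s s' \<or> tree_le V E r s' s"
proof (rule ccontr)
  assume nc: "\<not> ?thesis"
  have V: "s \<in> V" "s' \<in> V" "t \<in> V" using le tree_le_V by blast+
  define p q where "p = path s" and "q = path s'"
  have tp: "t \<in> set p" and tq: "t \<in> set q" using le V by (simp_all add: tree_le_iff p_def q_def)
  then obtain p1 w p2 where p: "p = p1 @ w # p2" "w \<in> set q" "\<forall>u\<in>set p1. u \<notin> set q"
    using split_list_first_prop[of p "\<lambda>u. u \<in> set q"] by blast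
  then obtain q1 q2 where q: "q = q1 @ w # q2" by (metis split_list)
  have "path w = w # p2" "path w = w # q2"
    using path_suffix V p q unfolding p_def q_def by blast+
  then have q2: "q2 = p2" by simp
  have sp: "s = hd p" "s' = hd q" using V path_props(2) by (simp_all add: p_def q_def)
  have "s \<notin> set q" "s' \<notin> set p" using nc V by (simp_all add: tree_le_iff p_def q_def)
  then have p1: "p1 \<noteq> []" and q1: "q1 \<noteq> []" using sp p q by (auto simp: hd_append)
  have wV: "w \<in> V" using p path_props(4)[OF V(2)] by (auto simp: q_def)
  have p2: "p2 \<noteq> []"
  proof
    assume "p2 = []"
    then have "w = r" using path_props(3)[OF V(1)] p by (simp add: p_def)
    then show False using tp tq p \<open>p2 = []\<close> t by auto
  qed
  then have wr: "w \<noteq> r" using path_props(3,5)[OF V(1)] p by (auto simp: p_def[symmetric])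
  have suc: "successively (\<lambda>u v. (u, v) \<in> E) p" "successively (\<lambda>u v. (u, v) \<in> E) q"
    and dis: "distinct p" "distinct q"
    using path_props V by (simp_all add: p_def q_def)
  have sym: "(u, v) \<in> E \<Longrightarrow> (v, u) \<in> E" for u v
    using sg by (auto simp: simple_graph_def sym_def)
  have "(w, last p1) \<in> E" "(w, last q1) \<in> E" "(w, hd p2) \<in> E"
    using suc p1 q1 p2 unfolding p q q2 by (auto simp: successively_append_iff successively_Cons sym)
  then have sub: "{last p1, last q1, hd p2} \<subseteq> {x. (w, x) \<in> E}" by simp
  have "last p1 \<noteq> last q1" "last p1 \<noteq> hd p2" "last q1 \<noteq> hd p2"
    using last_in_set[OF p1] last_in_set[OF q1] hd_in_set[OF p2] p(3) dis unfolding p(1) q q2 by auto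
  then have "card {last p1, last q1, hd p2} = 3" by simp
  moreover have "finite {x. (w, x) \<in> E}"
  proof (rule finite_subset)
    show "{x. (w, x) \<in> E} \<subseteq> V" using sg by (auto simp: simple_graph_def)
  qed (rule finite_V)
  ultimately have "3 \<le> degree_in E w" using sub card_mono unfolding degree_in_def by metis
  then show False using deg[OF wV wr] by simp
qed

lemma immediate_successor_iff:
  assumes "t \<in> V" "s \<in> V"
  shows "immediate_successor V E r s t \<longleftrightarrow> path t = t # path s"
proof
  assume im: "immediate_successor V E r s t"
  then have st: "tree_le V E r s t" "s \<noteq> t" by (auto simp: immediate_successor_def tree_less_def)
  then obtain xs where xs: "path t = xs @ path s" using path_suffix_ex assms tree_le_iff by metis
  have "xs \<noteq> []" using xs st(2) path_props(2) assms by (metis append_Nil)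
  then obtain xs' where xs': "xs = t # xs'" using xs path_props(1,2)[OF assms(1)] by (cases xs) auto
  have "xs' = []"
  proof (rule ccontr)
    assume "xs' \<noteq> []"
    then obtain u us where u: "xs' = u # us" by (cases xs') auto
    have pu: "path u = u # us @ path s"
      by (rule path_suffix[of t "[t]"]) (use assms xs xs' u in auto)
    have uV: "u \<in> V" using path_props(4)[OF assms(1)] xs xs' u by auto
    have "tree_less V E r u t"
      using path_props(5)[OF assms(1)] xs xs' u assms by (auto simp: tree_less_def tree_le_iff)
    moreover have "tree_less V E r s u"
      using pu uV self_path[OF assms(2)] path_props(5)[OF uV] by (auto simp: tree_less_def tree_le_iff)
    ultimately show False using im by (auto simp: immediate_successor_def)
  qed
  then show "path t = t # path s" using xs xs' by simp
next
  assume p: "path t = t # path s"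
  then have "tree_less V E r s t"
    using assms self_path[of s] path_props(5)[OF assms(1)] by (auto simp: tree_less_def tree_le_iff)
  moreover have False if "tree_less V E r s u" "tree_less V E r u t" for u
  proof -
    have "u \<in> set (path s)" using that(2) p assms by (auto simp: tree_less_def tree_le_iff)
    then show False using that(1) assms tree_le_antisym[of u s] by (auto simp: tree_less_def tree_le_iff)
  qed
  ultimately show "immediate_successor V E r s t" by (auto simp: immediate_successor_def)
qed

lemma path_maxchain:
  assumes t: "t \<in> V" and max: "\<And>u. tree_le V E r t u \<Longrightarrow> u = t"
  shows "set (path t) \<in> branches V E r"
proof -
  have chain: "pred_on.chain V (tree_le V E r) (set (path t))"
    unfolding pred_on.chain_def
  proof (intro conjI ballI)
    fix x y assume "x \<in> set (path t)" "y \<in> set (path t)"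
    then have "tree_le V E r x t" "tree_le V E r y t" by (simp_all add: tree_le_iff t)
    then show "sup (tree_le V E r) (=) x y \<or> sup (tree_le V E r) (=) y x"
      using tree_le_below by auto
  qed (rule path_props(4)[OF t])
  moreover have False if C: "pred_on.chain V (tree_le V E r) C" "set (path t) \<subset> C" for C
  proof -
    obtain u where u: "u \<in> C" "u \<notin> set (path t)" using C(2) by blast
    have "t \<in> C" using C(2) self_path[OF t] by blast
    then have "tree_le V E r t u \<or> tree_le V E r u t"
      using C(1) u tree_le_refl t unfolding pred_on.chain_def by (auto simp: sup_fun_def)
    then show False using u t max tree_le_iff self_path by metis
  qed
  ultimately show ?thesis unfolding branches_def pred_on.maxchain_def by blast
qed

text \<open>The vertex of the chain with the longest path lies above all the others. Anything above
  it could be added to the chain, so it is a leaf, and its path, being a chain that contains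
  \<open>b\<close>, equals \<open>b\<close>.\<close>

lemma branch_path:
  assumes b: "b \<in> branches V E r"
  shows "\<exists>t\<in>V. (\<forall>u. tree_le V E r t u \<longrightarrow> u = t) \<and> b = set (path t)"
proof -
  have chain: "pred_on.chain V (tree_le V E r) b"
    and max: "\<And>C. pred_on.chain V (tree_le V E r) C \<Longrightarrow> \<not> b \<subset> C"
    using b unfolding branches_def pred_on.maxchain_def by blast+
  have bV: "b \<subseteq> V" using chain unfolding pred_on.chain_def by blast
  have cmp: "tree_le V E r x y \<or> tree_le V E r y x" if "x \<in> b" "y \<in> b" for x y
    using chain that bV tree_le_refl unfolding pred_on.chain_def by (auto simp: sup_fun_def)
  have ne: "b \<noteq> {}"
  proof
    assume "b = {}"
    moreover have "pred_on.chain V (tree_le V E r) {r}"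
      unfolding pred_on.chain_def using r_V by auto
    ultimately show False using max by blast
  qed
  have fb: "finite b" using bV finite_V finite_subset by blast
  then obtain t where t: "t \<in> b" "\<And>u. u \<in> b \<Longrightarrow> length (path u) \<le> length (path t)"
    using ne obtains_MAX[of b "\<lambda>u. length (path u)"] by (metis Max_ge finite_imageI imageI)
  have tV: "t \<in> V" using t bV by blast
  have below: "tree_le V E r u t" if "u \<in> b" for u
    using cmp[OF t(1) that] t(2)[OF that] tree_le_length by (metis le_antisym)
  have top: "u = t" if tu: "tree_le V E r t u" for u
  proof (rule ccontr)
    assume "u \<noteq> t"
    have "u \<notin> b" using below[of u] tree_le_antisym[OF tu] \<open>u \<noteq> t\<close> by auto
    have "pred_on.chain V (tree_le V E r) (insert u b)"
      unfolding pred_on.chain_def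
    proof (intro conjI ballI)
      show "insert u b \<subseteq> V" using bV tree_le_V[OF tu] by simp
      fix x y assume xy: "x \<in> insert u b" "y \<in> insert u b"
      have "tree_le V E r x u" if "x \<in> insert u b" for x
        using that below tree_le_trans[OF _ tu] tree_le_refl tree_le_V[OF tu] by blast
      then show "sup (tree_le V E r) (=) x y \<or> sup (tree_le V E r) (=) y x"
        using xy cmp by (auto simp: sup_fun_def)
    qed
    then show False using max \<open>u \<notin> b\<close> by blast
  qed
  have "b \<subseteq> set (path t)" using below tV tree_le_iff by blast
  moreover have "set (path t) \<in> branches V E r"
    using path_maxchain tV top by blast
  then have "pred_on.chain V (tree_le V E r) (set (path t))"
    unfolding branches_def pred_on.maxchain_def by blast
  ultimately have "b = set (path t)" using max by blast
  then show ?thesis using tV top by blast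
qed

lemma leaf_above:
  assumes "t \<in> V"
  shows "\<exists>u\<in>V. tree_le V E r t u \<and> (\<forall>w. tree_le V E r u w \<longrightarrow> w = u)"
proof -
  define U where "U = {u \<in> V. tree_le V E r t u}"
  have "finite U" "U \<noteq> {}" using finite_V tree_le_refl[OF assms] assms by (auto simp: U_def)
  then obtain u where u: "u \<in> U" "\<And>w. w \<in> U \<Longrightarrow> length (path w) \<le> length (path u)"
    using obtains_MAX[of U "\<lambda>u. length (path u)"] by (metis Max_ge finite_imageI imageI)
  have "w = u" if "tree_le V E r u w" for w
  proof -
    have "w \<in> U" using u(1) that tree_le_trans tree_le_V unfolding U_def by blast
    then show ?thesis using u(2) tree_le_length[OF that] by (metis le_antisym)
  qed
  then show ?thesis using u by (auto simp: U_def)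
qed

text \<open>Serves both directions: coordinatizing a given fan and verifying a constructed
  one.\<close>

lemma successor_coords:
  fixes v :: "nat \<Rightarrow> nat \<Rightarrow> 'a"
  assumes Vv: "V = {v i h |i h. i < n \<and> h \<le> N}"
    and len: "\<And>i h. i < n \<Longrightarrow> h \<le> N \<Longrightarrow> length (path (v i h)) = Suc h"
    and pSuc: "\<And>i h. i < n \<Longrightarrow> Suc h \<le> N \<Longrightarrow> path (v i (Suc h)) = v i (Suc h) # path (v i h)"
  shows "{(s, t). s \<in> V \<and> t \<in> V \<and> (s = t \<or> immediate_successor V E r s t)} =
    {(v i h, v i k) |i h k. i < n \<and> k \<le> N \<and> (k = h \<or> k = Suc h)}" (is "?L = ?R")
proof (intro equalityI subrelI)
  have vV: "v i h \<in> V" if "i < n" "h \<le> N" for i h using that unfolding Vv by blast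
  fix s t
  {
    assume "(s, t) \<in> ?L"
    then have st: "s \<in> V" "t \<in> V" "s = t \<or> immediate_successor V E r s t" by auto
    obtain i k where t: "t = v i k" "i < n" "k \<le> N" using st(2) unfolding Vv by blast
    show "(s, t) \<in> ?R"
    proof (cases "s = t")
      case True
      then show ?thesis using t by blast
    next
      case False
      then have p: "path t = t # path s" using st immediate_successor_iff by metis
      moreover have "length (path t) = Suc k" unfolding t(1) by (rule len[OF t(2,3)])
      ultimately have "length (path s) = k" by (metis length_Cons nat.inject)
      then obtain h where h: "k = Suc h" using path_props(1)[OF st(1)] by (cases k) auto
      have hN: "h \<le> N" using h t(3) by simp
      have "path t = t # path (v i h)"
        unfolding t(1) h by (rule pSuc) (use t h in simp_all)
      then have "path s = path (v i h)" using p by (metis list.inject)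
      then have "s = v i h"
        using path_props(2)[OF st(1)] path_props(2)[OF vV[OF t(2) hN]] by metis
      then show ?thesis using t h by blast
    qed
  next
    assume "(s, t) \<in> ?R"
    then obtain i h k where st: "s = v i h" "t = v i k" "i < n" "k \<le> N" "k = h \<or> k = Suc h" by blast
    then have hN: "h \<le> N" by auto
    have "s = t \<or> immediate_successor V E r s t"
      using st(5)
    proof
      assume "k = Suc h"
      then show ?thesis
        using st pSuc[of i h] immediate_successor_iff[OF vV[of i k] vV[of i h]] hN by simp
    qed (use st in simp)
    then show "(s, t) \<in> ?L" using st vV hN by simp
  }
qed

end

section \<open>Coordinates of an ordered fan by branch and level\<close>

abbreviation pts :: "'a RS_structure \<Rightarrow> 'a set" where
  "pts A \<equiv> topspace (Space A)"

text \<open>\<open>v i h\<close> is the vertex at level \<open>h\<close> of the \<open>i\<close>-th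
  branch. The equation for the root holds for all \<open>i\<close>, also beyond \<open>n\<close>, so
  that it applies without side conditions. With \<open>N = 0\<close> only the root remains, and
  distinct branches force \<open>n = 1\<close>.\<close>

definition fan_coords :: "'a RS_structure \<Rightarrow> nat \<Rightarrow> nat \<Rightarrow> (nat \<Rightarrow> nat \<Rightarrow> 'a) \<Rightarrow> bool" where
  "fan_coords A n N v \<longleftrightarrow>
     0 < n \<and> (N = 0 \<longrightarrow> n = 1) \<and> (\<forall>i. v i 0 = v 0 0) \<and>
     (\<forall>i<n. \<forall>j<n. \<forall>h\<le>N. \<forall>k\<le>N. v i h = v j k \<longrightarrow> h = k \<and> (h = 0 \<or> i = j)) \<and>
     Space A = discrete_topology {v i h |i h. i < n \<and> h \<le> N} \<and>
     RelR A = {(v i h, v i k) |i h k. i < n \<and> k \<le> N \<and> (k = h \<or> k = Suc h)} \<and>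
     RelS A = {(v i h, v j k) |i j h k. i \<le> j \<and> j < n \<and> h \<le> N \<and> k \<le> N}"

theorem ordered_fan_coords:
  assumes "ordered_fan A"
  shows "\<exists>n N v. fan_coords A n N v"
proof -
  obtain V E r bs where fan: "fan V E r"
    and hts: "\<forall>b\<in>branches V E r. \<forall>b'\<in>branches V E r. height b = height b'"
    and bs: "distinct bs" "set bs = branches V E r"
    and A: "Space A = discrete_topology V"
      "RelR A = {(s, t). s \<in> V \<and> t \<in> V \<and> (s = t \<or> immediate_successor V E r s t)}"
      "RelS A = {(x, y). \<exists>i j. i \<le> j \<and> j < length bs \<and> x \<in> bs ! i \<and> y \<in> bs ! j}"
    using assms unfolding ordered_fan_def by blast
  interpret rooted_fan V E r by standard (rule fan)
  define n where "n = length bs"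
  have "\<exists>t. t \<in> V \<and> (\<forall>u. tree_le V E r t u \<longrightarrow> u = t) \<and> bs ! i = set (path t)" if "i < n" for i
    using branch_path[of "bs ! i"] that bs(2) nth_mem[of i bs] unfolding n_def by blast
  then obtain tip where tip: "\<And>i. i < n \<Longrightarrow> tip i \<in> V"
    "\<And>i u. i < n \<Longrightarrow> tree_le V E r (tip i) u \<Longrightarrow> u = tip i" "\<And>i. i < n \<Longrightarrow> bs ! i = set (path (tip i))"
    by metis
  define N where "N = length (path (tip 0)) - 1"
  have on_branch: "\<exists>i<n. t \<in> bs ! i" if tV: "t \<in> V" for t
  proof -
    obtain u where u: "u \<in> V" "tree_le V E r t u" "\<forall>w. tree_le V E r u w \<longrightarrow> w = u"
      using leaf_above[OF tV] by blast
    then have "set (path u) \<in> set bs" using path_maxchain bs(2) by blast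
    then obtain i where "i < n" "bs ! i = set (path u)" unfolding n_def by (metis in_set_conv_nth)
    then show ?thesis using u tree_le_iff by blast
  qed
  have n: "0 < n" using on_branch[OF r_V] by auto
  have len: "length (path (tip i)) = Suc N" if "i < n" for i
  proof -
    have card: "card (bs ! j) = length (path (tip j))" if "j < n" for j
      using tip[OF that] path_props(5) by (simp add: distinct_card)
    have "height (bs ! i) = height (bs ! 0)"
      using hts bs(2) that n unfolding n_def by (metis nth_mem)
    then have "length (path (tip i)) - 1 = length (path (tip 0)) - 1"
      unfolding height_def card[OF that] card[OF n] .
    moreover have "0 < length (path (tip i))"
      using path_props(1)[OF tip(1)[OF that]] by simp
    ultimately show ?thesis unfolding N_def by linarith
  qed
  \<comment> \<open>Paths run from the leaf to the root, so level \<open>h\<close> sits at position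
    \<open>N - h\<close>; beyond the last branch the value is the root, as the root equation
    requires.\<close>
  define v where "v i h = (if i < n then path (tip i) ! (N - h) else r)" for i h
  have pv: "path (v i h) = drop (N - h) (path (tip i))" and vV: "v i h \<in> V" if "i < n" for i h
  proof -
    have l: "N - h < length (path (tip i))" using len[OF that] by simp
    have "path (tip i) = take (N - h) (path (tip i)) @ v i h # drop (Suc (N - h)) (path (tip i))"
      using id_take_nth_drop[OF l] that by (simp add: v_def)
    from path_suffix[OF tip(1)[OF that] this] show "path (v i h) = drop (N - h) (path (tip i))"
      using Cons_nth_drop_Suc[OF l] that by (simp add: v_def)
    show "v i h \<in> V" using path_props(4)[OF tip(1)[OF that]] nth_mem[OF l] that by (auto simp: v_def)
  qed
  have lenv: "length (path (v i h)) = Suc h" if "i < n" "h \<le> N" for i h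
    using pv[OF that(1)] len[OF that(1)] that(2) by simp
  have v0: "v i 0 = r" for i
  proof (cases "i < n")
    case True
    then show ?thesis
      using path_props(1,3)[OF tip(1)[OF True]] len[OF True] last_conv_nth[of "path (tip i)"] by (simp add: v_def)
  qed (simp add: v_def)
  have pSuc: "path (v i (Suc h)) = v i (Suc h) # path (v i h)" if "i < n" "Suc h \<le> N" for i h
  proof -
    have l: "N - Suc h < length (path (tip i))" using len[OF that(1)] by simp
    have "Suc (N - Suc h) = N - h" using that by simp
    then show ?thesis
      using pv[OF that(1)] Cons_nth_drop_Suc[OF l] that(1) by (simp add: v_def)
  qed
  have bsv: "bs ! i = {v i h |h. h \<le> N}" if i: "i < n" for i
  proof -
    have "set (path (tip i)) = {path (tip i) ! k |k. k < Suc N}"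
      using len[OF i] by (simp add: set_conv_nth)
    also have "\<dots> = {v i h |h. h \<le> N}"
    proof (intro equalityI subsetI)
      fix x assume "x \<in> {path (tip i) ! k |k. k < Suc N}"
      then obtain k where "x = path (tip i) ! k" "k \<le> N" by auto
      then have "x = v i (N - k)" "N - k \<le> N" using i by (simp_all add: v_def)
      then show "x \<in> {v i h |h. h \<le> N}" by blast
    next
      fix x assume "x \<in> {v i h |h. h \<le> N}"
      then obtain h where "x = path (tip i) ! (N - h)" using i by (auto simp: v_def)
      then show "x \<in> {path (tip i) ! k |k. k < Suc N}" by auto
    qed
    finally show ?thesis using tip(3)[OF i] by simp
  qed
  have Vv: "V = {v i h |i h. i < n \<and> h \<le> N}"
    using on_branch bsv vV by blast
  have vle: "tree_le V E r (v i h) (tip i)" if "i < n" "h \<le> N" for i h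
    using bsv[OF that(1)] tip(1,3)[OF that(1)] that tree_le_iff by blast
  have inj: "h = k \<and> (h = 0 \<or> i = j)" if "i < n" "j < n" "h \<le> N" "k \<le> N" "v i h = v j k" for i j h k
  proof -
    have hk: "h = k" using lenv that by (metis Suc_inject)
    \<comment> \<open>A vertex other than the root below two tips makes the tips comparable by
      \<open>tree_le_above\<close>; being leaves they coincide, and the enumeration of branches has
      no repetition.\<close>
    moreover have "i = j" if "h \<noteq> 0"
    proof -
      have "v i h \<noteq> r" using lenv[OF \<open>i < n\<close> \<open>h \<le> N\<close>] that path_r by auto
      moreover have "tree_le V E r (v i h) (tip i)" "tree_le V E r (v i h) (tip j)"
        using vle[of i h] vle[of j k] \<open>i < n\<close> \<open>j < n\<close> \<open>h \<le> N\<close> \<open>k \<le> N\<close> \<open>v i h = v j k\<close> by simp_all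
      ultimately have "tree_le V E r (tip i) (tip j) \<or> tree_le V E r (tip j) (tip i)"
        by (rule tree_le_above)
      then have "tip i = tip j" using tip(2) \<open>i < n\<close> \<open>j < n\<close> by metis
      then have "bs ! i = bs ! j" using tip(3) \<open>i < n\<close> \<open>j < n\<close> by simp
      then show "i = j" using bs(1) \<open>i < n\<close> \<open>j < n\<close> unfolding n_def by (simp add: nth_eq_iff_index_eq)
    qed
    ultimately show ?thesis by blast
  qed
  have N0: "n = 1" if "N = 0"
  proof (rule ccontr)
    assume "n \<noteq> 1"
    then have "1 < n" using n by simp
    then have "bs ! 0 = bs ! 1" using bsv[of 0] bsv[of 1] n v0 that by simp
    then show False using bs(1) \<open>1 < n\<close> n unfolding n_def by (metis nth_eq_iff_index_eq zero_neq_one)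
  qed
  have R: "RelR A = {(v i h, v i k) |i h k. i < n \<and> k \<le> N \<and> (k = h \<or> k = Suc h)}"
    unfolding A(2) by (rule successor_coords[OF Vv lenv pSuc])
  have S: "RelS A = {(v i h, v j k) |i j h k. i \<le> j \<and> j < n \<and> h \<le> N \<and> k \<le> N}" (is "_ = ?S")
  proof (intro equalityI subrelI)
    fix x y assume "(x, y) \<in> RelS A"
    then obtain i j where "i \<le> j" "j < n" "x \<in> bs ! i" "y \<in> bs ! j" by (auto simp: A n_def)
    then show "(x, y) \<in> ?S" using bsv[of i] bsv[of j] by auto
  next
    fix x y assume "(x, y) \<in> ?S"
    then obtain i j h k where "x = v i h" "y = v j k" "i \<le> j" "j < n" "h \<le> N" "k \<le> N" by blast
    then have "x \<in> bs ! i" "y \<in> bs ! j" using bsv[of i] bsv[of j] by auto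
    then show "(x, y) \<in> RelS A" using \<open>i \<le> j\<close> \<open>j < n\<close> by (auto simp: A n_def)
  qed
  have inj': "\<forall>i<n. \<forall>j<n. \<forall>h\<le>N. \<forall>k\<le>N. v i h = v j k \<longrightarrow> h = k \<and> (h = 0 \<or> i = j)"
    using inj by blast
  have N0': "N = 0 \<longrightarrow> n = 1" using N0 by blast
  have v0': "\<forall>i. v i 0 = v 0 0" by (simp add: v0)
  have Sp: "Space A = discrete_topology {v i h |i h. i < n \<and> h \<le> N}"
    unfolding A(1) Vv[symmetric] ..
  have "fan_coords A n N v"
    unfolding fan_coords_def by (intro conjI) (rule n N0' v0' inj' Sp R S)+
  then show ?thesis by blast
qed

section \<open>Spiders: fans with a prescribed number and height of branches\<close>

lemma cycle_neighbours:
  assumes c: "graph_cycle E c" and w: "w \<in> set c"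
  shows "\<exists>a b. a \<in> set c \<and> b \<in> set c \<and> a \<noteq> b \<and> (w, a) \<in> E \<and> (b, w) \<in> E"
proof -
  obtain xs ys where cs: "c = xs @ w # ys" using w by (metis split_list)
  define zs where "zs = ys @ xs"
  have len: "length zs \<ge> 2" and dis: "distinct zs" and suc: "successively (\<lambda>u v. (u, v) \<in> E) (xs @ w # ys)"
    and closing: "(last c, hd c) \<in> E"
    using c unfolding graph_cycle_def cs zs_def by auto
  obtain a zs' where zs: "zs = a # zs'" using len by (cases zs) auto
  then have ne: "zs' \<noteq> []" using len by auto
  have "a \<noteq> last zs" using dis zs ne by auto
  moreover have "a \<in> set zs" "last zs \<in> set zs" using zs by auto
  then have "a \<in> set c" "last zs \<in> set c" unfolding cs zs_def by auto
  moreover have "(w, a) \<in> E"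
  proof (cases ys)
    case Nil
    then have "last c = w" "hd c = a" using zs by (simp_all add: cs zs_def)
    then show ?thesis using closing by simp
  next
    case (Cons y ys')
    then have "y = a" using zs by (simp add: zs_def)
    then show ?thesis using suc unfolding Cons by (simp add: successively_append_iff)
  qed
  moreover have "(last zs, w) \<in> E"
  proof (cases "xs = []")
    case True
    then have "hd c = w" "last c = last zs" using zs by (auto simp: cs zs_def)
    then show ?thesis using closing by simp
  next
    case False
    then show ?thesis using suc by (simp add: successively_append_iff zs_def)
  qed
  ultimately show ?thesis by blast
qed

lemma successively_upt:
  "(\<And>m. a \<le> m \<Longrightarrow> Suc m < b \<Longrightarrow> P m (Suc m)) \<Longrightarrow> successively P [a..<b]"
proof (induction b)
  case (Suc b)
  then have IH: "successively P [a..<b]" by simp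
  show ?case
  proof (cases "a < b")
    case True
    then have "last [a..<b] = b - 1" by simp
    then have "P (last [a..<b]) b" using Suc.prems[of "b - 1"] True by simp
    then show ?thesis using IH True by (simp add: successively_append_iff)
  qed auto
qed simp

lemma graph_path_rev:
  assumes "sym E" "graph_path V E x y p"
  shows "graph_path V E y x (rev p)"
proof -
  have "successively (\<lambda>u v. (v, u) \<in> E) p"
  proof (rule successively_mono)
    show "successively (\<lambda>u v. (u, v) \<in> E) p" using assms(2) by (simp add: graph_path_def)
  qed (rule symD[OF assms(1)])
  then show ?thesis using assms(2) by (simp add: graph_path_def hd_rev last_rev)
qed

context
  fixes v :: "nat \<Rightarrow> nat \<Rightarrow> 'a" and n N :: nat
  assumes n: "0 < n" and N: "0 < N" and v0: "\<And>i. v i 0 = v 0 0"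
    and inj: "\<And>i j h k. v i h = v j k \<Longrightarrow> h = k \<and> (h = 0 \<or> i = j)"
begin

definition spider_vertices :: "'a set" where
  "spider_vertices = {v i h |i h. i < n \<and> h \<le> N}"

lemma spider_in: "i < n \<Longrightarrow> h \<le> N \<Longrightarrow> v i h \<in> spider_vertices"
  unfolding spider_vertices_def by blast

definition spider_edges :: "('a \<times> 'a) set" where
  "spider_edges = {(v i h, v i (Suc h)) |i h. i < n \<and> h < N} \<union> {(v i (Suc h), v i h) |i h. i < n \<and> h < N}"

lemma spider_edgeD:
  assumes "(v i h, y) \<in> spider_edges"
  shows "(0 < h \<and> y = v i (h - 1)) \<or> (\<exists>j<n. h < N \<and> y = v j (Suc h) \<and> (0 < h \<longrightarrow> j = i))"
proof -
  consider j k where "j < n" "k < N" "v i h = v j k" "y = v j (Suc k)"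
    | j k where "j < n" "k < N" "v i h = v j (Suc k)" "y = v j k"
    using assms unfolding spider_edges_def by blast
  then show ?thesis
  proof cases
    case 1
    then show ?thesis using inj[OF 1(3)] by auto
  next
    case 2
    then show ?thesis using inj[OF 2(3)] by auto
  qed
qed

lemma spider_sym: "sym spider_edges"
  unfolding sym_def spider_edges_def by blast

text \<open>A vertex of maximal level on a cycle would have two distinct neighbours on the cycle,
  but the only neighbour that is not higher is the next vertex towards the root.\<close>

lemma spider_acyclic: "\<nexists>c. graph_cycle spider_edges c"
proof
  assume "\<exists>c. graph_cycle spider_edges c"
  then obtain c where c: "graph_cycle spider_edges c" by blast
  define lev where "lev x = (THE h. \<exists>i. x = v i h)" for x
  have lev: "lev (v i h) = h" for i h
    unfolding lev_def using inj by (intro the_equality) blast+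
  have "set c \<noteq> {}" using c by (auto simp: graph_cycle_def)
  then obtain w where w: "w \<in> set c" "\<And>u. u \<in> set c \<Longrightarrow> lev u \<le> lev w"
    using obtains_MAX[of "set c" lev] by (metis List.finite_set Max_ge finite_imageI imageI)
  obtain a b where ab: "a \<in> set c" "b \<in> set c" "a \<noteq> b" "(w, a) \<in> spider_edges" "(b, w) \<in> spider_edges"
    using cycle_neighbours[OF c w(1)] by blast
  have bw: "(w, b) \<in> spider_edges" using ab(5) spider_sym by (auto simp: sym_def)
  obtain i h where wv: "w = v i h" using ab(4) unfolding spider_edges_def by blast
  have "u = v i (h - 1)" if "u \<in> set c" "(w, u) \<in> spider_edges" for u
    using spider_edgeD[OF that(2)[unfolded wv]] w(2)[OF that(1)] by (auto simp: wv lev)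
  then show False using ab bw by metis
qed

lemma spider_segment:
  assumes "i < n" "h \<le> k" "k \<le> N"
  shows "graph_path spider_vertices spider_edges (v i h) (v i k) (map (v i) [h..<Suc k])"
  unfolding graph_path_def
proof (intro conjI)
  show "set (map (v i) [h..<Suc k]) \<subseteq> spider_vertices"
    using assms by (auto intro!: spider_in)
  show "distinct (map (v i) [h..<Suc k])"
    using inj by (auto simp: distinct_map inj_on_def simp del: upt_Suc)
  show "successively (\<lambda>u v. (u, v) \<in> spider_edges) (map (v i) [h..<Suc k])"
    unfolding successively_map
  proof (rule successively_upt)
    fix m assume "Suc m < Suc k"
    then have "m < N" using assms by simp
    then show "(v i m, v i (Suc m)) \<in> spider_edges" using assms(1) unfolding spider_edges_def by blast
  qed
  show "hd (map (v i) [h..<Suc k]) = v i h" using assms by (simp add: hd_map del: upt_Suc)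
  show "last (map (v i) [h..<Suc k]) = v i k" using assms by simp
qed (use assms in simp)

lemma spider_root_path:
  assumes "i < n" "h \<le> N"
  shows "graph_path spider_vertices spider_edges (v i h) (v 0 0) (rev (map (v i) [0..<Suc h]))"
  using graph_path_rev[OF spider_sym spider_segment[OF assms(1) _ assms(2)], of 0] v0[of i] by simp

lemma spider_connected:
  assumes "x \<in> spider_vertices" "y \<in> spider_vertices"
  shows "\<exists>p. graph_path spider_vertices spider_edges x y p"
proof -
  obtain i h j k where x: "x = v i h" "i < n" "h \<le> N" and y: "y = v j k" "j < n" "k \<le> N"
    using assms unfolding spider_vertices_def by blast
  consider "k = 0" | "i = j" "h \<le> k" | "i = j" "k \<le> h" | "i \<noteq> j" "0 < k" by linarith
  then show ?thesis
  proof cases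
    case 1
    then show ?thesis using spider_root_path[OF x(2,3)] x y v0 by metis
  next
    case 2
    then show ?thesis using spider_segment x y by blast
  next
    case 3
    then show ?thesis using graph_path_rev[OF spider_sym spider_segment] x y by blast
  next
    case 4
    \<comment> \<open>\<open>q\<close> starts at level 1, so that the root, already the end of
      \<open>p\<close>, is not repeated.\<close>
    define p q where "p = rev (map (v i) [0..<Suc h])" and "q = map (v j) [1..<Suc k]"
    have p: "graph_path spider_vertices spider_edges x (v 0 0) p"
      using spider_root_path[OF x(2,3)] x by (simp add: p_def)
    have q: "graph_path spider_vertices spider_edges (v j 1) y q"
      using spider_segment[of j 1 k] 4 y by (simp add: q_def)
    have "(v 0 0, v j 1) \<in> spider_edges"
    proof -
      have "(v j 0, v j (Suc 0)) \<in> spider_edges" using y N unfolding spider_edges_def by blast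
      then show ?thesis using v0[of j] by simp
    qed
    moreover have "set p \<inter> set q = {}"
    proof (rule ccontr)
      assume "set p \<inter> set q \<noteq> {}"
      then obtain a b where "v i a = v j b" "1 \<le> b" by (auto simp: p_def q_def simp del: upt_Suc)
      then show False using inj[of i a j b] 4 by simp
    qed
    ultimately have "graph_path spider_vertices spider_edges x y (p @ q)"
      using p q unfolding graph_path_def by (simp add: successively_append_iff)
    then show ?thesis by blast
  qed
qed

lemma spider_fan: "fan spider_vertices spider_edges (v 0 0)"
  unfolding fan_def
proof (intro conjI ballI)
  have "spider_vertices = (\<lambda>(i, h). v i h) ` ({..<n} \<times> {..N})"
    unfolding spider_vertices_def by auto
  then show fin: "finite spider_vertices" by simp
  show "v 0 0 \<in> spider_vertices" using n unfolding spider_vertices_def by blast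
  show "simple_graph spider_vertices spider_edges"
    unfolding simple_graph_def
  proof (intro conjI spider_sym)
    show "spider_edges \<subseteq> spider_vertices \<times> spider_vertices"
      unfolding spider_edges_def by (auto intro!: spider_in)
    show "irrefl spider_edges"
      unfolding irrefl_def spider_edges_def using inj by (auto dest: inj)
  qed
  fix x assume x: "x \<in> spider_vertices - {v 0 0}"
  then obtain i h where ih: "x = v i h" "0 < h" using v0 unfolding spider_vertices_def by (auto, metis gr0I)
  have "{w. (x, w) \<in> spider_edges} \<subseteq> {v i (h - 1), v i (Suc h)}"
    using spider_edgeD[of i h] ih by auto
  then have "card {w. (x, w) \<in> spider_edges} \<le> card {v i (h - 1), v i (Suc h)}"
    by (intro card_mono) auto
  also have "\<dots> \<le> 2" by (simp add: card_insert_if)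
  finally show "degree_in spider_edges x \<le> 2" by (simp add: degree_in_def)
qed (use spider_connected spider_acyclic in auto)

interpretation spider: rooted_fan spider_vertices spider_edges "v 0 0"
  by standard (rule spider_fan)

lemma spider_path: "i < n \<Longrightarrow> h \<le> N \<Longrightarrow> spider.path (v i h) = rev (map (v i) [0..<Suc h])"
  by (rule spider.path_eq[OF spider_root_path])

lemma spider_le:
  assumes "i < n" "h \<le> N"
  shows "tree_le spider_vertices spider_edges (v 0 0) s (v i h) \<longleftrightarrow> s \<in> v i ` {..h}"
proof -
  have "v i h \<in> spider_vertices" using assms unfolding spider_vertices_def by blast
  then show ?thesis
    by (simp only: spider.tree_le_iff spider_path[OF assms] set_rev set_map set_upt atLeast0LessThan lessThan_Suc_atMost)
qed

lemma spider_tip: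
  assumes "i < n" "tree_le spider_vertices spider_edges (v 0 0) (v i N) u"
  shows "u = v i N"
proof -
  obtain j k where u: "u = v j k" "j < n" "k \<le> N"
    using spider.tree_le_V[OF assms(2)] unfolding spider_vertices_def by blast
  then obtain k' where "v i N = v j k'" "k' \<le> k"
    using assms(2) spider_le[OF u(2,3)] by auto
  then show ?thesis using inj[of i N j k'] u N by auto
qed

lemma spider_branches: "branches spider_vertices spider_edges (v 0 0) = (\<lambda>i. v i ` {..N}) ` {..<n}"
proof (intro equalityI subsetI)
  fix b assume "b \<in> branches spider_vertices spider_edges (v 0 0)"
  then obtain t where t: "t \<in> spider_vertices" "b = set (spider.path t)"
    "\<And>u. tree_le spider_vertices spider_edges (v 0 0) t u \<Longrightarrow> u = t"
    using spider.branch_path by blast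
  then obtain i h where ih: "t = v i h" "i < n" "h \<le> N" unfolding spider_vertices_def by blast
  have "h = N"
  proof (rule ccontr)
    assume "h \<noteq> N"
    then have "tree_le spider_vertices spider_edges (v 0 0) t (v i (Suc h))"
      using ih by (auto simp: spider_le)
    then show False using t(3) inj[of i "Suc h" i h] ih by auto
  qed
  then show "b \<in> (\<lambda>i. v i ` {..N}) ` {..<n}"
    using t(2) ih spider_path by (auto simp: atLeast0LessThan lessThan_Suc_atMost simp del: upt_Suc)
next
  fix b assume "b \<in> (\<lambda>i. v i ` {..N}) ` {..<n}"
  then obtain i where i: "i < n" "b = v i ` {..N}" by auto
  then have "v i N \<in> spider_vertices" unfolding spider_vertices_def by blast
  moreover have "set (spider.path (v i N)) = b"
    using i spider_path by (auto simp: atLeast0LessThan lessThan_Suc_atMost simp del: upt_Suc)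
  ultimately show "b \<in> branches spider_vertices spider_edges (v 0 0)"
    using spider.path_maxchain spider_tip[OF i(1)] by metis
qed

definition spider_structure :: "'a RS_structure" where
  "spider_structure = \<lparr>Space = discrete_topology spider_vertices,
     RelR = {(v i h, v i k) |i h k. i < n \<and> k \<le> N \<and> (k = h \<or> k = Suc h)},
     RelS = {(v i h, v j k) |i j h k. i \<le> j \<and> j < n \<and> h \<le> N \<and> k \<le> N}\<rparr>"

lemma spider_R:
  "{(s, t). s \<in> spider_vertices \<and> t \<in> spider_vertices \<and>
      (s = t \<or> immediate_successor spider_vertices spider_edges (v 0 0) s t)} =
   {(v i h, v i k) |i h k. i < n \<and> k \<le> N \<and> (k = h \<or> k = Suc h)}"
proof (rule spider.successor_coords[OF spider_vertices_def])
  show "length (spider.path (v i h)) = Suc h" if "i < n" "h \<le> N" for i h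
    using spider_path[OF that] by simp
  show "spider.path (v i (Suc h)) = v i (Suc h) # spider.path (v i h)" if "i < n" "Suc h \<le> N" for i h
    using that spider_path[of i h] spider_path[of i "Suc h"] by simp
qed

lemma spider_ordered_fan: "ordered_fan spider_structure"
proof -
  define bs where "bs = map (\<lambda>i. v i ` {..N}) [0..<n]"
  have card: "card (v i ` {..N}) = Suc N" for i
  proof -
    have "inj_on (v i) {..N}" using inj by (auto simp: inj_on_def)
    then show ?thesis by (simp add: card_image)
  qed
  have "distinct bs"
    unfolding bs_def distinct_map
  proof (intro conjI inj_onI)
    fix i j assume "v i ` {..N} = v j ` {..N}"
    then have "v i N \<in> v j ` {..N}" by blast
    then show "i = j" using inj N by blast
  qed simp
  moreover have "set bs = branches spider_vertices spider_edges (v 0 0)"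
    unfolding bs_def spider_branches by auto
  moreover have "\<forall>b\<in>branches spider_vertices spider_edges (v 0 0).
      \<forall>b'\<in>branches spider_vertices spider_edges (v 0 0). height b = height b'"
    unfolding spider_branches by (simp add: height_def card)
  moreover have "RelS spider_structure = {(x, y). \<exists>i j. i \<le> j \<and> j < length bs \<and> x \<in> bs ! i \<and> y \<in> bs ! j}"
    unfolding spider_structure_def bs_def by force
  moreover have "Space spider_structure = discrete_topology spider_vertices"
    "RelR spider_structure = {(s, t). s \<in> spider_vertices \<and> t \<in> spider_vertices \<and>
      (s = t \<or> immediate_successor spider_vertices spider_edges (v 0 0) s t)}"
    unfolding spider_R by (simp_all add: spider_structure_def)
  ultimately show ?thesis
    unfolding ordered_fan_def using spider_fan by blast
qed

lemma spider_fan_coords: "fan_coords spider_structure n N v"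
proof -
  have a: "N = 0 \<longrightarrow> n = 1" using N by simp
  have b: "\<forall>i. v i 0 = v 0 0" using v0 by blast
  have c: "\<forall>i<n. \<forall>j<n. \<forall>h\<le>N. \<forall>k\<le>N. v i h = v j k \<longrightarrow> h = k \<and> (h = 0 \<or> i = j)"
    using inj by blast
  show ?thesis
    unfolding fan_coords_def
    by (intro conjI n a b c) (simp_all only: spider_structure_def RS_structure.simps spider_vertices_def)
qed

end

text \<open>The root is coded as 0 and every other vertex as the successor of the code of its
  coordinates, which gives injectivity away from level 0.\<close>

theorem ordered_fan_exists:
  assumes "0 < n" "0 < N"
  shows "\<exists>(A :: nat RS_structure) v. ordered_fan A \<and> fan_coords A n N v"
proof -
  define v where "v i h = (if h = 0 then 0 else Suc (prod_encode (i, h)))" for i h :: nat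
  have v: "v i 0 = v 0 0" "v i h = v j k \<Longrightarrow> h = k \<and> (h = 0 \<or> i = j)" for i j h k
    by (auto simp: v_def split: if_splits)
  show ?thesis
    using spider_ordered_fan[of n N v] spider_fan_coords[of n N v] assms v by blast
qed

section \<open>Epimorphisms in coordinates\<close>

lemma fan_coordsD:
  assumes "fan_coords A n N v"
  shows "0 < n" "N = 0 \<Longrightarrow> n = 1" "v i 0 = v 0 0"
    "i < n \<Longrightarrow> j < n \<Longrightarrow> h \<le> N \<Longrightarrow> k \<le> N \<Longrightarrow> v i h = v j k \<Longrightarrow> h = k \<and> (h = 0 \<or> i = j)"
    "Space A = discrete_topology {v i h |i h. i < n \<and> h \<le> N}"
    "pts A = {v i h |i h. i < n \<and> h \<le> N}"
    "i < n \<Longrightarrow> h \<le> N \<Longrightarrow> v i h \<in> pts A"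
    "RelR A = {(v i h, v i k) |i h k. i < n \<and> k \<le> N \<and> (k = h \<or> k = Suc h)}"
    "RelS A = {(v i h, v j k) |i j h k. i \<le> j \<and> j < n \<and> h \<le> N \<and> k \<le> N}"
proof -
  note A = assms[unfolded fan_coords_def]
  note A2 = A[THEN conjunct2] note A3 = A2[THEN conjunct2] note A4 = A3[THEN conjunct2]
  note A5 = A4[THEN conjunct2] note A6 = A5[THEN conjunct2]
  show "0 < n" by (rule A[THEN conjunct1])
  show "N = 0 \<Longrightarrow> n = 1" by (rule A2[THEN conjunct1, THEN mp])
  show "v i 0 = v 0 0" by (rule A3[THEN conjunct1, THEN spec])
  show "RelR A = {(v i h, v i k) |i h k. i < n \<and> k \<le> N \<and> (k = h \<or> k = Suc h)}"
    by (rule A6[THEN conjunct1])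
  show "RelS A = {(v i h, v j k) |i j h k. i \<le> j \<and> j < n \<and> h \<le> N \<and> k \<le> N}"
    by (rule A6[THEN conjunct2])
  show "Space A = discrete_topology {v i h |i h. i < n \<and> h \<le> N}"
    by (rule A5[THEN conjunct1])
  then show "pts A = {v i h |i h. i < n \<and> h \<le> N}" by (simp only: topspace_discrete_topology)
  then show "i < n \<Longrightarrow> h \<le> N \<Longrightarrow> v i h \<in> pts A" by blast
  show "h = k \<and> (h = 0 \<or> i = j)" if "i < n" "j < n" "h \<le> N" "k \<le> N" "v i h = v j k"
    by (rule A4[THEN conjunct1, rule_format, OF that])
qed

text \<open>The root lies on all branches, so its label is an arbitrary choice; only its level is
  determined.\<close>

lemma fan_coords_inverse:
  assumes "fan_coords A n N v"
  obtains lab lev where "\<And>i h. i < n \<Longrightarrow> h \<le> N \<Longrightarrow> lev (v i h) = h"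
    "\<And>i h. i < n \<Longrightarrow> h \<le> N \<Longrightarrow> 0 < h \<Longrightarrow> lab (v i h) = i"
    "\<And>x. x \<in> pts A \<Longrightarrow> lab x < n \<and> lev x \<le> N \<and> v (lab x) (lev x) = x"
proof -
  note A = fan_coordsD[OF assms]
  have "\<forall>x\<in>pts A. \<exists>i h. i < n \<and> h \<le> N \<and> v i h = x"
    unfolding A(6) by blast
  then obtain lab lev where *: "\<And>x. x \<in> pts A \<Longrightarrow> lab x < n \<and> lev x \<le> N \<and> v (lab x) (lev x) = x"
    by metis
  show thesis
  proof
    show "lev (v i h) = h" if "i < n" "h \<le> N" for i h
      using *[OF A(7)[OF that]] A(4) that by metis
    show "lab (v i h) = i" if "i < n" "h \<le> N" "0 < h" for i h
      using *[OF A(7)[OF that(1,2)]] A(4)[of "lab (v i h)" i "lev (v i h)" h] that by auto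
  qed (use * in auto)
qed

lemma finite_fan_coords: "fan_coords A n N v \<Longrightarrow> finite (pts A)"
proof -
  assume A: "fan_coords A n N v"
  have "pts A = (\<lambda>(i, h). v i h) ` ({..<n} \<times> {..N})"
    unfolding fan_coordsD(6)[OF A] by auto
  then show ?thesis by simp
qed

lemma epimorphism_topspace:
  "epimorphism B A f \<Longrightarrow> x \<in> pts B \<Longrightarrow> f x \<in> pts A"
  unfolding epimorphism_def by blast

lemma epimorphism_R:
  assumes "epimorphism B A f" "(x, y) \<in> RelR B" "x \<in> pts B" "y \<in> pts B"
  shows "(f x, f y) \<in> RelR A"
proof -
  have "f x \<in> pts A" "f y \<in> pts A" using assms epimorphism_topspace by metis+
  then show ?thesis using assms unfolding epimorphism_def by blast
qed

lemma epimorphism_S: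
  assumes "epimorphism B A f" "(x, y) \<in> RelS B" "x \<in> pts B" "y \<in> pts B"
  shows "(f x, f y) \<in> RelS A"
proof -
  have "f x \<in> pts A" "f y \<in> pts A" using assms epimorphism_topspace by metis+
  then show ?thesis using assms unfolding epimorphism_def by blast
qed

lemma slow_reaches:
  assumes "slow s" "h \<le> s M"
  shows "\<exists>k\<le>M. s k = h"
  using assms(2)
proof (induction M)
  case 0
  then show ?case using slow_0[OF assms(1)] by auto
next
  case (Suc M)
  show ?case
  proof (cases "h \<le> s M")
    case True
    then show ?thesis using Suc by (meson le_SucI)
  next
    case False
    then have "s (Suc M) = h" using slow_Suc[OF assms(1), of M] Suc.prems by linarith
    then show ?thesis by blast
  qed
qed

lemma slow_jumps:
  assumes "slow s" "Suc h \<le> s M"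
  shows "\<exists>k<M. s k = h \<and> s (Suc k) = Suc h"
  using assms(2)
proof (induction M)
  case 0
  then show ?case using slow_0[OF assms(1)] by auto
next
  case (Suc M)
  show ?case
  proof (cases "Suc h \<le> s M")
    case True
    then show ?thesis using Suc by (meson less_SucI)
  next
    case False
    then have "s M = h \<and> s (Suc M) = Suc h" using slow_Suc[OF assms(1), of M] Suc.prems by linarith
    then show ?thesis by blast
  qed
qed

text \<open>An edge of \<open>B\<close> goes to a vertex or an edge of \<open>A\<close>, so along a
  branch the level never drops and rises by at most one, and off the root the image stays in one
  branch. \<open>RelS\<close> gives monotonicity of the labels, and surjectivity onto the tips of
  \<open>A\<close> gives \<open>full\<close>.\<close>

lemma epimorphism_fan_data:
  assumes B: "fan_coords B b M w" and A: "fan_coords A n N v" and f: "epimorphism B A f"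
  shows "\<exists>l s. fan_data b M n N l s \<and> (\<forall>a<b. \<forall>h\<le>M. f (w a h) = v (l a) (s a h))"
proof -
  obtain lab lev where lev: "\<And>i h. i < n \<Longrightarrow> h \<le> N \<Longrightarrow> lev (v i h) = h"
    and lab: "\<And>i h. i < n \<Longrightarrow> h \<le> N \<Longrightarrow> 0 < h \<Longrightarrow> lab (v i h) = i"
    and inv: "\<And>x. x \<in> pts A \<Longrightarrow> lab x < n \<and> lev x \<le> N \<and> v (lab x) (lev x) = x"
    by (rule fan_coords_inverse[OF A]) blast
  note cA = fan_coordsD[OF A] and cB = fan_coordsD[OF B]
  have fA: "f (w a h) \<in> pts A" if "a < b" "h \<le> M" for a h
    using epimorphism_topspace[OF f cB(7)[OF that]] .
  have surj: "\<exists>a h. a < b \<and> h \<le> M \<and> f (w a h) = x" if "x \<in> pts A" for x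
  proof -
    have "x \<in> f ` pts B" using f that unfolding epimorphism_def by blast
    then show ?thesis unfolding cB(6) by blast
  qed
  have edge: "\<exists>i h' k'. i < n \<and> k' \<le> N \<and> (k' = h' \<or> k' = Suc h') \<and> f (w a h) = v i h' \<and> f (w a (Suc h)) = v i k'"
    if "a < b" "h < M" for a h
  proof -
    have "Suc h \<le> M" using that by simp
    then have "(w a h, w a (Suc h)) \<in> RelR B" using that(1) unfolding cB(8) by blast
    then have "(f (w a h), f (w a (Suc h))) \<in> RelR A"
      using epimorphism_R[OF f] cB(7)[of a] that by simp
    then show ?thesis unfolding cA(8) by blast
  qed
  have lev_step: "lev (f (w a (Suc h))) = lev (f (w a h)) \<or> lev (f (w a (Suc h))) = Suc (lev (f (w a h)))"
    if bh: "a < b" "h < M" for a h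
  proof -
    obtain i h' k' where s: "i < n" "k' \<le> N" "k' = h' \<or> k' = Suc h'" "f (w a h) = v i h'" "f (w a (Suc h)) = v i k'"
      using edge[OF bh] by blast
    then show ?thesis using lev[of i h'] lev[of i k'] by auto
  qed
  \<comment> \<open>Levels do not drop along branches, so the image of the root has the least level
    of all; by surjectivity this is 0.\<close>
  have lev_root: "lev (f (w a 0)) = 0" if "a < b" for a
  proof -
    have "lev (f (w 0 0)) \<le> lev (f (w a' h))" if "a' < b" "h \<le> M" for a' h
      using that(2)
    proof (induction h)
      case 0
      then show ?case using cB(3)[of a'] by simp
    next
      case (Suc h)
      then show ?case using lev_step[OF that(1), of h] by force
    qed
    moreover obtain a' h where "a' < b" "h \<le> M" "f (w a' h) = v 0 0"
      using surj[OF cA(7)[of 0 0]] cA(1) by blast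
    moreover have "lev (v 0 0) = 0" using lev cA(1) by simp
    ultimately have "lev (f (w 0 0)) = 0" by (metis le_zero_eq)
    then show ?thesis using cB(3)[of a] by simp
  qed
  define l where "l a = lab (f (w a M))" for a
  \<comment> \<open>Capping at \<open>M\<close> makes \<open>s a\<close> constant past the tip,
    hence slow on all natural numbers.\<close>
  define s where "s a h = lev (f (w a (min h M)))" for a h
  have l: "l a < n" if "a < b" for a
    using inv fA[of a M] that by (simp add: l_def)
  have s: "slow (s a)" if "a < b" for a
    unfolding slow_def
  proof (intro conjI allI)
    show "s a 0 = 0" using lev_root[OF that] by (simp add: s_def)
    show "s a (Suc h) = s a h \<or> s a (Suc h) = Suc (s a h)" for h
    proof (cases "h < M")
      case True
      then show ?thesis using lev_step[OF that True] by (simp add: s_def min_def)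
    qed (simp add: s_def min_def)
  qed
  have sN: "s a h \<le> N" if "a < b" for a h
    using inv[OF fA[OF that, of "min h M"]] by (simp add: s_def)
  \<comment> \<open>Descending from the tip, whose label defines \<open>l a\<close>: an edge lies in
    a single branch of \<open>A\<close>, so the label persists as long as the level is positive, and
    at level 0 it does not matter.\<close>
  have fv: "f (w a h) = v (l a) (s a h)" if b: "a < b" and "h \<le> M" for a h
    using that(2)
  proof (induction rule: inc_induct)
    case base
    then show ?case using inv[OF fA[OF b, of M]] by (simp add: l_def s_def)
  next
    case (step h)
    obtain i h' k' where e: "i < n" "k' \<le> N" "k' = h' \<or> k' = Suc h'" "f (w a h) = v i h'" "f (w a (Suc h)) = v i k'"
      using edge[OF b step(2)] by blast
    have h': "h' \<le> N" using e by auto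
    have "v i k' = v (l a) (s a (Suc h))" using step(3) e by simp
    then have "k' = s a (Suc h) \<and> (k' = 0 \<or> i = l a)"
      using cA(4)[OF e(1) l[OF b] e(2) sN[OF b]] by blast
    moreover have "s a h = h'" using lev[OF e(1) h'] e(4) step(2) by (simp add: s_def min_def)
    ultimately show ?case using e cA(3)[of i] cA(3)[of "l a"] by auto
  qed
  have mono: "l a \<le> l a'" if a: "a \<le> a'" "a' < b" "0 < s a M" "0 < s a' M" for a a'
  proof -
    have b: "a < b" using that by simp
    have "(w a M, w a' M) \<in> RelS B" using that unfolding cB(9) by blast
    then have "(f (w a M), f (w a' M)) \<in> RelS A"
      using epimorphism_S[OF f] cB(7) that b by blast
    then obtain i j h k where ij: "i \<le> j" "j < n" "h \<le> N" "k \<le> N"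
      "v (l a) (s a M) = v i h" "v (l a') (s a' M) = v j k"
      using fv[OF b, of M] fv[OF a(2), of M] unfolding cA(9) by auto
    have "l a = i" using cA(4)[OF l[OF b] _ sN[OF b] ij(3) ij(5)] ij that by simp
    moreover have "l a' = j" using cA(4)[OF l[OF that(2)] ij(2) sN[OF that(2)] ij(4) ij(6)] that by simp
    ultimately show ?thesis using ij by simp
  qed
  have full: "\<exists>a<b. l a = i \<and> s a M = N" if i: "i < n" for i
  proof -
    obtain a h where a: "a < b" "h \<le> M" "f (w a h) = v i N"
      using surj[OF cA(7)[OF i, of N]] by blast
    then have "v (l a) (s a h) = v i N" using fv by simp
    then have e: "s a h = N \<and> (s a h = 0 \<or> l a = i)"
      using cA(4)[OF l[OF a(1)] i sN[OF a(1), of h] order_refl] by blast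
    have "s a M = N" using slow_mono[OF s[OF a(1)] a(2)] sN[OF a(1), of M] e by simp
    moreover have "l a = i"
    proof (cases "N = 0")
      case True
      then show ?thesis using cA(2) l[OF a(1)] that by simp
    qed (use e in auto)
    ultimately show ?thesis using a(1) by blast
  qed
  have "fan_data b M n N l s"
    unfolding fan_data_def using l s sN mono full by blast
  then show ?thesis using fv by blast
qed

text \<open>Every vertex and edge of \<open>A\<close> is lifted to a source branch that reaches the
  tip of the target branch: a slow map takes all intermediate values and realizes each increase by a
  single step.\<close>

lemma fan_data_epimorphism:
  assumes B: "fan_coords B b M w" and A: "fan_coords A n N v" and d: "fan_data b M n N l s"
    and fv: "\<And>a h. a < b \<Longrightarrow> h \<le> M \<Longrightarrow> f (w a h) = v (l a) (s a h)"
  shows "epimorphism B A f"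
proof -
  note cA = fan_coordsD[OF A] and cB = fan_coordsD[OF B]
  have l: "l a < n" and s: "slow (s a)" and sM: "s a M \<le> N" if "a < b" for a
    using d that unfolding fan_data_def by blast+
  have sN: "s a h \<le> N" if "a < b" "h \<le> M" for a h
    using slow_mono[OF s[OF that(1)] that(2)] sM[OF that(1)] by simp
  have mono: "l a \<le> l a'" if "a \<le> a'" "a' < b" "0 < s a M" "0 < s a' M" for a a'
    using d that unfolding fan_data_def by blast
  have full: "\<exists>a<b. l a = i \<and> s a M = N" if "i < n" for i
    using d that unfolding fan_data_def by blast
  have maps: "f x \<in> pts A" if xB: "x \<in> pts B" for x
  proof -
    obtain a h where "x = w a h" "a < b" "h \<le> M" using xB unfolding cB(6) by blast
    then show ?thesis using fv cA(7) l sN by simp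
  qed
  have pre: "\<exists>a h. a < b \<and> h \<le> M \<and> l a = i \<and> s a h = k \<and> s a M = N" if ik: "i < n" "k \<le> N" for i k
  proof -
    obtain a where a: "a < b" "l a = i" "s a M = N" using full[OF ik(1)] by blast
    then obtain h where "h \<le> M" "s a h = k" using slow_reaches[OF s[OF a(1)]] ik(2) by blast
    then show ?thesis using a by blast
  qed
  have "f ` pts B = pts A"
  proof (intro equalityI subsetI)
    fix x assume "x \<in> pts A"
    then obtain i k where ik: "x = v i k" "i < n" "k \<le> N" unfolding cA(6) by blast
    then obtain a h where "a < b" "h \<le> M" "l a = i" "s a h = k" using pre by blast
    then have "x = f (w a h)" "w a h \<in> pts B" using ik fv cB(7) by auto
    then show "x \<in> f ` pts B" by blast
  qed (use maps in blast)
  moreover have "continuous_map (Space B) (Space A) f"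
    unfolding cB(5) continuous_map_from_discrete_topology using maps unfolding cB(6) by blast
  moreover have "(x, y) \<in> RelR A \<longleftrightarrow> (\<exists>x'\<in>pts B. \<exists>y'\<in>pts B.
      (x', y') \<in> RelR B \<and> f x' = x \<and> f y' = y)" for x y
  proof
    assume "(x, y) \<in> RelR A"
    then obtain i h k where xy: "x = v i h" "y = v i k" "i < n" "k \<le> N" "k = h \<or> k = Suc h"
      unfolding cA(8) by blast
    have "\<exists>a h' k'. a < b \<and> k' \<le> M \<and> (k' = h' \<or> k' = Suc h') \<and> l a = i \<and> s a h' = h \<and> s a k' = k"
      using xy(5)
    proof
      assume "k = h"
      then show ?thesis using pre[OF xy(3,4)] by blast
    next
      assume k: "k = Suc h"
      obtain a where a: "a < b" "l a = i" "s a M = N" using full[OF xy(3)] by blast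
      then obtain h' where "h' < M" "s a h' = h" "s a (Suc h') = Suc h"
        using slow_jumps[OF s[OF a(1)]] xy(4) k by metis
      then show ?thesis using a k by (metis Suc_leI)
    qed
    then obtain a h' k' where c: "a < b" "k' \<le> M" "k' = h' \<or> k' = Suc h'" "l a = i" "s a h' = h" "s a k' = k"
      by blast
    then have "h' \<le> M" by auto
    moreover have "(w a h', w a k') \<in> RelR B" unfolding cB(8) using c by blast
    ultimately show "\<exists>x'\<in>pts B. \<exists>y'\<in>pts B. (x', y') \<in> RelR B \<and> f x' = x \<and> f y' = y"
      using c xy fv cB(7) by metis
  next
    assume "\<exists>x'\<in>pts B. \<exists>y'\<in>pts B. (x', y') \<in> RelR B \<and> f x' = x \<and> f y' = y"
    then obtain x' y' where xy: "(x', y') \<in> RelR B" "f x' = x" "f y' = y" by blast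
    then obtain a h k where c: "x' = w a h" "y' = w a k" "a < b" "k \<le> M" "k = h \<or> k = Suc h"
      unfolding cB(8) by blast
    then have h: "h \<le> M" by auto
    have "s a k = s a h \<or> s a k = Suc (s a h)" using s[OF c(3)] c(5) unfolding slow_def by blast
    moreover have "x = v (l a) (s a h)" "y = v (l a) (s a k)" using xy c h fv by auto
    ultimately show "(x, y) \<in> RelR A" unfolding cA(8) using l[OF c(3)] sN[OF c(3,4)] by blast
  qed
  moreover have "(x, y) \<in> RelS A \<longleftrightarrow> (\<exists>x'\<in>pts B. \<exists>y'\<in>pts B.
      (x', y') \<in> RelS B \<and> f x' = x \<and> f y' = y)" for x y
  proof
    assume "(x, y) \<in> RelS A"
    then obtain i j h k where xy: "x = v i h" "y = v j k" "i \<le> j" "j < n" "h \<le> N" "k \<le> N"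
      unfolding cA(9) by blast
    have "\<exists>a a' h' k'. a \<le> a' \<and> a' < b \<and> h' \<le> M \<and> k' \<le> M \<and> l a = i \<and> l a' = j \<and> s a h' = h \<and> s a' k' = k"
    proof (cases "i = j")
      case True
      obtain a where a: "a < b" "l a = i" "s a M = N" using full[of i] xy by auto
      then show ?thesis
        using slow_reaches[OF s[OF a(1)], of h M] slow_reaches[OF s[OF a(1)], of k M] xy True by blast
    next
      case False
      obtain a h' where a: "a < b" "h' \<le> M" "l a = i" "s a h' = h" "s a M = N"
        using pre[of i h] xy by auto
      obtain a' k' where a': "a' < b" "k' \<le> M" "l a' = j" "s a' k' = k" "s a' M = N"
        using pre[of j k] xy by auto
      \<comment> \<open>Two different branches exist, so their tips are not the root and
        monotonicity applies to \<open>a\<close> and \<open>a'\<close>. The order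
        \<open>a' \<le> a\<close> would give \<open>j \<le> i\<close>.\<close>
      have "0 < N" using cA(2) False xy by (metis less_one neq0_conv le_less_trans)
      then have "a \<le> a'" using mono[of a' a] a a' False xy(3) by (metis le_antisym nat_le_linear)
      then show ?thesis using a a' by blast
    qed
    then obtain a a' h' k' where c: "a \<le> a'" "a' < b" "h' \<le> M" "k' \<le> M" "l a = i" "l a' = j"
      "s a h' = h" "s a' k' = k" by blast
    then have "(w a h', w a' k') \<in> RelS B" unfolding cB(9) by blast
    moreover have "w a h' \<in> pts B" "w a' k' \<in> pts B" using cB(7) c by simp_all
    moreover have "f (w a h') = x" "f (w a' k') = y" using fv c xy by simp_all
    ultimately show "\<exists>x'\<in>pts B. \<exists>y'\<in>pts B. (x', y') \<in> RelS B \<and> f x' = x \<and> f y' = y"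
      by blast
  next
    assume "\<exists>x'\<in>pts B. \<exists>y'\<in>pts B. (x', y') \<in> RelS B \<and> f x' = x \<and> f y' = y"
    then obtain x' y' where xy: "(x', y') \<in> RelS B" "f x' = x" "f y' = y" by blast
    then obtain a a' h k where c: "x' = w a h" "y' = w a' k" "a \<le> a'" "a' < b" "h \<le> M" "k \<le> M"
      unfolding cB(9) by blast
    then have a: "a < b" by simp
    have x: "x = v (l a) (s a h)" and y: "y = v (l a') (s a' k)" using xy c a fv by auto
    \<comment> \<open>When one of the images is the root, it may be regarded as lying on the branch
      of the other, which gives equal indices without monotonicity.\<close>
    have "\<exists>i j. i \<le> j \<and> j < n \<and> x = v i (s a h) \<and> y = v j (s a' k)"
    proof (cases "s a h = 0")
      case True
      then have "x = v 0 (s a h)" using x cA(3) by metis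
      then show ?thesis using y l[OF c(4)] by blast
    next
      case False
      then have p: "0 < s a M" using slow_mono[OF s[OF a] c(5)] by simp
      show ?thesis
      proof (cases "s a' k = 0")
        case True
        then have "y = v (l a) (s a' k)" using y cA(3) by metis
        then show ?thesis using x l[OF a] by blast
      next
        case False
        then have "0 < s a' M" using slow_mono[OF s[OF c(4)] c(6)] by simp
        then show ?thesis using mono[OF c(3,4) p] x y l[OF c(4)] by blast
      qed
    qed
    then show "(x, y) \<in> RelS A" unfolding cA(9) using sN[OF a c(5)] sN[OF c(4,6)] by blast
  qed
  ultimately show ?thesis unfolding epimorphism_def by blast
qed

section \<open>The Ramsey property\<close>

lemma uniform_ramsey_aux:
  "\<exists>R. \<forall>f :: nat set \<Rightarrow> nat. (\<forall>D. f D < r) \<longrightarrow>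
    (\<exists>H\<subseteq>{..<R}. card H = m \<and> (\<forall>D D'. D \<subseteq> H \<longrightarrow> D' \<subseteq> H \<longrightarrow> card D = card D' \<longrightarrow> card D \<le> T \<longrightarrow> f D = f D'))"
proof (induction T)
  case 0
  have "D = {}" if "D \<subseteq> {..<m}" "card D = 0" for D :: "nat set"
    using that finite_subset card_0_eq by (metis finite_lessThan)
  then show ?case by (intro exI[of _ m] allI impI exI[of _ "{..<m}"]) (auto, metis)
next
  case (Suc T)
  then obtain R where R: "\<And>f :: nat set \<Rightarrow> nat. (\<forall>D. f D < r) \<Longrightarrow>
    \<exists>H\<subseteq>{..<R}. card H = m \<and> (\<forall>D D'. D \<subseteq> H \<longrightarrow> D' \<subseteq> H \<longrightarrow> card D = card D' \<longrightarrow> card D \<le> T \<longrightarrow> f D = f D')"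
    by blast
  obtain Q :: nat where Q: "partn_lst {..<Q} (replicate r R) (Suc T)"
    using ramsey_full by blast
  show ?case
  proof (intro exI[of _ Q] allI impI)
    fix f :: "nat set \<Rightarrow> nat" assume f: "\<forall>D. f D < r"
    then have "f \<in> nsets {..<Q} (Suc T) \<rightarrow> {..<length (replicate r R)}" by simp
    then obtain i where "i < r" "monochromatic {..<Q} (replicate r R ! i) (Suc T) f i"
      using Q unfolding partn_lst_def by auto
    then obtain G where G: "G \<in> nsets {..<Q} R" "f ` nsets G (Suc T) \<subseteq> {i}"
      unfolding monochromatic_def by auto
    then have fG: "finite G" "card G = R" "G \<subseteq> {..<Q}" by (auto simp: nsets_def)
    then obtain g where g: "bij_betw g {..<R} G"
      using ex_bij_betw_nat_finite by (metis atLeast0LessThan)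
    obtain H where H: "H \<subseteq> {..<R}" "card H = m"
      "\<And>D D'. D \<subseteq> H \<Longrightarrow> D' \<subseteq> H \<Longrightarrow> card D = card D' \<Longrightarrow> card D \<le> T \<Longrightarrow> f (g ` D) = f (g ` D')"
      using R[of "\<lambda>D. f (g ` D)"] f by blast
    have inj: "inj_on g H" using g H(1) by (meson bij_betw_imp_inj_on inj_on_subset)
    have gH: "g ` H \<subseteq> G" using g H(1) by (auto simp: bij_betw_def)
    have "f D = f D'" if D: "D \<subseteq> g ` H" "D' \<subseteq> g ` H" "card D = card D'" "card D \<le> Suc T" for D D'
    proof (cases "card D = Suc T")
      case True
      have DG: "D \<subseteq> G" "D' \<subseteq> G" using D(1,2) gH by blast+
      then have "D \<in> nsets G (Suc T)" "D' \<in> nsets G (Suc T)"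
        using finite_subset[OF DG(1) fG(1)] finite_subset[OF DG(2) fG(1)] D(3) True
        by (simp_all add: nsets_def)
      then show ?thesis using G(2) by blast
    next
      case False
      obtain C C' where C: "D = g ` C" "C \<subseteq> H" "D' = g ` C'" "C' \<subseteq> H"
        using D(1,2) by (auto simp: subset_image_iff)
      then have "card D = card C" "card D' = card C'"
        using card_image inj inj_on_subset by metis+
      then show ?thesis using H(3)[of C C'] C D False by simp
    qed
    moreover have "card (g ` H) = m" using card_image[OF inj] H(2) by simp
    ultimately show "\<exists>H\<subseteq>{..<Q}. card H = m \<and>
        (\<forall>D D'. D \<subseteq> H \<longrightarrow> D' \<subseteq> H \<longrightarrow> card D = card D' \<longrightarrow> card D \<le> Suc T \<longrightarrow> f D = f D')"
      using gH fG(3) by (intro exI[of _ "g ` H"]) blast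
  qed
qed

text \<open>A subset of \<open>H\<close> has at most \<open>m\<close> elements, so
  \<open>T = m\<close> covers all sizes. The shift by \<open>Suc\<close> keeps 0 out of
  \<open>H\<close>, because level 0 is the root and no branch can climb there.\<close>

lemma uniform_ramsey:
  "\<exists>R. \<forall>f :: nat set \<Rightarrow> nat. (\<forall>D. f D < r) \<longrightarrow>
    (\<exists>H\<subseteq>{1..R}. card H = m \<and> (\<forall>D D'. D \<subseteq> H \<longrightarrow> D' \<subseteq> H \<longrightarrow> card D = card D' \<longrightarrow> f D = f D'))"
proof -
  obtain R where R: "\<And>f :: nat set \<Rightarrow> nat. (\<forall>D. f D < r) \<Longrightarrow>
    \<exists>H\<subseteq>{..<R}. card H = m \<and> (\<forall>D D'. D \<subseteq> H \<longrightarrow> D' \<subseteq> H \<longrightarrow> card D = card D' \<longrightarrow> card D \<le> m \<longrightarrow> f D = f D')"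
    using uniform_ramsey_aux[of r m m] by blast
  show ?thesis
  proof (intro exI[of _ R] allI impI)
    fix f :: "nat set \<Rightarrow> nat" assume f: "\<forall>D. f D < r"
    obtain H where H: "H \<subseteq> {..<R}" "card H = m"
      "\<And>D D'. D \<subseteq> H \<Longrightarrow> D' \<subseteq> H \<Longrightarrow> card D = card D' \<Longrightarrow> card D \<le> m \<Longrightarrow> f (Suc ` D) = f (Suc ` D')"
      using R[of "\<lambda>D. f (Suc ` D)"] f by blast
    have fin: "finite H" using H(1) finite_subset by blast
    have "f D = f D'" if D: "D \<subseteq> Suc ` H" "D' \<subseteq> Suc ` H" "card D = card D'" for D D'
    proof -
      obtain C C' where C: "D = Suc ` C" "C \<subseteq> H" "D' = Suc ` C'" "C' \<subseteq> H"
        using D(1,2) by (auto simp: subset_image_iff)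
      then have "card C = card C'" using D(3) by (simp add: card_image)
      moreover have "card C \<le> m" using card_mono[OF fin C(2)] H(2) by simp
      ultimately show ?thesis using H(3)[of C C'] C by simp
    qed
    moreover have "card (Suc ` H) = m" using H(2) by (simp add: card_image)
    moreover have "Suc ` H \<subseteq> {1..R}" using H(1) by auto
    ultimately show "\<exists>H\<subseteq>{1..R}. card H = m \<and> (\<forall>D D'. D \<subseteq> H \<longrightarrow> D' \<subseteq> H \<longrightarrow> card D = card D' \<longrightarrow> f D = f D')"
      by (intro exI[of _ "Suc ` H"]) blast
  qed
qed

text \<open>
  A set \<open>D\<close> of levels is split into consecutive blocks, the \<open>c\<close>-th of size \<open>t c M\<close>; the number
  of elements of block \<open>c\<close> below a level is recovered from that of \<open>D\<close> by truncation.
\<close>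

lemma slow_concat:
  fixes t :: "nat \<Rightarrow> nat \<Rightarrow> nat" and M m :: nat
  assumes t: "\<And>c. c < m \<Longrightarrow> slow (t c)"
  defines "S \<equiv> \<lambda>k y. \<Sum>c<k. t c (min M (y - c * M))"
  shows "slow (S m)"
    and "c < m \<Longrightarrow> t c (min M (y - c * M)) = min (t c M) (S m y - (\<Sum>c'<c. t c' M))"
    and "S m (m * M) = (\<Sum>c<m. t c M)"
proof -
  have full: "S k y = (\<Sum>c<k. t c M)" if "k * M \<le> y" for k y
    unfolding S_def
  proof (rule sum.cong)
    fix c assume "c \<in> {..<k}"
    then have "Suc c * M \<le> k * M" by (intro mult_le_mono1) simp
    then have "M \<le> y - c * M" using that by simp
    then show "t c (min M (y - c * M)) = t c M" by (simp add: min_def)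
  qed simp
  show "S m (m * M) = (\<Sum>c<m. t c M)" by (rule full) simp
  have SSuc: "S (Suc k) y = S k y + t k (min M (y - k * M))" for k y
    by (simp add: S_def)
  have cut: "S k' y = S k y" if "y \<le> k * M" "k \<le> k'" "k' \<le> m" for k k' y
    using that(2,3)
  proof (induction k' rule: dec_induct)
    case (step j)
    have "y \<le> j * M" by (rule le_trans[OF that(1) mult_le_mono1[OF step(1)]])
    then have "t j (min M (y - j * M)) = 0" using slow_0[OF t[of j]] step by simp
    then show ?case using step by (simp add: SSuc)
  qed simp
  have le: "S k y \<le> (\<Sum>c<k. t c M)" if "k \<le> m" for k y
    unfolding S_def
  proof (rule sum_mono)
    fix c assume "c \<in> {..<k}"
    then have "c < m" using that by simp
    then show "t c (min M (y - c * M)) \<le> t c M" by (intro slow_mono[OF t]) simp_all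
  qed
  have slowS: "slow (S k)" if "k \<le> m" for k
    using that
  proof (induction k)
    case 0
    then show ?case by (simp add: S_def slow_def)
  next
    case (Suc k)
    then have IH: "slow (S k)" and tk: "slow (t k)" using t by simp_all
    show ?case unfolding slow_def
    proof (intro conjI allI)
      show "S (Suc k) 0 = 0" using slow_0[OF IH] slow_0[OF tk] by (simp add: SSuc)
      fix y
      show "S (Suc k) (Suc y) = S (Suc k) y \<or> S (Suc k) (Suc y) = Suc (S (Suc k) y)"
      proof (cases "Suc y \<le> k * M")
        case True
        then show ?thesis using IH unfolding SSuc slow_def by simp
      next
        case False
        then have "S k (Suc y) = S k y" using full[of k y] full[of k "Suc y"] by simp
        moreover have "min M (Suc y - k * M) = min M (y - k * M) \<or> min M (Suc y - k * M) = Suc (min M (y - k * M))"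
          using False by (auto simp: min_def)
        ultimately show ?thesis using tk unfolding SSuc slow_def by auto
      qed
    qed
  qed
  show "slow (S m)" by (rule slowS) (rule order_refl)
  have key: "t c (min M (y - c * M)) = min (t c M) (S m y - (\<Sum>c'<c. t c' M))" if c: "c < m" for c y
  proof (cases "y \<le> c * M")
    case True
    have "S m y = S c y" by (rule cut[OF True]) (use c in auto)
    then have "S m y \<le> (\<Sum>c'<c. t c' M)" using le[of c y] c by simp
    then show ?thesis using True slow_0[OF t[OF c]] by simp
  next
    case False
    have Sc: "S (Suc c) y = (\<Sum>c'<c. t c' M) + t c (min M (y - c * M))"
      using full[of c y] False by (simp add: SSuc)
    show ?thesis
    proof (cases "y \<le> Suc c * M")
      case True
      have "S m y = S (Suc c) y" by (rule cut[OF True]) (use c in auto)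
      then show ?thesis using Sc slow_mono[OF t[OF c], of "min M (y - c * M)" M] by simp
    next
      case False
      then have m: "min M (y - c * M) = M" by simp
      have "S (Suc c) y \<le> S m y" unfolding S_def by (intro sum_mono2) (use c in auto)
      then show ?thesis using Sc m by simp
    qed
  qed
  show "c < m \<Longrightarrow> t c (min M (y - c * M)) = min (t c M) (S m y - (\<Sum>c'<c. t c' M))"
    by (rule key)
qed

text \<open>Collect the elements of \<open>H\<close> at which \<open>S\<close> of the counting
  function jumps. Thus climbing along \<open>H\<close> and applying a slow map afterwards amounts to
  climbing along a subset of \<open>H\<close>.\<close>

lemma slow_subset:
  fixes H :: "nat set"
  assumes S: "slow S" and H: "finite H" "0 \<notin> H"
  shows "\<exists>D\<subseteq>H. \<forall>h. card (D \<inter> {..h}) = S (card (H \<inter> {..h}))"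
proof -
  define D where "D = {d \<in> H. S (card (H \<inter> {..d})) \<noteq> S (card (H \<inter> {..d}) - 1)}"
  have "card (D \<inter> {..h}) = S (card (H \<inter> {..h}))" for h
  proof (induction h)
    case 0
    have "H \<inter> {..0} = {}" "D \<inter> {..0} = {}" using H(2) by (auto simp: D_def)
    then show ?case using slow_0[OF S] by simp
  next
    case (Suc h)
    show ?case
    proof (cases "Suc h \<in> H")
      case False
      then have "H \<inter> {..Suc h} = H \<inter> {..h}" "D \<inter> {..Suc h} = D \<inter> {..h}"
        by (auto simp: D_def le_Suc_eq)
      then show ?thesis using Suc by simp
    next
      case True
      then have "H \<inter> {..Suc h} = insert (Suc h) (H \<inter> {..h})" by (auto simp: le_Suc_eq)
      then have c: "card (H \<inter> {..Suc h}) = Suc (card (H \<inter> {..h}))" using H(1) by simp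
      show ?thesis
      proof (cases "Suc h \<in> D")
        case True
        then have "D \<inter> {..Suc h} = insert (Suc h) (D \<inter> {..h})" by (auto simp: le_Suc_eq)
        moreover have "finite D" using H(1) by (simp add: D_def)
        ultimately have "card (D \<inter> {..Suc h}) = Suc (card (D \<inter> {..h}))" by simp
        moreover have "S (card (H \<inter> {..Suc h})) = Suc (S (card (H \<inter> {..h})))"
          using True S c unfolding D_def slow_def by auto
        ultimately show ?thesis using Suc by simp
      next
        case False
        then have "D \<inter> {..Suc h} = D \<inter> {..h}" by (auto simp: le_Suc_eq)
        moreover have "S (card (H \<inter> {..Suc h})) = S (card (H \<inter> {..h}))"
          using False True c unfolding D_def by auto
        ultimately show ?thesis using Suc by simp
      qed
    qed
  qed
  moreover have "D \<subseteq> H" by (auto simp: D_def)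
  ultimately show ?thesis by blast
qed

lemma slow_card: "finite (H :: nat set) \<Longrightarrow> 0 \<notin> H \<Longrightarrow> slow (\<lambda>h. card (H \<inter> {..h}))"
  unfolding slow_def
proof (intro conjI allI)
  assume H: "finite H" "0 \<notin> H"
  show "card (H \<inter> {..0}) = 0" using H by auto
  fix h
  have "H \<inter> {..Suc h} = (if Suc h \<in> H then insert (Suc h) (H \<inter> {..h}) else H \<inter> {..h})"
    by (auto simp: le_Suc_eq)
  then show "card (H \<inter> {..Suc h}) = card (H \<inter> {..h}) \<or> card (H \<inter> {..Suc h}) = Suc (card (H \<inter> {..h}))"
    using H by simp
qed

lemma slow_comp:
  assumes "slow s" "slow t"
  shows "slow (\<lambda>h. s (t h))"
  unfolding slow_def
proof (intro conjI allI)
  show "s (t 0) = 0" using assms by (simp add: slow_0)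
  fix h
  have "t (Suc h) = t h \<or> t (Suc h) = Suc (t h)" using assms(2) by (simp add: slow_def)
  then show "s (t (Suc h)) = s (t h) \<or> s (t (Suc h)) = Suc (s (t h))"
  proof
    assume "t (Suc h) = Suc (t h)"
    then show ?thesis using assms(1) by (simp only: slow_def)
  qed simp
qed

lemma slow_min: "slow (\<lambda>h. min k h)"
  unfolding slow_def min_def by auto

lemma slow_diff: "slow (\<lambda>h. h - k)"
  unfolding slow_def by auto

lemma epimorphism_cong:
  assumes f: "epimorphism B A f" and eq: "\<And>x. x \<in> pts B \<Longrightarrow> g x = f x"
  shows "epimorphism B A g"
proof -
  have "continuous_map (Space B) (Space A) g"
    using f continuous_map_eq[of "Space B" "Space A" f g] eq unfolding epimorphism_def by auto
  moreover have "g ` pts B = f ` pts B"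
    using eq by (rule image_cong[OF refl])
  ultimately show ?thesis using f unfolding epimorphism_def by (simp add: eq cong: bex_cong)
qed

text \<open>\<open>C\<close> has one branch for each letter of the words and enough levels for the
  Ramsey theorem. A homogeneous set \<open>H\<close> of levels and a homogeneous word
  \<open>x\<close> define \<open>\<gamma>\<close>: branch \<open>c\<close> climbs during the
  \<open>c\<close>-th block of \<open>M\<close> elements of \<open>H\<close> until it reaches the
  endpoint given by the letter \<open>x ! c\<close>. Each \<open>f \<circ> \<gamma>\<close> is then
  some \<open>\<Psi> z D\<close> with \<open>D \<subseteq> H\<close>, where \<open>z\<close> is the
  image of \<open>x\<close> under \<open>f\<close>. Its colour depends on \<open>z\<close> alone by
  the choice of \<open>H\<close>, and is the same for all \<open>f\<close> by the choice of
  \<open>x\<close>.\<close>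

theorem fan_ramsey:
  fixes A B :: "nat RS_structure" and r :: nat
  assumes "ordered_fan A" "ordered_fan B"
  shows "\<exists>C :: nat RS_structure. ordered_fan C \<and> (\<forall>\<kappa> :: (nat \<Rightarrow> nat) \<Rightarrow> nat.
    (\<forall>g. \<kappa> g < r) \<longrightarrow> (\<forall>g g'. (\<forall>x\<in>pts C. g x = g' x) \<longrightarrow> \<kappa> g = \<kappa> g') \<longrightarrow>
    (\<exists>\<gamma> c. epimorphism C B \<gamma> \<and> (\<forall>f. epimorphism B A f \<longrightarrow> \<kappa> (f \<circ> \<gamma>) = c)))"
proof (cases "r = 0")
  case True
  then show ?thesis using assms(1) by auto
next
  case False
  obtain n N v where A: "fan_coords A n N v" using ordered_fan_coords[OF assms(1)] by blast
  obtain b M w where B: "fan_coords B b M w" using ordered_fan_coords[OF assms(2)] by blast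
  note cA = fan_coordsD[OF A] and cB = fan_coordsD[OF B]
  \<comment> \<open>Only the values on the points of \<open>B\<close> matter; extensional
    representatives make the set finite, as the word theorem requires.\<close>
  define F where "F = {f \<in> pts B \<rightarrow>\<^sub>E pts A. epimorphism B A f}"
  have finF: "finite F"
    unfolding F_def using finite_PiE[OF finite_fan_coords[OF B], of "\<lambda>_. pts A"] finite_fan_coords[OF A] by simp
  have "\<exists>m. \<forall>e :: nat list \<Rightarrow> nat. (\<forall>z. e z < r) \<longrightarrow> (\<exists>x. length x = m \<and> homogeneous_word F w b M e x)"
    by (rule word_ramsey[where v = v and n = n and N = N, OF finF cA(3) cA(1)])
      (use epimorphism_fan_data[OF B A] in \<open>simp add: F_def\<close>)
  then obtain m where m': "\<forall>e :: nat list \<Rightarrow> nat. (\<forall>z. e z < r) \<longrightarrow> (\<exists>x. length x = m \<and> homogeneous_word F w b M e x)"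
    by (elim exE)
  have m: "\<exists>x. length x = m \<and> homogeneous_word F w b M e x" if "\<And>z. e z < r" for e :: "nat list \<Rightarrow> nat"
    using m'[THEN spec[of _ e], THEN mp, OF allI, OF that] .
  have m0: "0 < m"
  proof -
    have "\<exists>x. length x = m \<and> homogeneous_word F w b M (\<lambda>_. 0 :: nat) x"
      by (rule m) (use False in simp)
    then obtain x where x: "length x = m" "homogeneous_word F w b M (\<lambda>_. 0 :: nat) x"
      by (elim exE conjE)
    have "(0, M) \<in> set x" by (rule homogeneous_wordD(3)[OF x(2) cB(1)])
    then show ?thesis using x(1) by (metis length_pos_if_in_set)
  qed
  define Z where "Z = {z. set z \<subseteq> pts A \<and> length z = m}"
  have finZ: "finite Z" unfolding Z_def by (rule finite_lists_length_eq[OF finite_fan_coords[OF A]])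
  obtain labA levA where levA: "\<And>i h. i < n \<Longrightarrow> h \<le> N \<Longrightarrow> levA (v i h) = h"
    and labA: "\<And>i h. i < n \<Longrightarrow> h \<le> N \<Longrightarrow> 0 < h \<Longrightarrow> labA (v i h) = i"
    by (rule fan_coords_inverse[OF A]) blast
  have "finite (Z \<rightarrow>\<^sub>E {..<r})" by (intro finite_PiE finZ) simp
  \<comment> \<open>A set of levels is coloured by the whole function that sends each endpoint word
    to a colour, coded as a number. One homogeneous set then serves all endpoint words.\<close>
  then obtain enc :: "(nat list \<Rightarrow> nat) \<Rightarrow> nat" and q
    where enc: "enc ` (Z \<rightarrow>\<^sub>E {..<r}) = {i. i < q}" "inj_on enc (Z \<rightarrow>\<^sub>E {..<r})"
    using finite_imp_inj_to_nat_seg by metis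
  obtain R where R: "\<And>f :: nat set \<Rightarrow> nat. (\<And>D. f D < q) \<Longrightarrow>
    \<exists>H\<subseteq>{1..R}. card H = m * M \<and> (\<forall>D D'. D \<subseteq> H \<longrightarrow> D' \<subseteq> H \<longrightarrow> card D = card D' \<longrightarrow> f D = f D')"
    using uniform_ramsey[of q "m * M"] by blast
  \<comment> \<open>One level above the range of \<open>H\<close>, so that the height is positive
    even for \<open>R = 0\<close>.\<close>
  define K where "K = Suc R"
  have K0: "0 < K" by (simp add: K_def)
  obtain C :: "nat RS_structure" and u where C: "ordered_fan C" "fan_coords C m K u"
    using ordered_fan_exists[OF m0 K0] by blast
  note cC = fan_coordsD[OF C(2)]
  obtain labC levC where levC: "\<And>i h. i < m \<Longrightarrow> h \<le> K \<Longrightarrow> levC (u i h) = h"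
    and labC: "\<And>i h. i < m \<Longrightarrow> h \<le> K \<Longrightarrow> 0 < h \<Longrightarrow> labC (u i h) = i"
    by (rule fan_coords_inverse[OF C(2)]) blast
  \<comment> \<open>The map onto \<open>A\<close> with endpoints \<open>z\<close> and climbing
    levels \<open>D\<close>: branch \<open>c\<close> uses the elements of \<open>D\<close> after
    those spent by the earlier branches, as many as the level of its endpoint requires.\<close>
  define \<Psi> where "\<Psi> z D x = v (labA (z ! labC x)) (min (levA (z ! labC x))
      (card (D \<inter> {..levC x}) - (\<Sum>c<labC x. levA (z ! c))))" for z D x
  have "\<exists>\<gamma> c. epimorphism C B \<gamma> \<and> (\<forall>f. epimorphism B A f \<longrightarrow> \<kappa> (f \<circ> \<gamma>) = c)"
    if \<kappa>r: "\<forall>g. \<kappa> g < r" and \<kappa>c: "\<forall>g g'. (\<forall>x\<in>pts C. g x = g' x) \<longrightarrow> \<kappa> g = \<kappa> g'"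
    for \<kappa> :: "(nat \<Rightarrow> nat) \<Rightarrow> nat"
  proof -
    define fD where "fD D = restrict (\<lambda>z. \<kappa> (\<Psi> z D)) Z" for D
    have fD: "fD D \<in> Z \<rightarrow>\<^sub>E {..<r}" for D using \<kappa>r by (simp add: fD_def)
    have "enc (fD D) < q" for D
    proof -
      have "enc (fD D) \<in> {i. i < q}" unfolding enc(1)[symmetric] using fD by (rule imageI)
      then show ?thesis by simp
    qed
    then obtain H where H: "H \<subseteq> {1..R}" "card H = m * M"
      "\<And>D D'. D \<subseteq> H \<Longrightarrow> D' \<subseteq> H \<Longrightarrow> card D = card D' \<Longrightarrow> enc (fD D) = enc (fD D')"
      using R[of "\<lambda>D. enc (fD D)"] by blast
    have finH: "finite H" using H(1) by (rule finite_subset) simp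
    have H0: "0 \<notin> H" using H(1) by auto
    have hom: "\<kappa> (\<Psi> z D) = \<kappa> (\<Psi> z D')" if "D \<subseteq> H" "D' \<subseteq> H" "card D = card D'" "z \<in> Z" for D D' z
    proof -
      have "fD D = fD D'" using inj_onD[OF enc(2) H(3)[OF that(1-3)] fD fD] .
      then have "fD D z = fD D' z" by simp
      then show ?thesis using that(4) by (simp add: fD_def)
    qed
    \<comment> \<open>Any subset of \<open>H\<close> of the size demanded by \<open>z\<close> will
      do, by homogeneity. For words that demand too many levels the choice is arbitrary, and such
      words do not arise as images of \<open>x\<close>.\<close>
    define D0 where "D0 z = (SOME D. D \<subseteq> H \<and> card D = (\<Sum>c<m. levA (z ! c)))" for z
    define e where "e z = \<kappa> (\<Psi> z (D0 z))" for z
    have "\<exists>x. length x = m \<and> homogeneous_word F w b M e x"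
      by (rule m) (simp add: e_def \<kappa>r)
    then obtain x where x: "length x = m" "homogeneous_word F w b M e x"
      by (elim exE conjE)
    define bt qt where "bt c = fst (x ! c)" and "qt c = snd (x ! c)" for c
    have bt: "bt c < b" and qt: "qt c \<le> M" if "c < m" for c
    proof -
      have "x ! c \<in> set x" using that x(1) by simp
      from homogeneous_wordD(2)[OF x(2) this] show "bt c < b" "qt c \<le> M" by (simp_all add: bt_def qt_def)
    qed
    have btmono: "bt c \<le> bt c'" if "c \<le> c'" "c' < m" for c c'
      using sorted_nth_mono[OF homogeneous_wordD(1)[OF x(2)] that(1)] that x(1) by (simp add: bt_def)
    have full: "\<exists>c<m. bt c = a \<and> qt c = M" if "a < b" for a
    proof -
      have "(a, M) \<in> set x" by (rule homogeneous_wordD(3)[OF x(2) that])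
      then obtain c where "c < m" "x ! c = (a, M)" using x(1) by (metis in_set_conv_nth)
      then show ?thesis by (intro exI[of _ c]) (simp add: bt_def qt_def)
    qed
    \<comment> \<open>The number of elements of the \<open>c\<close>-th block of \<open>M\<close>
      elements of \<open>H\<close> up to level \<open>h\<close>; \<open>sC\<close> stops it at the
      level of the endpoint.\<close>
    define kc where "kc c h = min M (card (H \<inter> {..h}) - c * M)" for c h
    define sC where "sC c h = min (qt c) (kc c h)" for c h
    have kc: "slow (kc c)" for c
      unfolding kc_def by (intro slow_comp[OF slow_min] slow_comp[OF slow_diff] slow_card finH H0)
    have sC: "slow (sC c)" for c
      unfolding sC_def by (rule slow_comp[OF slow_min kc])
    have HK: "H \<inter> {..K} = H" using H(1) by (auto simp: K_def)
    have kcK: "kc c K = M" if "c < m" for c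
    proof -
      have "Suc c * M \<le> m * M" using that by (intro mult_le_mono1) simp
      then show ?thesis by (simp add: kc_def HK H(2))
    qed
    have sCK: "sC c K = qt c" if "c < m" for c
      using kcK[OF that] qt[OF that] by (simp add: sC_def)
    have data: "fan_data m K b M bt sC"
      unfolding fan_data_def
    proof (intro conjI allI impI)
      show "bt c < b" "slow (sC c)" "sC c K \<le> M" if "c < m" for c
        using bt[OF that] sC sCK[OF that] qt[OF that] by simp_all
      show "bt c \<le> bt c'" if "c \<le> c'" "c' < m" for c c' using btmono that .
      show "\<exists>c<m. bt c = a \<and> sC c K = M" if "a < b" for a
        using full[OF that] sCK by auto
    qed
    define \<gamma> where "\<gamma> y = w (bt (labC y)) (sC (labC y) (levC y))" for y
    have \<gamma>: "\<gamma> (u c h) = w (bt c) (sC c h)" if "c < m" "h \<le> K" for c h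
    proof (cases "h = 0")
      case True
      have "levC (u c h) = 0" using levC[OF that] True by simp
      then have "\<gamma> (u c h) = w (bt (labC (u c h))) 0" by (simp add: \<gamma>_def slow_0[OF sC])
      also have "\<dots> = w (bt c) 0" using cB(3) by metis
      finally show ?thesis using True by (simp add: slow_0[OF sC])
    next
      case False
      then show ?thesis using levC[OF that] labC[OF that] by (simp add: \<gamma>_def)
    qed
    have \<gamma>_epi: "epimorphism C B \<gamma>"
      by (rule fan_data_epimorphism[OF C(2) B data \<gamma>])
    obtain col where col: "\<forall>f\<in>F. e (map (\<lambda>p. f (w (fst p) (snd p))) x) = col"
      using homogeneous_wordD(4)[OF x(2)] by (elim exE)
    have "\<kappa> (f \<circ> \<gamma>) = col" if f: "epimorphism B A f" for f
    proof -
      define f' where "f' = restrict f (pts B)"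
      have "epimorphism B A f'" by (rule epimorphism_cong[OF f]) (simp add: f'_def)
      moreover have "f' \<in> pts B \<rightarrow>\<^sub>E pts A"
        using epimorphism_topspace[OF f] by (simp add: f'_def)
      ultimately have f'F: "f' \<in> F" by (simp add: F_def)
      define z where "z = map (\<lambda>p. f' (w (fst p) (snd p))) x"
      have ez: "e z = col" unfolding z_def by (rule bspec[OF col f'F])
      obtain l s where d: "fan_data b M n N l s" and fv: "\<forall>a<b. \<forall>h\<le>M. f (w a h) = v (l a) (s a h)"
        using epimorphism_fan_data[OF B A f] by blast
      have l: "l a < n" and s: "slow (s a)" and sM: "s a M \<le> N" if "a < b" for a
        using d that unfolding fan_data_def by blast+
      have zc: "z ! c = v (l (bt c)) (s (bt c) (qt c))" if "c < m" for c
      proof -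
        have "z ! c = f' (w (bt c) (qt c))" using that x(1) by (simp add: z_def bt_def qt_def)
        also have "\<dots> = f (w (bt c) (qt c))" using cB(7)[OF bt[OF that] qt[OF that]] by (simp add: f'_def)
        finally show ?thesis using fv bt[OF that] qt[OF that] by simp
      qed
      \<comment> \<open>The level in \<open>A\<close> that \<open>f \<circ> \<gamma>\<close> reaches
        on branch \<open>c\<close> after \<open>k\<close> steps of its block. Concatenated over the
        blocks these maps form the slow map \<open>S\<close>, whose jumps on \<open>H\<close> make
        up \<open>D\<close>.\<close>
      define t where "t c k = s (bt c) (min (qt c) k)" for c k
      have t: "slow (t c)" if "c < m" for c
        unfolding t_def by (rule slow_comp[OF s[OF bt[OF that]] slow_min])
      have tM: "t c M = s (bt c) (qt c)" if "c < m" for c using qt[OF that] by (simp add: t_def min_def)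
      have tN: "t c M \<le> N" if "c < m" for c
        using tM[OF that] slow_mono[OF s[OF bt[OF that]] qt[OF that]] sM[OF bt[OF that]] by simp
      have zc': "z ! c = v (l (bt c)) (t c M)" if "c < m" for c
        using zc[OF that] tM[OF that] by simp
      have levz: "levA (z ! c) = t c M" if "c < m" for c
        using zc'[OF that] levA[OF l[OF bt[OF that]] tN[OF that]] by simp
      have zZ: "z \<in> Z"
      proof -
        have "set z \<subseteq> pts A"
        proof
          fix y assume "y \<in> set z"
          then obtain c where "c < length z" "y = z ! c" by (metis in_set_conv_nth)
          then have "c < m" "y = z ! c" using x(1) by (simp_all add: z_def)
          then show "y \<in> pts A"
            using zc' cA(7)[OF l[OF bt] tN] by simp
        qed
        then show ?thesis using x(1) by (simp add: Z_def z_def)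
      qed
      define S where "S y = (\<Sum>c<m. t c (min M (y - c * M)))" for y
      have S1: "slow S"
        unfolding S_def by (rule slow_concat(1)[of m t M, OF t])
      have S2: "t c (min M (y - c * M)) = min (t c M) (S y - (\<Sum>c'<c. t c' M))" if "c < m" for c y
        unfolding S_def by (rule slow_concat(2)[of m t, OF t that])
      have S3: "S (m * M) = (\<Sum>c<m. t c M)"
        unfolding S_def by (rule slow_concat(3)[of m t M, OF t])
      obtain D where D: "D \<subseteq> H" "\<And>h. card (D \<inter> {..h}) = S (card (H \<inter> {..h}))"
        using slow_subset[OF S1 finH H0] by blast
      have "D \<inter> {..K} = D" using D(1) HK by blast
      then have "card D = S (m * M)" using D(2)[of K] HK H(2) by simp
      also have "\<dots> = (\<Sum>c<m. levA (z ! c))" using S3 levz by simp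
      finally have cD: "card D = (\<Sum>c<m. levA (z ! c))" .
      have "D0 z \<subseteq> H \<and> card (D0 z) = (\<Sum>c<m. levA (z ! c))"
        unfolding D0_def by (rule someI[of _ D]) (use D(1) cD in simp)
      then have "\<kappa> (\<Psi> z D) = e z" unfolding e_def using hom[OF D(1) _ _ zZ] cD by simp
      moreover have "\<Psi> z D y = (f \<circ> \<gamma>) y" if y: "y \<in> pts C" for y
      proof -
        obtain c h where ch: "y = u c h" "c < m" "h \<le> K" using y unfolding cC(6) by blast
        have lev: "levC y = h" using levC ch by simp
        have sCM: "sC c h \<le> M" using qt[OF ch(2)] by (simp add: sC_def)
        have rhs: "(f \<circ> \<gamma>) y = v (l (bt c)) (t c (kc c h))"
          using \<gamma>[OF ch(2,3)] fv bt[OF ch(2)] sCM ch(1) by (simp add: sC_def t_def)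
        show ?thesis
        proof (cases "h = 0")
          case True
          have "D \<inter> {..0} = {}" using D(1) H0 by auto
          then have "\<Psi> z D y = v (labA (z ! labC y)) 0" using True lev by (simp add: \<Psi>_def)
          moreover have "(f \<circ> \<gamma>) y = v (l (bt c)) 0"
            using rhs True slow_0[OF kc] slow_0[OF t[OF ch(2)]] by simp
          ultimately show ?thesis using cA(3) by metis
        next
          case False
          then have lab: "labC y = c" using labC ch by simp
          have "(\<Sum>c'<c. levA (z ! c')) = (\<Sum>c'<c. t c' M)"
            by (rule sum.cong) (use levz ch(2) in auto)
          then have "\<Psi> z D y = v (labA (z ! c)) (min (t c M) (S (card (H \<inter> {..h})) - (\<Sum>c'<c. t c' M)))"
            using levz[OF ch(2)] by (simp add: \<Psi>_def lab lev D(2))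
          also have "\<dots> = v (labA (z ! c)) (t c (kc c h))"
            unfolding S2[OF ch(2), symmetric] kc_def ..
          finally have lhs: "\<Psi> z D y = v (labA (z ! c)) (t c (kc c h))" .
          show ?thesis
          proof (cases "t c (kc c h) = 0")
            case True
            then show ?thesis using lhs rhs cA(3) by metis
          next
            case False
            have "kc c h \<le> M" by (simp add: kc_def)
            then have "0 < t c M" using slow_mono[OF t[OF ch(2)]] False by (metis gr0I le_zero_eq)
            then have "labA (z ! c) = l (bt c)"
              using zc'[OF ch(2)] labA[OF l[OF bt[OF ch(2)]] tN[OF ch(2)]] by simp
            then show ?thesis using lhs rhs by simp
          qed
        qed
      qed
      ultimately show ?thesis using \<kappa>c ez by metis
    qed
    then show ?thesis using \<gamma>_epi by blast
  qed
  then show ?thesis using C(1) by blast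
qed

section \<open>The automorphism group as a topological group\<close>

lemma epimorphism_continuous: "epimorphism B A f \<Longrightarrow> continuous_map (Space B) (Space A) f"
  unfolding epimorphism_def by (elim conjE)

lemma epimorphism_image: "epimorphism B A f \<Longrightarrow> f ` pts B = pts A"
  unfolding epimorphism_def by (elim conjE)

text \<open>Writing the relation clauses as equations between images makes composition, factoring
  and inversion of epimorphisms a matter of composing images. The intersections restrict the
  relations to points of the spaces.\<close>

lemma relation_image_iff:
  assumes "f ` X = Y"
  shows "(\<forall>x\<in>Y. \<forall>y\<in>Y. (x, y) \<in> Q \<longleftrightarrow> (\<exists>x'\<in>X. \<exists>y'\<in>X. (x', y') \<in> P \<and> f x' = x \<and> f y' = y)) \<longleftrightarrow>
    map_prod f f ` (P \<inter> X \<times> X) = Q \<inter> Y \<times> Y" (is "?l \<longleftrightarrow> ?r")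
proof -
  have mem: "(x, y) \<in> map_prod f f ` (P \<inter> X \<times> X) \<longleftrightarrow> (\<exists>x'\<in>X. \<exists>y'\<in>X. (x', y') \<in> P \<and> f x' = x \<and> f y' = y)" for x y
    by force
  have sub: "map_prod f f ` (P \<inter> X \<times> X) \<subseteq> Y \<times> Y" using assms by auto
  have "?r \<longleftrightarrow> (\<forall>x\<in>Y. \<forall>y\<in>Y. (x, y) \<in> map_prod f f ` (P \<inter> X \<times> X) \<longleftrightarrow> (x, y) \<in> Q)"
    using sub by blast
  then show ?thesis unfolding mem by blast
qed

lemma epimorphism_iff:
  "epimorphism B A f \<longleftrightarrow> continuous_map (Space B) (Space A) f \<and> f ` pts B = pts A \<and>
    map_prod f f ` (RelR B \<inter> pts B \<times> pts B) = RelR A \<inter> pts A \<times> pts A \<and>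
    map_prod f f ` (RelS B \<inter> pts B \<times> pts B) = RelS A \<inter> pts A \<times> pts A"
proof (cases "f ` pts B = pts A")
  case True
  show ?thesis
    unfolding epimorphism_def ball_conj_distrib relation_image_iff[OF True, symmetric] by (rule refl)
qed (simp add: epimorphism_def)

lemma map_prod_image_comp:
  assumes "\<And>x. x \<in> X \<Longrightarrow> h x = f (g x)"
  shows "map_prod h h ` (P \<inter> X \<times> X) = map_prod f f ` map_prod g g ` (P \<inter> X \<times> X)"
  unfolding image_image by (rule image_cong) (auto simp: assms)

lemma epimorphism_comp:
  assumes g: "epimorphism C B g" and f: "epimorphism B A f"
  shows "epimorphism C A (f \<circ> g)"
proof -
  have im: "map_prod (f \<circ> g) (f \<circ> g) ` (P \<inter> pts C \<times> pts C) =
    map_prod f f ` map_prod g g ` (P \<inter> pts C \<times> pts C)" for P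
    by (rule map_prod_image_comp) simp
  show ?thesis
    using g f continuous_map_compose[OF epimorphism_continuous[OF g] epimorphism_continuous[OF f]]
    unfolding epimorphism_iff im image_comp[symmetric] by simp
qed

text \<open>The image equations for \<open>\<phi>\<close> split through those for
  \<open>\<theta>\<close>, leaving the ones for \<open>f\<close>; continuity is automatic on a
  discrete space.\<close>

lemma epimorphism_factor:
  assumes \<theta>: "epimorphism L B \<theta>" and \<phi>: "epimorphism L A \<phi>"
    and eq: "\<And>x. x \<in> pts L \<Longrightarrow> \<phi> x = f (\<theta> x)"
    and disc: "Space B = discrete_topology V"
  shows "epimorphism B A f"
proof -
  have "f ` \<theta> ` pts L = \<phi> ` pts L"
    unfolding image_image using eq by (intro image_cong) auto
  then have im: "f ` pts B = pts A"
    by (simp only: epimorphism_image[OF \<theta>] epimorphism_image[OF \<phi>])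
  have "continuous_map (Space B) (Space A) f"
    using im unfolding disc continuous_map_from_discrete_topology topspace_discrete_topology by blast
  moreover have "map_prod \<phi> \<phi> ` (P \<inter> pts L \<times> pts L) =
    map_prod f f ` map_prod \<theta> \<theta> ` (P \<inter> pts L \<times> pts L)" for P
    by (rule map_prod_image_comp) (rule eq)
  ultimately show ?thesis
    using im \<theta> \<phi> unfolding epimorphism_iff by simp
qed

text \<open>A continuous bijection from a compact to a Hausdorff space is a homeomorphism, and the
  image equations for the relations can be inverted.\<close>

lemma automorphism_inverse:
  assumes f: "automorphism L f" and L: "compact_space (Space L)" "Hausdorff_space (Space L)"
    and g: "\<And>x. x \<in> pts L \<Longrightarrow> g x = inv_into (pts L) f x"
  shows "automorphism L g"
proof -
  let ?X = "pts L"
  have e: "epimorphism L L f" and b: "bij_betw f ?X ?X" using f unfolding isomorphism_def by blast+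
  have inj: "inj_on f ?X" and im: "f ` ?X = ?X" using b by (auto simp: bij_betw_def)
  have gf: "g (f x) = x" if "x \<in> ?X" for x
    using g[of "f x"] inv_into_f_f[OF inj that] im that by auto
  have fg: "f (g x) = x" "g x \<in> ?X" if "x \<in> ?X" for x
    using g[OF that] f_inv_into_f[of x f ?X] inv_into_into[of x f ?X] im that by auto
  have bg: "bij_betw g ?X ?X"
    by (rule bij_betw_byWitness[of _ f]) (use gf fg im in auto)
  have "homeomorphic_map (Space L) (Space L) f"
    by (rule continuous_imp_homeomorphic_map[OF epimorphism_continuous[OF e] L im inj])
  then obtain g' where "homeomorphic_maps (Space L) (Space L) f g'"
    unfolding homeomorphic_map_maps by (elim exE)
  then have g': "continuous_map (Space L) (Space L) g'" "\<And>x. x \<in> ?X \<Longrightarrow> g' (f x) = x"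
    unfolding homeomorphic_maps_def by blast+
  have "g' x = g x" if "x \<in> ?X" for x
    using g'(2)[OF fg(2)[OF that]] fg(1)[OF that] by simp
  then have "continuous_map (Space L) (Space L) g" using continuous_map_eq[OF g'(1)] by blast
  moreover have "map_prod g g ` map_prod f f ` (P \<inter> ?X \<times> ?X) = P \<inter> ?X \<times> ?X" for P
    using map_prod_image_comp[of ?X id g f P] gf by (simp add: map_prod.id)
  ultimately have "epimorphism L L g"
    using e bij_betw_imp_surj_on[OF bg] unfolding epimorphism_iff by metis
  then show ?thesis using bg unfolding isomorphism_def by blast
qed

lemma compactin_clopen_between:
  assumes X: "zero_dimensional_space X" and K: "compactin X K" and U: "openin X U" "K \<subseteq> U"
  shows "\<exists>W. openin X W \<and> closedin X W \<and> K \<subseteq> W \<and> W \<subseteq> U"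
proof -
  have "(arbitrary union_of (\<lambda>U. openin X U \<and> closedin X U)) U"
    using fun_cong[OF X[unfolded zero_dimensional_space_def], of U, THEN iffD1, OF U(1)] .
  then have "\<exists>\<C>. \<C> \<subseteq> {W. openin X W \<and> closedin X W} \<and> \<Union>\<C> = U"
    unfolding union_of_def by blast
  then obtain \<C> where C': "\<C> \<subseteq> {W. openin X W \<and> closedin X W}" "\<Union>\<C> = U"
    by (elim exE conjE)
  have C: "openin X W" "closedin X W" if "W \<in> \<C>" for W
    using subsetD[OF C'(1) that] by simp_all
  have "K \<subseteq> \<Union>\<C>" using U(2) C'(2) by simp
  then have "\<exists>\<F>. finite \<F> \<and> \<F> \<subseteq> \<C> \<and> K \<subseteq> \<Union>\<F>"
    by (rule compactinD[OF K C(1), rotated])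
  then obtain \<F> where F: "finite \<F>" "\<F> \<subseteq> \<C>" "K \<subseteq> \<Union>\<F>"
    by (elim exE conjE)
  have "openin X (\<Union>\<F>)" by (rule openin_Union) (rule C(1)[OF subsetD[OF F(2)]])
  moreover have "closedin X (\<Union>\<F>)"
    by (rule closedin_Union[OF F(1)]) (rule C(2)[OF subsetD[OF F(2)]])
  moreover have "\<Union>\<F> \<subseteq> U" using Union_mono[OF F(2)] C'(2) by simp
  ultimately show ?thesis using F(3) by blast
qed

locale compact_structure =
  fixes L :: "'a RS_structure"
  assumes L: "topological_structure L"
begin

abbreviation X where "X \<equiv> pts L"
abbreviation G where "G \<equiv> aut_group L"

lemma compact: "compact_space (Space L)" and Hausdorff: "Hausdorff_space (Space L)"
  and zero_dim: "zero_dimensional_space (Space L)"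
  using L unfolding topological_structure_def by blast+

lemma carrier_iff: "f \<in> carrier G \<longleftrightarrow> f \<in> extensional X \<and> automorphism L f"
  by (simp add: aut_group_def)

lemma carrierD:
  assumes "f \<in> carrier G"
  shows "f \<in> extensional X" "epimorphism L L f" "bij_betw f X X" "continuous_map (Space L) (Space L) f" "f \<in> Bij X"
    "x \<in> X \<Longrightarrow> f x \<in> X"
  using assms unfolding carrier_iff isomorphism_def epimorphism_def Bij_def by (auto dest: bij_betwE)

lemma carrierI: "f \<in> extensional X \<Longrightarrow> epimorphism L L f \<Longrightarrow> bij_betw f X X \<Longrightarrow> f \<in> carrier G"
  unfolding carrier_iff isomorphism_def by blast

lemma one_G: "\<one>\<^bsub>G\<^esub> = (\<lambda>x\<in>X. x)"
  by (simp add: aut_group_def BijGroup_def)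

lemma mult_G: "f \<in> carrier G \<Longrightarrow> g \<in> carrier G \<Longrightarrow> f \<otimes>\<^bsub>G\<^esub> g = compose X f g"
  using carrierD(5)[of f] carrierD(5)[of g] by (simp add: aut_group_def BijGroup_def)

lemma subgroup_G: "subgroup (carrier G) (BijGroup X)"
proof (rule group.subgroupI[OF group_BijGroup])
  show "carrier G \<subseteq> carrier (BijGroup X)"
    using carrierD(5) by (auto simp: BijGroup_def)
  have id: "epimorphism L L (\<lambda>x\<in>X. x)"
  proof (rule epimorphism_cong[of L L id])
    show "epimorphism L L id" unfolding epimorphism_def by (simp add: continuous_map_id)
  qed simp
  have "(\<lambda>x\<in>X. x) \<in> carrier G"
    using id id_Bij[of X] unfolding Bij_def by (intro carrierI) auto
  then show "carrier G \<noteq> {}" by blast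
next
  fix f assume f: "f \<in> carrier G"
  have "automorphism L (\<lambda>x\<in>X. inv_into X f x)"
    by (rule automorphism_inverse[of L f]) (use f compact Hausdorff in \<open>auto simp: carrier_iff\<close>)
  then show "inv\<^bsub>BijGroup X\<^esub> f \<in> carrier G"
    unfolding inv_BijGroup[OF carrierD(5)[OF f]] carrier_iff by simp
next
  fix f g assume f: "f \<in> carrier G" and g: "g \<in> carrier G"
  have "epimorphism L L (compose X f g)"
    by (rule epimorphism_cong[OF epimorphism_comp[OF carrierD(2)[OF g] carrierD(2)[OF f]]])
      (simp add: compose_def)
  moreover have "compose X f g \<in> Bij X" using compose_Bij carrierD(5) f g by blast
  ultimately have "compose X f g \<in> carrier G" unfolding Bij_def by (intro carrierI) auto
  then show "f \<otimes>\<^bsub>BijGroup X\<^esub> g \<in> carrier G"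
    using carrierD(5)[OF f] carrierD(5)[OF g] by (simp add: BijGroup_def)
qed

lemma G_eq: "G = BijGroup X\<lparr>carrier := carrier G\<rparr>"
  by (simp add: aut_group_def)

lemma group_G: "group G"
  by (subst G_eq) (rule group.subgroup_imp_group[OF group_BijGroup subgroup_G])

lemma inv_G: "f \<in> carrier G \<Longrightarrow> inv\<^bsub>G\<^esub> f = (\<lambda>x\<in>X. inv_into X f x)"
  using group.m_inv_consistent[OF group_BijGroup subgroup_G] inv_BijGroup[OF carrierD(5)] G_eq by metis

lemma mult_apply: "f \<in> carrier G \<Longrightarrow> g \<in> carrier G \<Longrightarrow> x \<in> X \<Longrightarrow> (f \<otimes>\<^bsub>G\<^esub> g) x = f (g x)"
  by (simp add: mult_G compose_def)

lemma inv_apply: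
  assumes "f \<in> carrier G" "x \<in> X"
  shows "(inv\<^bsub>G\<^esub> f) (f x) = x" "f ((inv\<^bsub>G\<^esub> f) x) = x"
proof -
  have "inj_on f X" "f ` X = X" using carrierD(3)[OF assms(1)] by (auto simp: bij_betw_def)
  then show "(inv\<^bsub>G\<^esub> f) (f x) = x" "f ((inv\<^bsub>G\<^esub> f) x) = x"
    using assms carrierD(6)[OF assms] by (simp_all add: inv_G f_inv_into_f)
qed

definition into :: "'a set \<Rightarrow> 'a set \<Rightarrow> ('a \<Rightarrow> 'a) set" where
  "into K U = {f \<in> extensional X. continuous_map (Space L) (Space L) f \<and> f ` K \<subseteq> U}"

definition subbase :: "('a \<Rightarrow> 'a) set set" where
  "subbase = {into K U |K U. compactin (Space L) K \<and> openin (Space L) U}"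

lemma aut_topology_eq: "aut_topology L = subtopology (topology_generated_by subbase) (carrier G)"
  unfolding aut_topology_def compact_open_topology_def subbase_def into_def ..

lemma into_iff: "f \<in> carrier G \<Longrightarrow> f \<in> into K U \<longleftrightarrow> f ` K \<subseteq> U"
  using carrierD(1,4) by (simp add: into_def)

lemma carrier_subbase: "carrier G \<subseteq> \<Union>subbase"
proof
  fix f assume f: "f \<in> carrier G"
  have "into X X \<in> subbase"
    using compact unfolding subbase_def compact_space_def by blast
  moreover have "f \<in> into X X" using f carrierD(6) by (auto simp: into_iff)
  ultimately show "f \<in> \<Union>subbase" by blast
qed

lemma topspace_aut: "topspace (aut_topology L) = carrier G"
  unfolding aut_topology_eq using carrier_subbase by (auto simp: topspace_subtopology)

lemma openin_into:
  assumes "compactin (Space L) K" "openin (Space L) U"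
  shows "openin (aut_topology L) (carrier G \<inter> into K U)"
proof -
  have "openin (topology_generated_by subbase) (into K U)"
    using assms unfolding subbase_def by (intro topology_generated_by_Basis) blast
  then show ?thesis unfolding aut_topology_eq openin_subtopology by blast
qed

lemma continuous_into_aut:
  assumes "\<And>x. x \<in> topspace T \<Longrightarrow> f x \<in> carrier G"
    and "\<And>K U. compactin (Space L) K \<Longrightarrow> openin (Space L) U \<Longrightarrow> openin T {x \<in> topspace T. f x ` K \<subseteq> U}"
  shows "continuous_map T (aut_topology L) f"
  unfolding aut_topology_eq continuous_map_in_subtopology
proof (intro conjI)
  show "f \<in> topspace T \<rightarrow> carrier G" using assms(1) by blast
  show "continuous_map T (topology_generated_by subbase) f"
  proof (rule continuous_on_generated_topo)
    fix W assume "W \<in> subbase"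
    then obtain K U where W: "W = into K U" "compactin (Space L) K" "openin (Space L) U"
      unfolding subbase_def by blast
    have "f -` W \<inter> topspace T = {x \<in> topspace T. f x ` K \<subseteq> U}"
      using into_iff[OF assms(1)] unfolding W(1) by blast
    then show "openin T (f -` W \<inter> topspace T)" using assms(2)[OF W(2,3)] by simp
  next
    show "f ` topspace T \<subseteq> \<Union>subbase" using assms(1) carrier_subbase by blast
  qed
qed

lemma continuous_mult:
  "continuous_map (prod_topology (aut_topology L) (aut_topology L)) (aut_topology L) (\<lambda>(g, h). g \<otimes>\<^bsub>G\<^esub> h)"
proof (rule continuous_into_aut)
  fix p assume "p \<in> topspace (prod_topology (aut_topology L) (aut_topology L))"
  then show "(case p of (g, h) \<Rightarrow> g \<otimes>\<^bsub>G\<^esub> h) \<in> carrier G"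
    using monoid.m_closed[OF group.is_monoid[OF group_G]] by (auto simp: topspace_aut)
next
  fix K U assume K: "compactin (Space L) K" and U: "openin (Space L) U"
  have KX: "K \<subseteq> X" using K compactin_subset_topspace by blast
  let ?P = "prod_topology (aut_topology L) (aut_topology L)"
  let ?S = "{p \<in> topspace ?P. (case p of (g, h) \<Rightarrow> g \<otimes>\<^bsub>G\<^esub> h) ` K \<subseteq> U}"
  show "openin ?P ?S"
  proof (subst openin_subopen, intro ballI)
    fix p assume p: "p \<in> ?S"
    obtain g h where gh: "p = (g, h)" by (cases p)
    have g: "g \<in> carrier G" and h: "h \<in> carrier G" using p unfolding gh by (auto simp: topspace_aut)
    have pU: "(g \<otimes>\<^bsub>G\<^esub> h) ` K \<subseteq> U" using p unfolding gh by simp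
    have sub: "g (h x) \<in> U" if "x \<in> K" for x
      using subsetD[OF pU imageI[OF that]] mult_apply[OF g h subsetD[OF KX that]] by simp
    have "compactin (Space L) (h ` K)" using image_compactin[OF K carrierD(4)[OF h]] .
    moreover have "openin (Space L) {x \<in> X. g x \<in> U}"
      using openin_continuous_map_preimage[OF carrierD(4)[OF g] U] .
    moreover have "h ` K \<subseteq> {x \<in> X. g x \<in> U}" using sub carrierD(6)[OF h] KX by auto
    ultimately obtain W where W: "openin (Space L) W" "closedin (Space L) W" "h ` K \<subseteq> W" "W \<subseteq> {x \<in> X. g x \<in> U}"
      using compactin_clopen_between[OF zero_dim] by meson
    define T where "T = (carrier G \<inter> into W U) \<times> (carrier G \<inter> into K W)"
    have "openin ?P T"
      unfolding T_def openin_prod_Times_iff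
      using openin_into[OF closedin_compact_space[OF compact W(2)] U] openin_into[OF K W(1)] by blast
    moreover have "p \<in> T" using g h W(3,4) unfolding gh T_def by (auto simp: into_iff)
    moreover have "T \<subseteq> ?S"
    proof
      fix p' assume "p' \<in> T"
      then obtain g' h' where p': "p' = (g', h')" "g' \<in> carrier G" "h' \<in> carrier G" "g' ` W \<subseteq> U" "h' ` K \<subseteq> W"
        unfolding T_def by (auto simp: into_iff)
      have "(g' \<otimes>\<^bsub>G\<^esub> h') ` K \<subseteq> U"
      proof (rule image_subsetI)
        fix k assume k: "k \<in> K"
        have "g' (h' k) \<in> U" using p'(4,5) k by blast
        then show "(g' \<otimes>\<^bsub>G\<^esub> h') k \<in> U" using mult_apply[OF p'(2,3) subsetD[OF KX k]] by simp
      qed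
      then show "p' \<in> ?S" using p' by (auto simp: topspace_aut)
    qed
    ultimately show "\<exists>T. openin ?P T \<and> p \<in> T \<and> T \<subseteq> ?S" by blast
  qed
qed

lemma continuous_inv: "continuous_map (aut_topology L) (aut_topology L) (\<lambda>g. inv\<^bsub>G\<^esub> g)"
proof (rule continuous_into_aut)
  show "inv\<^bsub>G\<^esub> g \<in> carrier G" if "g \<in> topspace (aut_topology L)" for g
    using group.inv_closed[OF group_G] that by (simp add: topspace_aut)
  fix K U assume K: "compactin (Space L) K" and U: "openin (Space L) U"
  have KX: "K \<subseteq> X" using K compactin_subset_topspace by blast
  have "closedin (Space L) (X - U)" using U by blast
  then have c: "compactin (Space L) (X - U)" by (rule closedin_compact_space[OF compact])
  have o: "openin (Space L) (X - K)" using compactin_imp_closedin[OF Hausdorff K] by blast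
  \<comment> \<open>Passing to complements turns a subbasic condition on the inverse into one on
    \<open>g\<close>; complements of open sets are compact here and complements of compact sets are
    open.\<close>
  have key: "(inv\<^bsub>G\<^esub> g) ` K \<subseteq> U \<longleftrightarrow> g ` (X - U) \<subseteq> X - K" if g: "g \<in> carrier G" for g
  proof
    assume a: "(inv\<^bsub>G\<^esub> g) ` K \<subseteq> U"
    show "g ` (X - U) \<subseteq> X - K"
    proof (rule image_subsetI)
      fix x assume x: "x \<in> X - U"
      have "g x \<notin> K"
      proof
        assume "g x \<in> K"
        then have "(inv\<^bsub>G\<^esub> g) (g x) \<in> U" using a by blast
        then show False using inv_apply(1)[OF g, of x] x by simp
      qed
      then show "g x \<in> X - K" using carrierD(6)[OF g, of x] x by simp
    qed
  next
    assume a: "g ` (X - U) \<subseteq> X - K"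
    show "(inv\<^bsub>G\<^esub> g) ` K \<subseteq> U"
    proof
      fix y assume "y \<in> (inv\<^bsub>G\<^esub> g) ` K"
      then obtain x where x: "x \<in> K" "y = (inv\<^bsub>G\<^esub> g) x" by blast
      then have y: "y \<in> X" using carrierD(6)[OF group.inv_closed[OF group_G g] subsetD[OF KX x(1)]] by simp
      have gy: "g y = x" using inv_apply(2)[OF g subsetD[OF KX x(1)]] unfolding x(2) .
      show "y \<in> U"
      proof (rule ccontr)
        assume "y \<notin> U"
        then have "g y \<in> X - K" using subsetD[OF a imageI[of y]] y by simp
        then show False using gy x(1) by simp
      qed
    qed
  qed
  have "{g \<in> topspace (aut_topology L). (inv\<^bsub>G\<^esub> g) ` K \<subseteq> U} = carrier G \<inter> into (X - U) (X - K)"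
    unfolding topspace_aut
  proof (rule Set.set_eqI)
    fix g
    show "g \<in> {g \<in> carrier G. (inv\<^bsub>G\<^esub> g) ` K \<subseteq> U} \<longleftrightarrow> g \<in> carrier G \<inter> into (X - U) (X - K)"
    proof (cases "g \<in> carrier G")
      case True
      then show ?thesis using key[OF True] into_iff[OF True] by (simp only: mem_Collect_eq Int_iff simp_thms)
    qed simp
  qed
  then show "openin (aut_topology L) {g \<in> topspace (aut_topology L). (inv\<^bsub>G\<^esub> g) ` K \<subseteq> U}"
    using openin_into[OF c o] by simp
qed

lemma topological_group_aut: "topological_group G (aut_topology L)"
  unfolding topological_group_def
  by (intro conjI group_G topspace_aut continuous_mult continuous_inv)

end

section \<open>Fixed points\<close>

lemma continuous_map_to_discreteI:
  assumes "\<And>x. x \<in> topspace T \<Longrightarrow> f x \<in> Y" and "\<And>y. y \<in> Y \<Longrightarrow> openin T {x \<in> topspace T. f x = y}"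
  shows "continuous_map T (discrete_topology Y) f"
  unfolding continuous_map
proof (intro conjI allI impI)
  show "f ` topspace T \<subseteq> topspace (discrete_topology Y)" using assms(1) by auto
  fix U assume "openin (discrete_topology Y) U"
  then have U: "U \<subseteq> Y" by simp
  have "{x \<in> topspace T. f x \<in> U} = (\<Union>y\<in>U. {x \<in> topspace T. f x = y})" by blast
  also have "openin T \<dots>"
    by (rule openin_clauses(3)) (use assms(2) U in blast)
  finally show "openin T {x \<in> topspace T. f x \<in> U}" .
qed

lemma ordered_fan_space:
  fixes A :: "'b RS_structure"
  assumes "ordered_fan A"
  obtains V where "Space A = discrete_topology V" "finite V"
proof -
  obtain n N v where A: "fan_coords A n N v" using ordered_fan_coords[OF assms] by (elim exE)
  show thesis
    using that[OF fan_coordsD(5)[OF A]] finite_fan_coords[OF A] unfolding fan_coordsD(6)[OF A] by blast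
qed

locale fraisse_limit =
  fixes L :: "'a RS_structure"
  assumes lim: "projective_Fraisse_limit L"
begin

sublocale compact_structure L
  by standard (rule lim[unfolded projective_Fraisse_limit_def, THEN conjunct1])

lemma L1: "ordered_fan (A :: nat RS_structure) \<Longrightarrow> \<exists>\<phi>. epimorphism L A \<phi>"
  using lim[unfolded projective_Fraisse_limit_def, THEN conjunct2, THEN conjunct1] by blast

lemma L2:
  assumes "finite (Y :: nat set)" "continuous_map (Space L) (discrete_topology Y) f"
  obtains A :: "nat RS_structure" and \<phi> f0 where "ordered_fan A" "epimorphism L A \<phi>"
    "\<And>x. x \<in> X \<Longrightarrow> f x = f0 (\<phi> x)"
proof -
  note l = lim[unfolded projective_Fraisse_limit_def, THEN conjunct2, THEN conjunct2, THEN conjunct1]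
  have "\<exists>(A :: nat RS_structure) \<phi> f0. ordered_fan A \<and> epimorphism L A \<phi> \<and> (\<forall>x\<in>X. f x = f0 (\<phi> x))"
    by (rule l[THEN spec[of _ Y], THEN spec[of _ f], THEN mp, OF conjI[OF assms]])
  then show thesis using that by blast
qed

lemma L3:
  assumes A: "ordered_fan (A :: nat RS_structure)" and \<phi>: "epimorphism L A \<phi>\<^sub>1" "epimorphism L A \<phi>\<^sub>2"
  obtains \<psi> where "\<psi> \<in> carrier G" "\<And>x. x \<in> X \<Longrightarrow> \<phi>\<^sub>2 x = \<phi>\<^sub>1 (\<psi> x)"
proof -
  note l = lim[unfolded projective_Fraisse_limit_def, THEN conjunct2, THEN conjunct2, THEN conjunct2]
  have "\<exists>\<psi>. automorphism L \<psi> \<and> (\<forall>x\<in>X. \<phi>\<^sub>2 x = \<phi>\<^sub>1 (\<psi> x))"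
    by (rule l[THEN spec[of _ A], THEN spec[of _ \<phi>\<^sub>1], THEN spec[of _ \<phi>\<^sub>2], THEN mp, OF conjI[OF A conjI[OF \<phi>]]])
  then obtain \<psi> where \<psi>: "automorphism L \<psi>" "\<forall>x\<in>X. \<phi>\<^sub>2 x = \<phi>\<^sub>1 (\<psi> x)" by (elim exE conjE)
  have e: "epimorphism L L \<psi>" and b: "bij_betw \<psi> X X" using \<psi>(1)[unfolded isomorphism_def, THEN conjunct1] \<psi>(1)[unfolded isomorphism_def, THEN conjunct2] .
  show thesis
  proof (rule that)
    have "epimorphism L L (restrict \<psi> X)" by (rule epimorphism_cong[OF e]) simp
    moreover have "bij_betw (restrict \<psi> X) X X" using b bij_betw_cong[of X "restrict \<psi> X" \<psi> X] by simp
    ultimately show "restrict \<psi> X \<in> carrier G" by (intro carrierI) auto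
    show "\<phi>\<^sub>2 x = \<phi>\<^sub>1 (restrict \<psi> X x)" if "x \<in> X" for x using \<psi>(2) that by simp
  qed
qed

lemma epimorphism_fibre_open:
  assumes "ordered_fan (A :: nat RS_structure)" "epimorphism L A \<phi>"
  shows "openin (Space L) {x \<in> X. \<phi> x = a}"
proof -
  obtain V where V: "Space A = discrete_topology V" using ordered_fan_space[OF assms(1)] by metis
  have im: "\<phi> x \<in> V" if "x \<in> X" for x
    using epimorphism_topspace[OF assms(2) that] V by simp
  have "openin (Space L) {x \<in> X. \<phi> x \<in> {a} \<inter> V}"
    by (rule openin_continuous_map_preimage[OF epimorphism_continuous[OF assms(2)]]) (simp add: V)
  moreover have "{x \<in> X. \<phi> x \<in> {a} \<inter> V} = {x \<in> X. \<phi> x = a}" using im by auto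
  ultimately show ?thesis by simp
qed

text \<open>The pair of both maps, coded as a natural number, is a continuous map to a finite
  discrete space and thus factors through a fan.\<close>

lemma common_refinement:
  fixes A1 A2 :: "nat RS_structure"
  assumes 1: "ordered_fan A1" "epimorphism L A1 \<phi>1" and 2: "ordered_fan A2" "epimorphism L A2 \<phi>2"
  obtains B :: "nat RS_structure" and \<theta> f1 f2 where "ordered_fan B" "epimorphism L B \<theta>"
    "\<forall>x\<in>X. \<phi>1 x = f1 (\<theta> x)" "\<forall>x\<in>X. \<phi>2 x = f2 (\<theta> x)"
proof -
  define f where "f x = prod_encode (\<phi>1 x, \<phi>2 x)" for x
  define Y where "Y = f ` X"
  have "continuous_map (Space L) (discrete_topology Y) f"
  proof (rule continuous_map_to_discreteI)
    show "f x \<in> Y" if "x \<in> X" for x using that by (simp add: Y_def)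
    fix y
    have "f x = y \<longleftrightarrow> \<phi>1 x = fst (prod_decode y) \<and> \<phi>2 x = snd (prod_decode y)" for x
      unfolding f_def by (metis prod.collapse prod_decode_inverse prod_encode_inverse fst_conv snd_conv)
    then have "{x \<in> X. f x = y} = {x \<in> X. \<phi>1 x = fst (prod_decode y)} \<inter> {x \<in> X. \<phi>2 x = snd (prod_decode y)}"
      by blast
    also have "openin (Space L) \<dots>"
      by (intro openin_Int epimorphism_fibre_open[OF 1] epimorphism_fibre_open[OF 2])
    finally show "openin (Space L) {x \<in> X. f x = y}" .
  qed
  moreover have "finite Y"
  proof -
    obtain V1 V2 where V: "Space A1 = discrete_topology V1" "finite V1" "Space A2 = discrete_topology V2" "finite V2"
      using ordered_fan_space[OF 1(1)] ordered_fan_space[OF 2(1)] by metis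
    have "Y \<subseteq> prod_encode ` (V1 \<times> V2)"
      using epimorphism_topspace[OF 1(2)] epimorphism_topspace[OF 2(2)] V by (auto simp: Y_def f_def)
    then show ?thesis using V finite_subset by blast
  qed
  ultimately obtain B :: "nat RS_structure" and \<theta> f0 where B: "ordered_fan B" "epimorphism L B \<theta>"
    and f0: "\<And>x. x \<in> X \<Longrightarrow> f x = f0 (\<theta> x)" using L2[of Y f] by metis
  show thesis
  proof (rule that[OF B])
    show "\<forall>x\<in>X. \<phi>1 x = fst (prod_decode (f0 (\<theta> x)))" "\<forall>x\<in>X. \<phi>2 x = snd (prod_decode (f0 (\<theta> x)))"
      by (simp_all add: f0[symmetric] f_def)
  qed
qed

lemma finite_refinement:
  fixes A :: "nat RS_structure"
  assumes A: "ordered_fan A" and "finite H" "\<And>h. h \<in> H \<Longrightarrow> epimorphism L A (\<Phi> h)"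
  shows "\<exists>(B :: nat RS_structure) \<theta>. ordered_fan B \<and> epimorphism L B \<theta> \<and> (\<forall>h\<in>H. \<exists>f. \<forall>x\<in>X. \<Phi> h x = f (\<theta> x))"
  using assms(2,3)
proof (induction H rule: finite_induct)
  case empty
  then show ?case using L1[OF A] A by blast
next
  case (insert h H)
  then obtain B :: "nat RS_structure" and \<theta> where B: "ordered_fan B" "epimorphism L B \<theta>"
    and H: "\<And>k. k \<in> H \<Longrightarrow> \<exists>f. \<forall>x\<in>X. \<Phi> k x = f (\<theta> x)" by auto
  obtain B' :: "nat RS_structure" and \<theta>' f1 f2 where B': "ordered_fan B'" "epimorphism L B' \<theta>'"
    and f: "\<forall>x\<in>X. \<theta> x = f1 (\<theta>' x)" "\<forall>x\<in>X. \<Phi> h x = f2 (\<theta>' x)"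
    by (rule common_refinement[OF B A insert.prems[OF insertI1]])
  have "\<exists>f. \<forall>x\<in>X. \<Phi> k x = f (\<theta>' x)" if k: "k \<in> insert h H" for k
  proof (cases "k = h")
    case True
    then show ?thesis using f(2) by blast
  next
    case False
    then obtain f' where "\<forall>x\<in>X. \<Phi> k x = f' (\<theta> x)" using H k by blast
    then have "\<forall>x\<in>X. \<Phi> k x = (f' \<circ> f1) (\<theta>' x)" using f(1) by simp
    then show ?thesis by (rule exI[of _ "f' \<circ> f1"])
  qed
  then show ?case using B' by blast
qed

lemma one_apply: "x \<in> X \<Longrightarrow> \<one>\<^bsub>G\<^esub> x = x"
  by (simp add: one_G)

lemma one_carrier: "\<one>\<^bsub>G\<^esub> \<in> carrier G"
  using group.is_monoid[OF group_G] by (rule monoid.one_closed)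

text \<open>A subbasic neighbourhood contains the stabilizer of a clopen set \<open>P\<close>
  between \<open>K\<close> and \<open>U\<close>, and the indicator of \<open>P\<close> factors
  through an epimorphism onto a fan. Finite intersections are handled by common refinements.\<close>

lemma small_stabilizer:
  assumes V: "openin (aut_topology L) V" "\<one>\<^bsub>G\<^esub> \<in> V"
  shows "\<exists>(A :: nat RS_structure) \<phi>. ordered_fan A \<and> epimorphism L A \<phi> \<and>
    (\<forall>g\<in>carrier G. (\<forall>x\<in>X. \<phi> (g x) = \<phi> x) \<longrightarrow> g \<in> V)"
proof -
  obtain W where W: "openin (topology_generated_by subbase) W" "V = W \<inter> carrier G"
    using V(1) unfolding aut_topology_eq openin_subtopology by blast
  have "generate_topology_on subbase W" using W(1) by (rule openin_topology_generated_by)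
  moreover have "\<one>\<^bsub>G\<^esub> \<in> W" using V(2) W(2) by blast
  ultimately have "\<exists>(A :: nat RS_structure) \<phi>. ordered_fan A \<and> epimorphism L A \<phi> \<and>
    (\<forall>g\<in>carrier G. (\<forall>x\<in>X. \<phi> (g x) = \<phi> x) \<longrightarrow> g \<in> W)"
  proof (induction rule: generate_topology_on.induct)
    case Empty
    then show ?case by simp
  next
    case (Int a b)
    then have ab: "\<one>\<^bsub>G\<^esub> \<in> a" "\<one>\<^bsub>G\<^esub> \<in> b" by simp_all
    from Int.IH(1)[OF ab(1)] obtain A1 :: "nat RS_structure" and \<phi>1 where 1: "ordered_fan A1" "epimorphism L A1 \<phi>1"
      "\<forall>g\<in>carrier G. (\<forall>x\<in>X. \<phi>1 (g x) = \<phi>1 x) \<longrightarrow> g \<in> a" by (elim exE conjE)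
    from Int.IH(2)[OF ab(2)] obtain A2 :: "nat RS_structure" and \<phi>2 where 2: "ordered_fan A2" "epimorphism L A2 \<phi>2"
      "\<forall>g\<in>carrier G. (\<forall>x\<in>X. \<phi>2 (g x) = \<phi>2 x) \<longrightarrow> g \<in> b" by (elim exE conjE)
    obtain B :: "nat RS_structure" and \<theta> f1 f2 where B: "ordered_fan B" "epimorphism L B \<theta>"
      and f: "\<forall>x\<in>X. \<phi>1 x = f1 (\<theta> x)" "\<forall>x\<in>X. \<phi>2 x = f2 (\<theta> x)"
      by (rule common_refinement[OF 1(1,2) 2(1,2)])
    have "g \<in> a \<inter> b" if g: "g \<in> carrier G" "\<forall>x\<in>X. \<theta> (g x) = \<theta> x" for g
    proof -
      have "\<forall>x\<in>X. \<phi>1 (g x) = \<phi>1 x" "\<forall>x\<in>X. \<phi>2 (g x) = \<phi>2 x"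
        using f g(2) carrierD(6)[OF g(1)] by simp_all
      then show ?thesis using 1(3) 2(3) g(1) by simp
    qed
    then show ?case using B by (intro exI[of _ B] exI[of _ \<theta>]) simp
  next
    case (UN K)
    then obtain k where k: "k \<in> K" "\<one>\<^bsub>G\<^esub> \<in> k" by (elim UnionE)
    from UN.IH[OF k] obtain A :: "nat RS_structure" and \<phi> where A: "ordered_fan A" "epimorphism L A \<phi>"
      "\<forall>g\<in>carrier G. (\<forall>x\<in>X. \<phi> (g x) = \<phi> x) \<longrightarrow> g \<in> k" by (elim exE conjE)
    then show ?case using k(1) by (intro exI[of _ A] exI[of _ \<phi>]) (simp, metis)
  next
    case (Basis s)
    then obtain K U where s: "s = into K U" "compactin (Space L) K" "openin (Space L) U"
      unfolding subbase_def by (elim CollectE exE conjE)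
    have KX: "K \<subseteq> X" by (rule compactin_subset_topspace[OF s(2)])
    have "K \<subseteq> U"
    proof
      fix x assume x: "x \<in> K"
      have "\<one>\<^bsub>G\<^esub> ` K \<subseteq> U" using Basis.prems into_iff[OF one_carrier] unfolding s(1) by simp
      then have "\<one>\<^bsub>G\<^esub> x \<in> U" using x by blast
      then show "x \<in> U" using one_apply[OF subsetD[OF KX x]] by simp
    qed
    then obtain P where P: "openin (Space L) P" "closedin (Space L) P" "K \<subseteq> P" "P \<subseteq> U"
      using compactin_clopen_between[OF zero_dim s(2,3)] by metis
    define f where "f x = (if x \<in> P then 1 else 0 :: nat)" for x
    have "continuous_map (Space L) (discrete_topology {0, 1}) f"
    proof (rule continuous_map_to_discreteI)
      show "f x \<in> {0, 1}" for x by (simp add: f_def)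
      have "{x \<in> X. f x = 1} = P" "{x \<in> X. f x = 0} = X - P"
        using openin_subset[OF P(1)] by (auto simp: f_def)
      moreover have "openin (Space L) (X - P)" using P(2) by (simp add: closedin_def)
      ultimately show "openin (Space L) {x \<in> X. f x = y}" if "y \<in> {0, 1}" for y
        using that P(1) by auto
    qed
    then obtain A :: "nat RS_structure" and \<phi> f0 where A: "ordered_fan A" "epimorphism L A \<phi>"
      and f0: "\<And>x. x \<in> X \<Longrightarrow> f x = f0 (\<phi> x)" using L2[of "{0, 1}" f] by auto
    have "g \<in> s" if g: "g \<in> carrier G" "\<forall>x\<in>X. \<phi> (g x) = \<phi> x" for g
    proof -
      have "g x \<in> U" if x: "x \<in> K" for x
      proof -
        have xX: "x \<in> X" using x KX by blast
        have "f (g x) = f x" using f0 carrierD(6)[OF g(1) xX] xX g(2) by simp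
        moreover have "f x = 1" using subsetD[OF P(3) x] by (simp add: f_def)
        ultimately have "f (g x) = 1" by simp
        then have "g x \<in> P" unfolding f_def by (metis zero_neq_one)
        then show ?thesis by (rule subsetD[OF P(4)])
      qed
      then have "g ` K \<subseteq> U" by (rule image_subsetI)
      then show ?thesis unfolding s(1) by (rule into_iff[OF g(1), THEN iffD2])
    qed
    then show ?case using A by (intro exI[of _ A] exI[of _ \<phi>]) simp
  qed
  then show ?thesis unfolding W(2) by (elim exE conjE, intro exI conjI) auto
qed

text \<open>Without fixed points, finitely many open sets \<open>Wx i\<close> and elements
  \<open>gx i\<close> with \<open>gx i\<close> moving \<open>Wx i\<close> off itself control the
  flow. Epimorphisms onto \<open>A\<close> are coloured by the set containing the corresponding
  translate of \<open>x0\<close>. A monochromatic copy yields \<open>g\<close> such that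
  \<open>g\<close> and all \<open>gx i \<otimes> g\<close> send \<open>x0\<close> into the same set,
  which is impossible.\<close>

lemma fixed_point:
  fixes T :: "'x topology"
  assumes T: "compact_space T" "Hausdorff_space T" "topspace T \<noteq> {}"
    and act: "continuous_action G (aut_topology L) T \<alpha>"
  shows "\<exists>x\<in>topspace T. \<forall>g\<in>carrier G. \<alpha> g x = x"
proof (rule ccontr)
  assume nofix: "\<not> ?thesis"
  let ?E = "topspace T"
  have ga: "group_action G ?E \<alpha>" and cont: "continuous_map (prod_topology (aut_topology L) T) T (\<lambda>(g, x). \<alpha> g x)"
    using act[unfolded continuous_action_def, THEN conjunct1] act[unfolded continuous_action_def, THEN conjunct2] .
  have \<alpha>E: "\<alpha> g x \<in> ?E" if "g \<in> carrier G" "x \<in> ?E" for g x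
    using group_action.element_image[OF ga that] by simp
  have \<alpha>mult: "\<alpha> (g \<otimes>\<^bsub>G\<^esub> h) x = \<alpha> g (\<alpha> h x)" if "g \<in> carrier G" "h \<in> carrier G" "x \<in> ?E" for g h x
    by (rule group_action.composition_rule[OF ga that(3,1,2)])
  have \<alpha>one: "\<alpha> \<one>\<^bsub>G\<^esub> x = x" if "x \<in> ?E" for x
    using group_action.id_eq_one[OF ga] that by (metis restrict_apply)
  have nbhd: "\<exists>U V. openin (aut_topology L) U \<and> openin T V \<and> g \<in> U \<and> x \<in> V \<and> (\<forall>u\<in>U. \<forall>y\<in>V. \<alpha> u y \<in> Q)"
    if g: "g \<in> carrier G" "x \<in> ?E" and Q: "openin T Q" "\<alpha> g x \<in> Q" for g x Q
  proof -
    let ?P = "prod_topology (aut_topology L) T"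
    have "openin ?P {p \<in> topspace ?P. (case p of (g, x) \<Rightarrow> \<alpha> g x) \<in> Q}"
      by (rule openin_continuous_map_preimage[OF cont Q(1)])
    moreover have "(g, x) \<in> {p \<in> topspace ?P. (case p of (g, x) \<Rightarrow> \<alpha> g x) \<in> Q}"
      using g Q(2) by (simp add: topspace_aut)
    ultimately have "\<exists>U V. openin (aut_topology L) U \<and> openin T V \<and> g \<in> U \<and> x \<in> V \<and>
        U \<times> V \<subseteq> {p \<in> topspace ?P. (case p of (g, x) \<Rightarrow> \<alpha> g x) \<in> Q}"
      unfolding openin_prod_topology_alt by (elim allE impE)
    then obtain U V where UV: "openin (aut_topology L) U" "openin T V" "g \<in> U" "x \<in> V"
      "U \<times> V \<subseteq> {p \<in> topspace ?P. (case p of (g, x) \<Rightarrow> \<alpha> g x) \<in> Q}" by (elim exE conjE)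
    have "\<alpha> u y \<in> Q" if "u \<in> U" "y \<in> V" for u y
      using subsetD[OF UV(5) SigmaI[OF that]] by simp
    then show ?thesis using UV(1-4) by blast
  qed
  \<comment> \<open>Two neighbourhoods are needed because a map to \<open>A\<close> determines a
    group element only up to the stabilizer of \<open>\<phi>\<close>: the smaller set
    \<open>W'\<close> defines the colour, and elements of \<open>V\<close> move it no further than
    \<open>W\<close>.\<close>
  define displaced where "displaced x g V W W' \<longleftrightarrow> g \<in> carrier G \<and> openin (aut_topology L) V \<and> \<one>\<^bsub>G\<^esub> \<in> V \<and>
      openin T W' \<and> x \<in> W' \<and> (\<forall>y\<in>W. \<alpha> g y \<notin> W) \<and> (\<forall>v\<in>V. \<forall>y\<in>W'. \<alpha> v y \<in> W)" for x g V W W'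
  have "\<exists>g V W W'. displaced x g V W W'" if x: "x \<in> ?E" for x
  proof -
    obtain g where g: "g \<in> carrier G" "\<alpha> g x \<noteq> x" using nofix x by blast
    obtain P Q where PQ: "openin T P" "openin T Q" "x \<in> P" "\<alpha> g x \<in> Q" "disjnt P Q"
      using T(2) x \<alpha>E[OF g(1) x] g(2) unfolding Hausdorff_space_def by metis
    obtain U0 V0 where V0: "openin T V0" "g \<in> U0" "x \<in> V0" "\<forall>u\<in>U0. \<forall>y\<in>V0. \<alpha> u y \<in> Q"
      using nbhd[OF g(1) x PQ(2,4)] by (elim exE conjE)
    define W where "W = P \<inter> V0"
    have W: "openin T W" "\<alpha> \<one>\<^bsub>G\<^esub> x \<in> W" using PQ(1,3) V0(1,3) \<alpha>one[OF x] by (simp_all add: W_def openin_Int)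
    obtain V W' where VW: "openin (aut_topology L) V" "openin T W'" "\<one>\<^bsub>G\<^esub> \<in> V" "x \<in> W'"
      "\<forall>v\<in>V. \<forall>y\<in>W'. \<alpha> v y \<in> W"
      using nbhd[OF one_carrier x W] by (elim exE conjE)
    have "\<alpha> g y \<notin> W" if "y \<in> W" for y
    proof -
      have "\<alpha> g y \<in> Q" using that V0(2,4) by (simp add: W_def)
      then show ?thesis using PQ(5) by (auto simp: W_def disjnt_iff)
    qed
    then show ?thesis using g(1) VW unfolding displaced_def
      by (intro exI[of _ g] exI[of _ V] exI[of _ W] exI[of _ W'] conjI) auto
  qed
  then obtain gx Vx Wx Wx' where all: "\<And>x. x \<in> ?E \<Longrightarrow> displaced x (gx x) (Vx x) (Wx x) (Wx' x)"
    by metis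
  have gx: "gx x \<in> carrier G" and Vx: "openin (aut_topology L) (Vx x)" "\<one>\<^bsub>G\<^esub> \<in> Vx x"
    and Wx': "openin T (Wx' x)" "x \<in> Wx' x" and disj: "y \<in> Wx x \<Longrightarrow> \<alpha> (gx x) y \<notin> Wx x"
    and VW: "v \<in> Vx x \<Longrightarrow> y \<in> Wx' x \<Longrightarrow> \<alpha> v y \<in> Wx x" if "x \<in> ?E" for x y v
    using all[OF that] unfolding displaced_def by blast+
  have "compactin T ?E" using T(1) by (simp add: compact_space_def)
  moreover have "?E \<subseteq> \<Union>(Wx' ` ?E)" using Wx'(2) by blast
  ultimately have "\<exists>\<F>. finite \<F> \<and> \<F> \<subseteq> Wx' ` ?E \<and> ?E \<subseteq> \<Union>\<F>"
    using Wx'(1) by (intro compactinD) auto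
  then obtain \<F> where \<F>: "finite \<F>" "\<F> \<subseteq> Wx' ` ?E" "?E \<subseteq> \<Union>\<F>" by (elim exE conjE)
  obtain I where I: "I \<subseteq> ?E" "finite I" "\<F> = Wx' ` I"
    using finite_subset_image[OF \<F>(1,2)] by blast
  have cover: "\<exists>i\<in>I. y \<in> Wx' i" if "y \<in> ?E" for y using \<F>(3) that unfolding I(3) by blast
  obtain x0 where x0: "x0 \<in> ?E" using T(3) by blast
  have I0: "I \<noteq> {}" using cover[OF x0] by blast
  define V where "V = (\<Inter>i\<in>I. Vx i)"
  have "openin (aut_topology L) V"
    unfolding V_def by (rule openin_INT2[OF I(2) I0]) (rule Vx(1)[OF subsetD[OF I(1)]])
  moreover have "\<one>\<^bsub>G\<^esub> \<in> V" unfolding V_def by (rule INT_I) (rule Vx(2)[OF subsetD[OF I(1)]])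
  ultimately obtain A :: "nat RS_structure" and \<phi> where A: "ordered_fan A" "epimorphism L A \<phi>"
    and stab: "\<forall>g\<in>carrier G. (\<forall>x\<in>X. \<phi> (g x) = \<phi> x) \<longrightarrow> g \<in> V"
    using small_stabilizer by meson
  \<comment> \<open>The translates to be compared in the end; the unit is included so that
    \<open>g\<close> itself gets the common colour.\<close>
  define H where "H = insert \<one>\<^bsub>G\<^esub> (gx ` I)"
  have H: "finite H" "\<And>h. h \<in> H \<Longrightarrow> h \<in> carrier G"
    using I gx one_carrier by (auto simp: H_def)
  have eH: "epimorphism L A (\<phi> \<circ> h)" if "h \<in> H" for h
    by (rule epimorphism_comp[OF carrierD(2)[OF H(2)[OF that]] A(2)])
  have "\<exists>(B :: nat RS_structure) \<theta>. ordered_fan B \<and> epimorphism L B \<theta> \<and> (\<forall>h\<in>H. \<exists>f. \<forall>x\<in>X. (\<phi> \<circ> h) x = f (\<theta> x))"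
    by (rule finite_refinement[OF A(1) H(1)]) (rule eH)
  then obtain B :: "nat RS_structure" and \<theta> where B: "ordered_fan B" "epimorphism L B \<theta>"
    and fac: "\<forall>h\<in>H. \<exists>f. \<forall>x\<in>X. (\<phi> \<circ> h) x = f (\<theta> x)"
    by (elim exE conjE)
  obtain VB where VB: "Space B = discrete_topology VB" using ordered_fan_space[OF B(1)] by metis
  have fac': "\<exists>f. epimorphism B A f \<and> (\<forall>x\<in>X. (\<phi> \<circ> h) x = f (\<theta> x))" if h: "h \<in> H" for h
  proof -
    obtain f where f: "\<forall>x\<in>X. (\<phi> \<circ> h) x = f (\<theta> x)" using bspec[OF fac h] by (elim exE)
    have "epimorphism B A f"
      by (rule epimorphism_factor[OF B(2) eH[OF h] _ VB]) (rule bspec[OF f])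
    then show ?thesis using f by blast
  qed
  define rep where "rep \<psi> g \<longleftrightarrow> g \<in> carrier G \<and> (\<forall>x\<in>X. \<psi> x = \<phi> (g x))" for \<psi> g
  \<comment> \<open>The colour depends on a chosen representative. Two representatives differ by the
    factor \<open>u\<close> below, which preserves \<open>\<phi>\<close> and so lies in
    \<open>V\<close>; hence every representative lands in \<open>Wx\<close> of the chosen
    colour.\<close>
  define col where "col \<psi> = (SOME i. i \<in> I \<and> \<alpha> (SOME g. rep \<psi> g) x0 \<in> Wx' i)" for \<psi>
  have col: "col \<psi> \<in> I \<and> \<alpha> g x0 \<in> Wx (col \<psi>)" if g: "rep \<psi> g" for \<psi> g
  proof -
    define k where "k = (SOME g. rep \<psi> g)"
    have k: "rep \<psi> k" unfolding k_def by (rule someI[of "rep \<psi>", OF g])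
    have gc: "g \<in> carrier G" and kc: "k \<in> carrier G" using g k by (simp_all add: rep_def)
    have kE: "\<alpha> k x0 \<in> ?E" by (rule \<alpha>E[OF kc x0])
    have "\<exists>i. i \<in> I \<and> \<alpha> k x0 \<in> Wx' i" using cover[OF kE] by blast
    from someI_ex[OF this] have ci: "col \<psi> \<in> I" "\<alpha> k x0 \<in> Wx' (col \<psi>)"
      unfolding col_def k_def[symmetric] by simp_all
    have ik: "inv\<^bsub>G\<^esub> k \<in> carrier G" by (rule group.inv_closed[OF group_G kc])
    define u where "u = g \<otimes>\<^bsub>G\<^esub> inv\<^bsub>G\<^esub> k"
    have uc: "u \<in> carrier G" unfolding u_def by (rule monoid.m_closed[OF group.is_monoid[OF group_G] gc ik])
    have "\<phi> (u x) = \<phi> x" if x: "x \<in> X" for x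
    proof -
      have ikx: "(inv\<^bsub>G\<^esub> k) x \<in> X" by (rule carrierD(6)[OF ik x])
      have "\<phi> (u x) = \<phi> (g ((inv\<^bsub>G\<^esub> k) x))" unfolding u_def mult_apply[OF gc ik x] ..
      also have "\<dots> = \<psi> ((inv\<^bsub>G\<^esub> k) x)" using g ikx by (simp add: rep_def)
      also have "\<dots> = \<phi> (k ((inv\<^bsub>G\<^esub> k) x))" using k ikx by (simp add: rep_def)
      also have "k ((inv\<^bsub>G\<^esub> k) x) = x" by (rule inv_apply(2)[OF kc x])
      finally show ?thesis .
    qed
    then have "u \<in> V" using stab uc by blast
    then have uV: "u \<in> Vx (col \<psi>)" using ci(1) unfolding V_def by (rule INT_D)
    have "u \<otimes>\<^bsub>G\<^esub> k = g"
      unfolding u_def using group.inv_solve_right'[OF group_G] gc kc ik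
      by (simp add: monoid.m_assoc[OF group.is_monoid[OF group_G]] group.l_inv[OF group_G] monoid.r_one[OF group.is_monoid[OF group_G]])
    then have "\<alpha> g x0 = \<alpha> u (\<alpha> k x0)" using \<alpha>mult[OF uc kc x0] by simp
    moreover have "\<alpha> u (\<alpha> k x0) \<in> Wx (col \<psi>)"
      by (rule VW[OF subsetD[OF I(1) ci(1)] uV ci(2)])
    ultimately show ?thesis using ci(1) by simp
  qed
  have col_cong: "col \<psi> = col \<psi>'" if "\<And>x. x \<in> X \<Longrightarrow> \<psi> x = \<psi>' x" for \<psi> \<psi>'
  proof -
    have "rep \<psi> = rep \<psi>'" using that by (auto simp: rep_def fun_eq_iff)
    then show ?thesis by (simp add: col_def)
  qed
  obtain ix :: "'x \<Rightarrow> nat" and r where ix: "ix ` I = {i. i < r}" "inj_on ix I"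
    using finite_imp_inj_to_nat_seg[OF I(2)] by (elim exE conjE)
  have ixr: "ix i < r" if "i \<in> I" for i using imageI[OF that, of ix] unfolding ix(1) by simp
  have r0: "0 < r" using I0 ixr by fastforce
  obtain C :: "nat RS_structure" where C: "ordered_fan C"
    and ram: "\<forall>\<kappa> :: (nat \<Rightarrow> nat) \<Rightarrow> nat. (\<forall>g. \<kappa> g < r) \<longrightarrow>
      (\<forall>g g'. (\<forall>x\<in>pts C. g x = g' x) \<longrightarrow> \<kappa> g = \<kappa> g') \<longrightarrow>
      (\<exists>\<gamma> c. epimorphism C B \<gamma> \<and> (\<forall>f. epimorphism B A f \<longrightarrow> \<kappa> (f \<circ> \<gamma>) = c))"
    using fan_ramsey[OF A(1) B(1), of r] by (elim exE conjE)
  obtain \<theta>' where \<theta>': "epimorphism L C \<theta>'" using L1[OF C] by (elim exE)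
  \<comment> \<open>The value 0 is a default for maps that do not represent a group element; it is a
    legal colour because \<open>I\<close> is nonempty.\<close>
  define \<kappa> where "\<kappa> f = (if col (f \<circ> \<theta>') \<in> I then ix (col (f \<circ> \<theta>')) else 0)" for f
  have "\<exists>\<gamma> c. epimorphism C B \<gamma> \<and> (\<forall>f. epimorphism B A f \<longrightarrow> \<kappa> (f \<circ> \<gamma>) = c)"
  proof (rule ram[THEN spec, THEN mp, THEN mp])
    show "\<forall>g. \<kappa> g < r" using ixr r0 by (simp add: \<kappa>_def)
    show "\<forall>g g'. (\<forall>x\<in>pts C. g x = g' x) \<longrightarrow> \<kappa> g = \<kappa> g'"
    proof (intro allI impI)
      fix g g' :: "nat \<Rightarrow> nat" assume eq: "\<forall>x\<in>pts C. g x = g' x"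
      have "col (g \<circ> \<theta>') = col (g' \<circ> \<theta>')"
        by (rule col_cong) (simp add: bspec[OF eq epimorphism_topspace[OF \<theta>']])
      then show "\<kappa> g = \<kappa> g'" by (simp add: \<kappa>_def)
    qed
  qed
  then obtain \<gamma> c where \<gamma>: "epimorphism C B \<gamma>" and c: "\<forall>f. epimorphism B A f \<longrightarrow> \<kappa> (f \<circ> \<gamma>) = c"
    by (elim exE conjE)
  \<comment> \<open>Homogeneity of the limit moves \<open>\<theta>\<close> to the monochromatic copy
    of \<open>B\<close>. For \<open>h\<close> in \<open>H\<close>, the map
    \<open>\<phi> \<circ> h \<circ> g\<close> then equals
    \<open>f \<circ> \<gamma> \<circ> \<theta>'\<close> on \<open>X\<close>, with \<open>f\<close>
    the factor of \<open>\<phi> \<circ> h\<close> through \<open>\<theta>\<close>, so all products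
    \<open>h \<otimes> g\<close> receive the colour \<open>c\<close>.\<close>
  obtain g where g: "g \<in> carrier G" and gx': "\<And>x. x \<in> X \<Longrightarrow> (\<gamma> \<circ> \<theta>') x = \<theta> (g x)"
    by (rule L3[OF B epimorphism_comp[OF \<theta>' \<gamma>]]) blast
  have mono: "\<exists>i\<in>I. ix i = c \<and> \<alpha> (h \<otimes>\<^bsub>G\<^esub> g) x0 \<in> Wx i" if h: "h \<in> H" for h
  proof -
    obtain f where f: "epimorphism B A f" "\<forall>x\<in>X. (\<phi> \<circ> h) x = f (\<theta> x)" using fac'[OF h] by (elim exE conjE)
    have hc: "h \<in> carrier G" by (rule H(2)[OF h])
    have "(f \<circ> \<gamma> \<circ> \<theta>') x = \<phi> ((h \<otimes>\<^bsub>G\<^esub> g) x)" if x: "x \<in> X" for x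
      using gx'[OF x] bspec[OF f(2) carrierD(6)[OF g x]] mult_apply[OF hc g x] by simp
    then have "rep (f \<circ> \<gamma> \<circ> \<theta>') (h \<otimes>\<^bsub>G\<^esub> g)"
      using monoid.m_closed[OF group.is_monoid[OF group_G] hc g] by (simp add: rep_def)
    from col[OF this] have "col (f \<circ> \<gamma> \<circ> \<theta>') \<in> I" "\<alpha> (h \<otimes>\<^bsub>G\<^esub> g) x0 \<in> Wx (col (f \<circ> \<gamma> \<circ> \<theta>'))" by simp_all
    moreover from this have "ix (col (f \<circ> \<gamma> \<circ> \<theta>')) = c"
      using c[THEN spec, THEN mp, OF f(1)] by (simp add: \<kappa>_def)
    ultimately show ?thesis by blast
  qed
  obtain i where i: "i \<in> I" "ix i = c" "\<alpha> (\<one>\<^bsub>G\<^esub> \<otimes>\<^bsub>G\<^esub> g) x0 \<in> Wx i"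
    using mono[of "\<one>\<^bsub>G\<^esub>"] unfolding H_def by blast
  obtain j where j: "j \<in> I" "ix j = c" "\<alpha> (gx i \<otimes>\<^bsub>G\<^esub> g) x0 \<in> Wx j"
    using mono[of "gx i"] i(1) unfolding H_def by blast
  have "j = i" using inj_onD[OF ix(2), of j i] i j by simp
  moreover have iE: "i \<in> ?E" using i(1) I(1) by blast
  have "\<alpha> (\<one>\<^bsub>G\<^esub> \<otimes>\<^bsub>G\<^esub> g) x0 = \<alpha> g x0" "\<alpha> (gx i \<otimes>\<^bsub>G\<^esub> g) x0 = \<alpha> (gx i) (\<alpha> g x0)"
    using \<alpha>mult[OF one_carrier g x0] \<alpha>mult[OF gx[OF iE] g x0] \<alpha>one[OF \<alpha>E[OF g x0]] by simp_all
  ultimately show False using disj[OF iE] i(3) j(3) by simp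
qed

end

theorem theorem2p8:
  fixes L :: "'a RS_structure"
  assumes "projective_Fraisse_limit L"
  shows "extremely_amenable TYPE('x) (aut_group L) (aut_topology L)"
proof -
  interpret fraisse_limit L by standard (rule assms)
  show ?thesis
    unfolding extremely_amenable_def using topological_group_aut fixed_point by blast
qed

end
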